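(* Let $N\ge1$ and let $f(\theta_1,\theta_2,\theta_3)$ be a smooth function which is $2\pi$-periodic in each variable. Let $z(x)=\frac1{1-e^{-x}}$. (i) If $\Re\alpha_1,\Re\alpha_2,\Re\beta>0$, then $$\begin{aligned}J(\alpha_1,\alpha_2;\beta):=&-e^{-\alpha_1-\alpha_2-\beta}\int_{U(N)}\frac{\Lambda_X'}{\Lambda_X}(e^{-\alpha_1})\frac{\Lambda_X'}{\Lambda_X}(e^{-\alpha_2})\frac{\Lambda_{X^*}'}{\Lambda_{X^*}}(e^{-\beta})\,dX\\ =&\;e^{-N(\alpha_1+\beta)}z(\alpha_1+\beta)z(-\alpha_1-\beta)\left(\frac{z'}z(\alpha_2-\alpha_1)-\frac{z'}z(\alpha_2+\beta)\right)\\ &+e^{-N(\alpha_2+\beta)}z(\alpha_2+\beta)z(-\alpha_2-\beta)\left(\frac{z'}z(\alpha_1-\alpha_2)-\frac{z'}z(\alpha_1+\beta)\right).\end{aligned}$$ (ii) If $\Re\alpha,\Re\beta>0$, then $$J(\alpha;\beta):=e^{-\alpha-\beta}\int_{U(N)}\frac{\Lambda_X'}{\Lambda_X}(e^{-\alpha})\frac{\Lambda_{X^*}'}{\Lambda_{X^*}}(e^{-\beta})\,dX=\left(\frac{z'}z\right)'(\alpha+\beta)+e^{-N(\alpha+\beta)}z(\alpha+\beta)z(-\alpha-\beta).$$ (iii) With $J$ at purely imaginary arguments given by the right-hand sides of the formulas in (i) and (ii), $$\begin{aligned}&\int_{U(N)}\ \sum_{\substack{1\le j_1,j_2,j_3\le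 N\\ \text{pairwise distinct}}}f(\theta_{j_1},\theta_{j_2},\theta_{j_3})\,dX\\ &=\frac1{(2\pi)^3}\int_{-\pi}^{\pi}\int_{-\pi}^{\pi}\int_{-\pi}^{\pi}\Big(J(i\theta_1,i\theta_2;-i\theta_3)+J(i\theta_1,i\theta_3;-i\theta_2)+J(i\theta_2,i\theta_3;-i\theta_1)\\ &\qquad+J(-i\theta_1,-i\theta_2;i\theta_3)+J(-i\theta_1,-i\theta_3;i\theta_2)+J(-i\theta_2,-i\theta_3;i\theta_1)\\ &\qquad+N\big(J(-i\theta_1;i\theta_3)+J(-i\theta_2;i\theta_3)+J(-i\theta_1;i\theta_2)+J(-i\theta_3;i\theta_2)+J(-i\theta_2;i\theta_1)+J(-i\theta_3;i\theta_1)\big)\\ &\qquad+N^3\Big)f(\theta_1,\theta_2,\theta_3)\,d\theta_1\,d\theta_2\,d\theta_3.\end{aligned}$$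
   Context: $U(N)$ is the group of $N\times N$ unitary matrices and $dX$ is Haar probability measure on it. The eigenvalues of $X\in U(N)$ are written $e^{i\theta_1},\dots,e^{i\theta_N}$; $X^*$ is the conjugate transpose of $X$. The characteristic polynomial is $\Lambda_X(s)=\det(I-sX^* )=\prod_{n=1}^N(1-se^{-i\theta_n})$, and $\Lambda_X'$ is its derivative in $s$. For class functions, Haar measure is given by Weyl's formula: $dX=\prod_{1\le j<k\le N}|e^{i\theta_k}-e^{i\theta_j}|^2\,\frac{d\theta_1\cdots d\theta_N}{N!(2\pi)^N}$ on $[0,2\pi]^N$. The singularity at $\alpha_1=\alpha_2$ of the explicit formula in (i) is removable and is filled in by continuity. Likewise the bracketed sum in the integrand in (iii) is understood with its removable singularities (at coincidences of the $\theta_j$ modulo $2\pi$) filled in by continuity. *)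

theory Defs
  imports "HOL-Probability.Probability"
begin

definition ctranspose :: "complex^'n^'m \<Rightarrow> complex^'m^'n" where
  "ctranspose X = (\<chi> i j. cnj (X $ j $ i))"

definition unitary_group :: "(complex^'n^'n) set" where
  "unitary_group = {X. X ** ctranspose X = mat 1 \<and> ctranspose X ** X = mat 1}"

text \<open>Normalized Haar measure, characterized among Borel probability measures on the group by
  left invariance; the group being compact, right invariance follows.\<close>

definition haar_prob :: "(complex^'n^'n) measure \<Rightarrow> bool" where
  "haar_prob M \<longleftrightarrow> prob_space M
     \<and> sets M = sets (restrict_space borel unitary_group)
     \<and> (\<forall>U\<in>unitary_group. distr M M (\<lambda>X. U ** X) = M)"

text \<open>The numbers $e^{i\theta_n}$ are the eigenvalues of $X$, listed with algebraic
  multiplicity.\<close>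

definition eigenangles :: "complex^'n^'n \<Rightarrow> ('n \<Rightarrow> real) \<Rightarrow> bool" where
  "eigenangles X \<theta> \<longleftrightarrow> (\<forall>w. det (mat w - X) = (\<Prod>n\<in>UNIV. w - cis (\<theta> n)))"

definition Lam :: "complex^'n^'n \<Rightarrow> complex \<Rightarrow> complex" where
  "Lam X s = det (mat 1 - mat s ** ctranspose X)"

definition Lam_logderiv :: "complex^'n^'n \<Rightarrow> complex \<Rightarrow> complex" where
  "Lam_logderiv X s = deriv (Lam X) s / Lam X s"

definition zfun :: "complex \<Rightarrow> complex" where
  "zfun x = 1 / (1 - exp (- x))"

definition z_logderiv :: "complex \<Rightarrow> complex" where
  "z_logderiv x = deriv zfun x / zfun x"

text \<open>The function \<open>F\<close>, given by a formula meaningful on \<open>D\<close>, with its removable singularities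
  outside \<open>D\<close> filled in by continuity.\<close>

definition fill_in :: "'a::topological_space set \<Rightarrow> ('a \<Rightarrow> 'b::t2_space) \<Rightarrow> 'a \<Rightarrow> 'b" where
  "fill_in D F p = (if p \<in> D then F p else Lim (at p within D) F)"

text \<open>The explicit expressions for $J(\alpha_1,\alpha_2;\beta)$ and $J(\alpha;\beta)$. The former is
  singular not only at $\alpha_1=\alpha_2$ but, by periodicity, whenever
  $\alpha_1-\alpha_2\in 2\pi i\,\mathbf{Z}$, and also where $\alpha_1+\beta$ or $\alpha_2+\beta$ lies in
  $2\pi i\,\mathbf{Z}$; the latter singularities do not occur when all real parts are positive.\<close>

definition J3_formula :: "nat \<Rightarrow> complex \<times> complex \<times> complex \<Rightarrow> complex" where
  "J3_formula N = (\<lambda>(\<alpha>1, \<alpha>2, \<beta>).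
     exp (- of_nat N * (\<alpha>1 + \<beta>)) * zfun (\<alpha>1 + \<beta>) * zfun (- \<alpha>1 - \<beta>)
       * (z_logderiv (\<alpha>2 - \<alpha>1) - z_logderiv (\<alpha>2 + \<beta>))
     + exp (- of_nat N * (\<alpha>2 + \<beta>)) * zfun (\<alpha>2 + \<beta>) * zfun (- \<alpha>2 - \<beta>)
       * (z_logderiv (\<alpha>1 - \<alpha>2) - z_logderiv (\<alpha>1 + \<beta>)))"

definition J3_regular :: "(complex \<times> complex \<times> complex) set" where
  "J3_regular = {(\<alpha>1, \<alpha>2, \<beta>). exp (\<alpha>1 - \<alpha>2) \<noteq> 1 \<and> exp (\<alpha>1 + \<beta>) \<noteq> 1 \<and> exp (\<alpha>2 + \<beta>) \<noteq> 1}"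

definition J3 :: "nat \<Rightarrow> complex \<Rightarrow> complex \<Rightarrow> complex \<Rightarrow> complex" where
  "J3 N \<alpha>1 \<alpha>2 \<beta> = fill_in J3_regular (J3_formula N) (\<alpha>1, \<alpha>2, \<beta>)"

definition J2 :: "nat \<Rightarrow> complex \<Rightarrow> complex \<Rightarrow> complex" where
  "J2 N \<alpha> \<beta> = deriv z_logderiv (\<alpha> + \<beta>)
     + exp (- of_nat N * (\<alpha> + \<beta>)) * zfun (\<alpha> + \<beta>) * zfun (- \<alpha> - \<beta>)"

definition J_bracket :: "nat \<Rightarrow> real \<times> real \<times> real \<Rightarrow> complex" where
  "J_bracket N = (\<lambda>(\<theta>1, \<theta>2, \<theta>3).
     let t1 = \<i> * of_real \<theta>1; t2 = \<i> * of_real \<theta>2; t3 = \<i> * of_real \<theta>3 in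
       J3 N t1 t2 (- t3) + J3 N t1 t3 (- t2) + J3 N t2 t3 (- t1)
     + J3 N (- t1) (- t2) t3 + J3 N (- t1) (- t3) t2 + J3 N (- t2) (- t3) t1
     + of_nat N * (J2 N (- t1) t3 + J2 N (- t2) t3 + J2 N (- t1) t2
                   + J2 N (- t3) t2 + J2 N (- t2) t1 + J2 N (- t3) t1)
     + of_nat N ^ 3)"

definition noncoincident :: "(real \<times> real \<times> real) set" where
  "noncoincident = {(\<theta>1, \<theta>2, \<theta>3). cis \<theta>1 \<noteq> cis \<theta>2 \<and> cis \<theta>1 \<noteq> cis \<theta>3 \<and> cis \<theta>2 \<noteq> cis \<theta>3}"

fun times_differentiable :: "nat \<Rightarrow> ('a::real_normed_vector \<Rightarrow> 'b::real_normed_vector) \<Rightarrow> bool" where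
  "times_differentiable 0 f \<longleftrightarrow> continuous_on UNIV f"
| "times_differentiable (Suc k) f \<longleftrightarrow> (\<forall>x. f differentiable (at x))
     \<and> (\<forall>v. times_differentiable k (\<lambda>x. frechet_derivative f (at x) v))"

definition smooth :: "('a::real_normed_vector \<Rightarrow> 'b::real_normed_vector) \<Rightarrow> bool" where
  "smooth f \<longleftrightarrow> (\<forall>k. times_differentiable k f)"

definition periodic3 :: "(real \<times> real \<times> real \<Rightarrow> complex) \<Rightarrow> bool" where
  "periodic3 f \<longleftrightarrow> (\<forall>x y z. f (x + 2 * pi, y, z) = f (x, y, z)
     \<and> f (x, y + 2 * pi, z) = f (x, y, z) \<and> f (x, y, z + 2 * pi) = f (x, y, z))"

end

theory Submission
  imports Defs "HOL-Computational_Algebra.Fundamental_Theorem_Algebra"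
begin

text \<open>
  Weyl's formula is not used. Left invariance makes the expectation of a derivative along the Lie
  algebra vanish, hence also that of $\Omega F$ for the Casimir operator $\Omega$. On polynomials in the
  power traces $p_k(X) = \mathrm{tr}\,X^k$, written in the eigenvalues and multiplied by the Vandermonde
  alternant $a_\rho$, the operator $\Omega$ is diagonal: it scales the monomial with exponent $\nu$ by
  $\sum_n Q(\nu_n) - \sum_n Q(\rho_n)$, where $Q(m) = m(m-N+1)$. For distinct exponents this vanishes only if
  $\nu$ is a permutation of $\rho = (0,\dots,N-1)$. Applying $1 - \Omega/\lambda$ for the finitely many nonzero
  eigenvalues $\lambda$ that occur leaves the expectation unchanged, so
  $\mathbf{E}[p_{k_1}\cdots p_{k_r}]$ is the coefficient of the monomial $\rho$ in $p_{k_1}\cdots p_{k_r}\,a_\rho$.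
  For $r \le 3$ this gives (i) and (ii) by summing geometric series, since with $u = e^{-\alpha_1-\beta}$ and
  $v = e^{-\alpha_2-\beta}$ the right-hand side of (i) is
  $\frac{uv\,(u^N-v^N)}{(1-u)(1-v)(u-v)}$. In (iii) the bracket is the $3 \times 3$ determinant of the
  Dirichlet kernel; trigonometric monomials are checked directly, and the general case follows by density.
\<close>

section \<open>Integration by parts on the unitary group\<close>

text \<open>The function Q comes from representation theory. By Weyl's character formula,
  multiplication by a_rho turns the irreducible character of highest weight lambda into the
  alternant of exponent nu = lambda + rho, and the sum of Q(nu_n) - Q(rho_n) is the Casimir
  eigenvalue on that representation. Neither fact is assumed; the diagonal form is verified on
  products of power sums. Two obstacles shape the argument. Single eigenvalues need not be
  differentiable where they collide, and the given eigenangles need not be measurable in X. So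
  derivatives are taken of traces of powers, through matrix entries, and the resulting terms are
  recorded as lists of exponents. The same lists act on formal Laurent polynomials, where
  diagonality is pure algebra; \<open>casimir\<close> is the syntax shared by both sides.
  Eigenvalues are substituted only afterwards, for one fixed X at a time, and the Vandermonde
  determinant is cancelled then.\<close>

lemma ctranspose_mult: "ctranspose (A ** B) = ctranspose B ** ctranspose A"
  by (simp add: ctranspose_def matrix_matrix_mult_def vec_eq_iff mult.commute)

lemma ctranspose_ctranspose [simp]: "ctranspose (ctranspose A) = A"
  by (simp add: ctranspose_def vec_eq_iff)

lemma ctranspose_nth [simp]: "ctranspose X $ i $ j = cnj (X $ j $ i)"
  by (simp add: ctranspose_def)

lemma ctranspose_add: "ctranspose (A + B) = ctranspose A + ctranspose B"
  by (simp add: vec_eq_iff)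

lemma ctranspose_scaleR: "ctranspose (c *\<^sub>R A) = c *\<^sub>R ctranspose A"
  by (simp add: vec_eq_iff)

lemma ctranspose_mat_one [simp]: "ctranspose (mat 1) = mat 1"
  by (simp add: vec_eq_iff mat_def)

lemma unitary_group_mult:
  assumes "U \<in> unitary_group" "V \<in> unitary_group"
  shows "U ** V \<in> unitary_group"
proof -
  have "U ** V ** (ctranspose V ** ctranspose U) = U ** (V ** ctranspose V) ** ctranspose U"
    "ctranspose V ** ctranspose U ** (U ** V) = ctranspose V ** (ctranspose U ** U) ** V"
    by (simp_all add: matrix_mul_assoc)
  thus ?thesis using assms by (simp add: unitary_group_def ctranspose_mult)
qed

lemma mat_one_in_unitary_group [simp]: "mat 1 \<in> unitary_group"
  by (simp add: unitary_group_def)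

lemma continuous_on_matrix_mult [continuous_intros]:
  fixes f :: "'a::topological_space \<Rightarrow> complex^'n^'m" and g :: "'a \<Rightarrow> complex^'k^'n"
  assumes "continuous_on S f" "continuous_on S g"
  shows "continuous_on S (\<lambda>x. f x ** g x)"
  unfolding matrix_matrix_mult_def using assms by (intro continuous_intros)

lemma continuous_on_ctranspose [continuous_intros]:
  fixes f :: "'a::topological_space \<Rightarrow> complex^'n^'m"
  assumes "continuous_on S f"
  shows "continuous_on S (\<lambda>x. ctranspose (f x))"
  unfolding ctranspose_def using assms by (intro continuous_intros)

section \<open>Compactness of the unitary group\<close>

lemma norm_unitary_entry_le:
  assumes "X \<in> unitary_group"
  shows "norm (X $ i $ j) \<le> 1"
proof -
  have "(X ** ctranspose X) $ i $ i = 1"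
    using assms by (simp add: unitary_group_def mat_def)
  hence "(\<Sum>k\<in>UNIV. X $ i $ k * cnj (X $ i $ k)) = 1"
    by (simp add: matrix_matrix_mult_def)
  hence "complex_of_real (\<Sum>k\<in>UNIV. (norm (X $ i $ k))\<^sup>2) = 1"
    by (simp flip: complex_norm_square)
  hence "(\<Sum>k\<in>UNIV. (norm (X $ i $ k))\<^sup>2) = 1"
    using of_real_eq_1_iff by blast
  moreover have "(norm (X $ i $ j))\<^sup>2 \<le> (\<Sum>k\<in>UNIV. (norm (X $ i $ k))\<^sup>2)"
    by (rule member_le_sum) auto
  ultimately show ?thesis
    by (simp add: power_le_one_iff abs_square_le_1)
qed

lemma compact_unitary_group: "compact (unitary_group :: (complex^'n^'n) set)"
proof -
  have "closed (unitary_group :: (complex^'n^'n) set)"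
    unfolding unitary_group_def
    by (intro closed_Collect_conj closed_Collect_eq continuous_intros)
  moreover have "bounded (unitary_group :: (complex^'n^'n) set)"
    unfolding bounded_iff
  proof (intro exI ballI)
    fix X :: "complex^'n^'n" assume X: "X \<in> unitary_group"
    have "norm X \<le> (\<Sum>i\<in>UNIV. norm (X $ i))"
      unfolding norm_vec_def by (intro L2_set_le_sum) auto
    also have "\<dots> \<le> (\<Sum>i\<in>UNIV. \<Sum>j\<in>UNIV. norm (X $ i $ j))"
      unfolding norm_vec_def[of "X $ _"] by (intro sum_mono L2_set_le_sum) auto
    also have "\<dots> \<le> (\<Sum>i\<in>(UNIV::'n set). \<Sum>j\<in>(UNIV::'n set). 1)"
      using X by (intro sum_mono norm_unitary_entry_le)
    finally show "norm X \<le> (\<Sum>i\<in>(UNIV::'n set). \<Sum>j\<in>(UNIV::'n set). 1)" .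
  qed
  ultimately show ?thesis by (simp add: compact_eq_bounded_closed)
qed

text \<open>For $A^3 = -A$ this is Rodrigues' formula for $\exp(\phi A)$.\<close>

definition rot :: "complex^'n^'n \<Rightarrow> real \<Rightarrow> complex^'n^'n" where
  "rot A \<phi> = mat 1 + sin \<phi> *\<^sub>R A + (1 - cos \<phi>) *\<^sub>R (A ** A)"

definition rot_generator :: "complex^'n^'n \<Rightarrow> bool" where
  "rot_generator A \<longleftrightarrow> ctranspose A = - A \<and> A ** A ** A = - A"

lemma matrix_mult_minus_left: "(- A :: 'a::ring_1^'n^'m) ** B = - (A ** B)"
  by (simp add: matrix_matrix_mult_def vec_eq_iff sum_negf)

lemma matrix_mult_minus_right: "(A :: 'a::ring_1^'n^'m) ** (- B) = - (A ** B)"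
  by (simp add: matrix_matrix_mult_def vec_eq_iff sum_negf)

lemma matrix_add_rdistrib: "(B + C :: 'a::semiring_1^'n^'m) ** A = B ** A + C ** A"
  by (simp add: matrix_matrix_mult_def vec_eq_iff sum.distrib distrib_right)

lemma matrix_scaleR_left: "(c *\<^sub>R A :: 'a::real_algebra_1^'n^'m) ** B = c *\<^sub>R (A ** B)"
  by (simp add: matrix_matrix_mult_def vec_eq_iff scaleR_sum_right)

lemma matrix_scaleR_right: "(A :: 'a::real_algebra_1^'n^'m) ** (c *\<^sub>R B) = c *\<^sub>R (A ** B)"
  by (simp add: matrix_matrix_mult_def vec_eq_iff scaleR_sum_right)

text \<open>With \<open>B = A ** A\<close> the relation on the cube gives
  \<open>A ** B = - A\<close> and \<open>B ** B = - B\<close>, so the span of \<open>mat 1\<close>,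
  \<open>A\<close>, \<open>B\<close> is closed under multiplication. Comparing coefficients leaves
  the addition theorems for sine and cosine.\<close>

lemma rot_add:
  assumes "rot_generator A"
  shows "rot A (\<phi> + \<psi>) = rot A \<phi> ** rot A \<psi>"
proof -
  have 3: "A ** A ** A = - A" using assms by (simp add: rot_generator_def)
  have 4: "A ** A ** A ** A = - (A ** A)" by (simp add: 3 matrix_mult_minus_left)
  have gen: "(mat 1 + a *\<^sub>R A + b *\<^sub>R B) ** (mat 1 + c *\<^sub>R A + d *\<^sub>R B)
      = mat 1 + (a + c - a * d - b * c) *\<^sub>R A + (b + d + a * c - b * d) *\<^sub>R B"
    if "A ** A = B" "A ** B = - A" "B ** A = - A" "B ** B = - B" for a b c d and B :: "complex^'a^'a"
    by (simp add: matrix_add_ldistrib matrix_add_rdistrib matrix_scaleR_left matrix_scaleR_right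
        that algebra_simps)
  show ?thesis
    unfolding rot_def
    by (subst gen) (simp_all add: 3 4 matrix_mul_assoc matrix_mult_minus_left sin_add cos_add algebra_simps)
qed

lemma rot_0 [simp]: "rot A 0 = mat 1"
  by (simp add: rot_def)

text \<open>As \<open>A\<close> is skew-Hermitian, \<open>A ** A\<close> is Hermitian, so taking the
  adjoint changes the sign of the sine term only, that is, of the angle. By \<open>rot_add\<close>
  this is the inverse.\<close>

lemma rot_unitary:
  assumes "rot_generator A"
  shows "rot A \<phi> \<in> unitary_group"
proof -
  have "ctranspose (rot A \<phi>) = rot A (- \<phi>)"
    using assms by (simp add: rot_def rot_generator_def ctranspose_add ctranspose_scaleR
        ctranspose_mult matrix_mult_minus_left matrix_mult_minus_right)
  thus ?thesis
    using rot_add[OF assms, of \<phi> "-\<phi>"] rot_add[OF assms, of "-\<phi>" \<phi>]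
    by (simp add: unitary_group_def)
qed

section \<open>Rotation generators built from matrix units\<close>

definition unit_matrix :: "'n \<Rightarrow> 'n \<Rightarrow> complex^'n^'n" where
  "unit_matrix a b = (\<chi> i j. of_bool (i = a \<and> j = b))"

lemma unit_matrix_nth [simp]: "unit_matrix a b $ i $ j = of_bool (i = a \<and> j = b)"
  by (simp add: unit_matrix_def)

lemma unit_matrix_mult:
  "unit_matrix a b ** unit_matrix c d = (if b = c then unit_matrix a d else 0)"
proof -
  have "(\<Sum>k\<in>UNIV. of_bool (i = a \<and> k = b) * of_bool (k = c \<and> j = d))
      = (\<Sum>k\<in>UNIV. if k = b then of_bool (i = a) * of_bool (b = c \<and> j = d) else (0::complex))" for i j
    by (rule sum.cong) auto
  thus ?thesis by (auto simp: vec_eq_iff matrix_matrix_mult_def)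
qed

lemma matrix_mult_diff_right: "(A :: 'a::ring_1^'n^'m) ** (B - C) = A ** B - A ** C"
  by (simp add: matrix_matrix_mult_def vec_eq_iff sum_subtractf right_diff_distrib)

lemma matrix_mult_diff_left: "(B - C :: 'a::ring_1^'n^'m) ** A = B ** A - C ** A"
  by (simp add: matrix_matrix_mult_def vec_eq_iff sum_subtractf left_diff_distrib)

lemma ctranspose_unit_matrix [simp]: "ctranspose (unit_matrix a b) = unit_matrix b a"
  by (simp add: vec_eq_iff conj_commute)

lemma ctranspose_diff: "ctranspose (A - B) = ctranspose A - ctranspose B"
  by (simp add: vec_eq_iff)

lemma mat_mult_nth [simp]: "(mat c ** A) $ i $ j = c * A $ i $ j" for c :: complex
proof -
  have "(\<Sum>k\<in>UNIV. (if i = k then c else 0) * A $ k $ j) = (\<Sum>k\<in>UNIV. if k = i then c * A $ k $ j else 0)"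
    by (rule sum.cong) auto
  thus ?thesis by (simp add: matrix_matrix_mult_def mat_def)
qed

lemma mult_mat_nth [simp]: "(A ** mat c) $ i $ j = A $ i $ j * c" for c :: complex
proof -
  have "(\<Sum>k\<in>UNIV. A $ i $ k * (if k = j then c else 0)) = (\<Sum>k\<in>UNIV. if k = j then A $ i $ k * c else 0)"
    by (rule sum.cong) auto
  thus ?thesis by (simp add: matrix_matrix_mult_def mat_def)
qed

lemma rot_generator_skew:
  assumes "a \<noteq> b"
  shows "rot_generator (unit_matrix a b - unit_matrix b a)"
proof -
  define A where "A = unit_matrix a b + - unit_matrix b a"
  have "A ** A = - (unit_matrix a a + unit_matrix b b)"
    using assms by (simp add: A_def matrix_add_ldistrib matrix_add_rdistrib unit_matrix_mult
      matrix_mult_minus_left matrix_mult_minus_right matrix_mult_diff_left matrix_mult_diff_right)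
  hence "A ** A ** A = - A"
    using assms by (simp add: A_def matrix_add_ldistrib matrix_add_rdistrib unit_matrix_mult
      matrix_mult_minus_left matrix_mult_minus_right matrix_mult_diff_left matrix_mult_diff_right)
  moreover have "ctranspose A = - A"
    by (simp add: A_def ctranspose_diff)
  ultimately show ?thesis by (simp add: rot_generator_def A_def)
qed

text \<open>For Hermitian \<open>P\<close> the multiple by the imaginary unit i is skew-Hermitian,
  and its cube is -i times the cube of \<open>P\<close>.\<close>

lemma rot_generator_i:
  assumes "ctranspose P = P" "P ** P ** P = (P :: complex^'n^'n)"
  shows "rot_generator (mat \<i> ** P)"
proof -
  have c: "P ** mat \<i> = mat \<i> ** P"
    by (simp add: vec_eq_iff mult.commute)
  have m: "mat \<i> ** mat \<i> = - (mat 1 :: complex^'n^'n)"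
    by (simp add: vec_eq_iff) (simp add: mat_def)
  have "mat \<i> ** P ** (mat \<i> ** P) = mat \<i> ** (P ** mat \<i>) ** P"
    by (simp only: matrix_mul_assoc)
  also have "\<dots> = (mat \<i> ** mat \<i>) ** P ** P"
    by (simp only: c matrix_mul_assoc)
  also have "\<dots> = - (P ** P)" by (simp add: m matrix_mult_minus_left)
  finally have 2: "mat \<i> ** P ** (mat \<i> ** P) = - (P ** P)" .
  have "P ** P ** (mat \<i> ** P) = P ** (P ** mat \<i>) ** P" by (simp only: matrix_mul_assoc)
  also have "\<dots> = (P ** mat \<i>) ** P ** P" by (simp only: c matrix_mul_assoc)
  also have "\<dots> = mat \<i> ** (P ** P ** P)" by (simp only: c matrix_mul_assoc)
  finally have "mat \<i> ** P ** (mat \<i> ** P) ** (mat \<i> ** P) = - (mat \<i> ** P)"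
    by (simp add: 2 matrix_mult_minus_left assms(2))
  moreover have "ctranspose (mat \<i> ** P) = - (mat \<i> ** P)"
  proof -
    have "ctranspose (mat \<i>) = - (mat \<i> :: complex^'n^'n)"
      by (simp add: vec_eq_iff mat_def)
    thus ?thesis by (simp add: ctranspose_mult assms(1) matrix_mult_minus_right c)
  qed
  ultimately show ?thesis by (simp add: rot_generator_def)
qed

lemma rot_generator_diag: "rot_generator (mat \<i> ** unit_matrix a a)"
  by (rule rot_generator_i) (simp_all add: unit_matrix_mult)

lemma rot_generator_sym:
  assumes "a \<noteq> b"
  shows "rot_generator (mat \<i> ** (unit_matrix a b + unit_matrix b a))"
  using assms
  by (intro rot_generator_i)
    (simp_all add: matrix_add_ldistrib matrix_add_rdistrib unit_matrix_mult ctranspose_add)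

section \<open>Haar integrals of continuous functions\<close>

lemma haar_prob_sets: "haar_prob M \<Longrightarrow> sets M = sets (restrict_space borel unitary_group)"
  by (simp add: haar_prob_def)

lemma haar_prob_space:
  assumes "haar_prob M" shows "space M = unitary_group"
  using sets_eq_imp_space_eq[OF haar_prob_sets[OF assms]] by (simp add: space_restrict_space)

lemma haar_prob_prob_space: "haar_prob M \<Longrightarrow> prob_space M"
  by (simp add: haar_prob_def)

lemma haar_measurable:
  fixes F :: "complex^'n^'n \<Rightarrow> 'b::topological_space"
  assumes "haar_prob M" "continuous_on unitary_group F"
  shows "F \<in> borel_measurable M"
  using borel_measurable_continuous_on_restrict[OF assms(2)]
    measurable_cong_sets[OF haar_prob_sets[OF assms(1)] refl] by blast

lemma continuous_on_unitary_bound: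
  fixes F :: "complex^'n^'n \<Rightarrow> complex"
  assumes "continuous_on unitary_group F"
  obtains B where "B \<ge> 0" "\<And>X. X \<in> unitary_group \<Longrightarrow> norm (F X) \<le> B"
proof -
  have "bounded (F ` unitary_group)"
    using assms compact_unitary_group by (intro compact_imp_bounded compact_continuous_image)
  then obtain B where B: "\<And>X. X \<in> unitary_group \<Longrightarrow> norm (F X) \<le> B"
    by (auto simp: bounded_iff)
  have "0 \<le> norm (F (mat 1))" by simp
  also have "\<dots> \<le> B" by (rule B) simp
  finally show ?thesis using B that by blast
qed

lemma haar_integrable:
  fixes F :: "complex^'n^'n \<Rightarrow> complex"
  assumes "haar_prob M" "continuous_on unitary_group F"
  shows "integrable M F"
proof -
  interpret prob_space M by (rule haar_prob_prob_space) fact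
  obtain B where "\<And>X. X \<in> unitary_group \<Longrightarrow> norm (F X) \<le> B"
    using continuous_on_unitary_bound[OF assms(2)] by blast
  thus ?thesis
    by (intro integrable_const_bound[where B = B] haar_measurable assms)
      (auto simp: haar_prob_space[OF assms(1)] intro!: AE_I2)
qed

lemma haar_integral_translate:
  fixes F :: "complex^'n^'n \<Rightarrow> complex"
  assumes M: "haar_prob M" and F: "continuous_on unitary_group F" and U: "U \<in> unitary_group"
  shows "(LINT X|M. F (U ** X)) = (LINT X|M. F X)"
proof -
  have "(\<lambda>X. U ** X) \<in> measurable (restrict_space borel unitary_group) (restrict_space borel unitary_group)"
    using U by (intro measurable_restrict_space2 borel_measurable_continuous_on_restrict continuous_intros)
      (auto simp: space_restrict_space unitary_group_mult)
  hence m: "(\<lambda>X. U ** X) \<in> measurable M M"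
    using measurable_cong_sets[OF haar_prob_sets[OF M] haar_prob_sets[OF M]] by blast
  have "(LINT X|M. F (U ** X)) = integral\<^sup>L (distr M M (\<lambda>X. U ** X)) F"
    by (rule integral_distr[symmetric, OF m haar_measurable[OF M F]])
  also have "distr M M (\<lambda>X. U ** X) = M" using M U by (simp add: haar_prob_def)
  finally show ?thesis .
qed

text \<open>\<open>dF a b\<close> is the derivative of \<open>F\<close> along the matrix unit at \<open>(a, b)\<close>, which lies in the
  complexified Lie algebra only; it is pinned down by real-linear combinations.\<close>

definition lie_deriv :: "(complex^'n^'n \<Rightarrow> complex) \<Rightarrow> ('n \<Rightarrow> 'n \<Rightarrow> complex^'n^'n \<Rightarrow> complex) \<Rightarrow> bool" where
  "lie_deriv F dF \<longleftrightarrow> continuous_on unitary_group F \<and> (\<forall>a b. continuous_on unitary_group (dF a b)) \<and>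
     (\<forall>A X. rot_generator A \<longrightarrow> X \<in> unitary_group \<longrightarrow>
       ((\<lambda>\<phi>. F (rot A \<phi> ** X)) has_vector_derivative (\<Sum>a\<in>UNIV. \<Sum>b\<in>UNIV. A $ a $ b * dF a b X)) (at 0))"

text \<open>Agreement on the group suffices, because \<open>rot A \<phi> ** X\<close> does not leave
  it.\<close>

lemma lie_deriv_cong:
  assumes "lie_deriv F dF" "\<And>X. X \<in> unitary_group \<Longrightarrow> F X = G X"
    "\<And>a b X. X \<in> unitary_group \<Longrightarrow> dF a b X = dG a b X"
  shows "lie_deriv G dG"
proof -
  have c: "continuous_on unitary_group G" "continuous_on unitary_group (dG a b)" for a b
    using assms by (auto simp: lie_deriv_def cong: continuous_on_cong)
  have "G (rot A \<phi> ** X) = F (rot A \<phi> ** X)" if "rot_generator A" "X \<in> unitary_group" for A \<phi> X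
    using assms(2) that by (simp add: unitary_group_mult rot_unitary)
  thus ?thesis using assms c unfolding lie_deriv_def by simp
qed

lemma lie_deriv_const: "lie_deriv (\<lambda>X. c) (\<lambda>a b X. 0)"
  by (simp add: lie_deriv_def)

lemma lie_deriv_add:
  assumes "lie_deriv F dF" "lie_deriv G dG"
  shows "lie_deriv (\<lambda>X. F X + G X) (\<lambda>a b X. dF a b X + dG a b X)"
  using assms unfolding lie_deriv_def
  by (auto intro!: continuous_intros derivative_eq_intros simp: sum.distrib distrib_left)

lemma lie_deriv_mult:
  assumes "lie_deriv F dF" "lie_deriv G dG"
  shows "lie_deriv (\<lambda>X. F X * G X) (\<lambda>a b X. dF a b X * G X + F X * dG a b X)"
  using assms unfolding lie_deriv_def
  by (auto intro!: continuous_intros derivative_eq_intros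
      simp: sum.distrib distrib_left sum_distrib_left sum_distrib_right ac_simps)

lemma lie_deriv_cmult:
  assumes "lie_deriv F dF"
  shows "lie_deriv (\<lambda>X. c * F X) (\<lambda>a b X. c * dF a b X)"
  using lie_deriv_mult[OF lie_deriv_const[of c] assms] by simp

lemma lie_deriv_sum:
  assumes "\<And>i. i \<in> I \<Longrightarrow> lie_deriv (F i) (dF i)"
  shows "lie_deriv (\<lambda>X. \<Sum>i\<in>I. F i X) (\<lambda>a b X. \<Sum>i\<in>I. dF i a b X)"
  using assms
  by (induction I rule: infinite_finite_induct) (auto intro: lie_deriv_const lie_deriv_add)

lemma rot_has_vector_derivative:
  fixes A X :: "complex^'n^'n"
  shows "((\<lambda>\<phi>. rot A \<phi> ** X) has_vector_derivative A ** X) (at 0)"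
proof -
  have eq: "rot A \<phi> ** X = X + sin \<phi> *\<^sub>R (A ** X) + (1 - cos \<phi>) *\<^sub>R (A ** A ** X)" for \<phi>
    by (simp add: rot_def matrix_add_rdistrib matrix_scaleR_left)
  show ?thesis
    unfolding eq by (auto intro!: derivative_eq_intros)
qed

text \<open>Left multiplication by the matrix unit at \<open>(a, b)\<close> moves row
  \<open>b\<close> of \<open>X\<close> into row \<open>a\<close> and clears all other rows.\<close>

lemma lie_deriv_entry:
  "lie_deriv (\<lambda>X. X $ i $ j) (\<lambda>a b X. of_bool (a = i) * X $ b $ j)"
proof -
  have "((\<lambda>\<phi>. (rot A \<phi> ** X) $ i $ j) has_vector_derivative
      (\<Sum>a\<in>UNIV. \<Sum>b\<in>UNIV. A $ a $ b * (of_bool (a = i) * X $ b $ j))) (at 0)" for A X :: "complex^'a^'a"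
  proof -
    have "((\<lambda>\<phi>. (rot A \<phi> ** X) $ i $ j) has_vector_derivative (A ** X) $ i $ j) (at 0)"
      by (intro bounded_linear.has_vector_derivative[OF bounded_linear_vec_nth] rot_has_vector_derivative)
    also have "(A ** X) $ i $ j = (\<Sum>a\<in>UNIV. if a = i then (\<Sum>b\<in>UNIV. A $ a $ b * X $ b $ j) else 0)"
      by (simp add: matrix_matrix_mult_def)
    also have "\<dots> = (\<Sum>a\<in>UNIV. \<Sum>b\<in>UNIV. A $ a $ b * (of_bool (a = i) * X $ b $ j))"
      by (rule sum.cong) auto
    finally show ?thesis .
  qed
  thus ?thesis by (auto simp: lie_deriv_def intro!: continuous_intros)
qed

text \<open>Conjugation is not complex linear, so the coefficients of \<open>A\<close> first appear
  conjugated. Skewness turns them into \<open>- A $ a $ j\<close>, and the result is complex linear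
  in \<open>A\<close> again; this admits conjugate entries to the complexified calculus.\<close>

lemma lie_deriv_cnj_entry:
  "lie_deriv (\<lambda>X. cnj (X $ j $ i)) (\<lambda>a b X. - of_bool (b = j) * cnj (X $ a $ i))"
proof -
  have "((\<lambda>\<phi>. cnj ((rot A \<phi> ** X) $ j $ i)) has_vector_derivative
      (\<Sum>a\<in>UNIV. \<Sum>b\<in>UNIV. A $ a $ b * (- of_bool (b = j) * cnj (X $ a $ i)))) (at 0)"
    if A: "rot_generator A" for A X :: "complex^'a^'a"
  proof -
    have skew: "cnj (A $ i $ j) = - A $ j $ i" for i j
      using arg_cong[of _ _ "\<lambda>X. X $ j $ i", OF conjunct1[OF A[unfolded rot_generator_def]]] by simp
    have "((\<lambda>\<phi>. cnj ((rot A \<phi> ** X) $ j $ i)) has_vector_derivative cnj ((A ** X) $ j $ i)) (at 0)"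
      by (intro bounded_linear.has_vector_derivative[OF bounded_linear_cnj]
          bounded_linear.has_vector_derivative[OF bounded_linear_vec_nth] rot_has_vector_derivative)
    also have "cnj ((A ** X) $ j $ i) = (\<Sum>a\<in>UNIV. - A $ a $ j * cnj (X $ a $ i))"
      by (simp add: matrix_matrix_mult_def skew)
    also have "\<dots> = (\<Sum>a\<in>UNIV. \<Sum>b\<in>UNIV. if b = j then - A $ a $ j * cnj (X $ a $ i) else 0)"
      by simp
    also have "\<dots> = (\<Sum>a\<in>UNIV. \<Sum>b\<in>UNIV. A $ a $ b * (- of_bool (b = j) * cnj (X $ a $ i)))"
      by (intro sum.cong) auto
    finally show ?thesis .
  qed
  thus ?thesis by (auto simp: lie_deriv_def intro!: continuous_intros)
qed

text \<open>Left invariance makes the integral of \<open>F (rot A \<phi> ** X)\<close> independent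
  of the angle. The difference quotients therefore integrate to 0, and they converge boundedly to
  the derivative.\<close>

lemma lie_deriv_integral_generator:
  assumes M: "haar_prob M" and F: "lie_deriv F dF" and A: "rot_generator A"
  shows "(LINT X|M. (\<Sum>a\<in>UNIV. \<Sum>b\<in>UNIV. A $ a $ b * dF a b X)) = 0"
proof -
  interpret prob_space M by (rule haar_prob_prob_space) fact
  define g where "g X = (\<Sum>a\<in>UNIV. \<Sum>b\<in>UNIV. A $ a $ b * dF a b X)" for X
  have cF: "continuous_on unitary_group F" and cg: "continuous_on unitary_group g"
    using F unfolding g_def lie_deriv_def by (auto intro!: continuous_intros)
  have cT: "continuous_on unitary_group (\<lambda>X. F (U ** X))" if "U \<in> unitary_group" for U
    by (rule continuous_on_compose2[OF cF]) (use that unitary_group_mult in \<open>auto intro!: continuous_intros\<close>)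
  have d0: "((\<lambda>\<phi>. F (rot A \<phi> ** X)) has_vector_derivative g X) (at 0)"
    if "X \<in> unitary_group" for X
    using F A that by (simp add: lie_deriv_def g_def)
  \<comment> \<open>The definition gives the derivative at angle 0 only; the group law
    \<open>rot_add\<close> transports it to any angle, with \<open>X\<close> replaced by
    \<open>rot A \<psi> ** X\<close>.\<close>
  have d: "((\<lambda>\<phi>. F (rot A \<phi> ** X)) has_vector_derivative g (rot A \<psi> ** X)) (at \<psi>)"
    if "X \<in> unitary_group" for X \<psi>
  proof -
    have *: "rot A \<phi> ** X = rot A (\<phi> - \<psi>) ** (rot A \<psi> ** X)" for \<phi>
      using rot_add[OF A, of "\<phi> - \<psi>" \<psi>] by (simp add: matrix_mul_assoc)
    have "((\<lambda>\<phi>. F (rot A \<phi> ** (rot A \<psi> ** X))) has_vector_derivative g (rot A \<psi> ** X)) (at (\<psi> - \<psi>))"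
      using d0[of "rot A \<psi> ** X"] that by (simp add: unitary_group_mult rot_unitary A)
    hence "((\<lambda>\<phi>. F (rot A \<phi> ** (rot A \<psi> ** X))) \<circ> (\<lambda>\<phi>. \<phi> - \<psi>) has_vector_derivative
        1 *\<^sub>R g (rot A \<psi> ** X)) (at \<psi>)"
      by (intro vector_diff_chain_at) (auto intro!: derivative_eq_intros)
    thus ?thesis by (subst *) (simp add: o_def)
  qed
  obtain B where B: "B \<ge> 0" "\<And>X. X \<in> unitary_group \<Longrightarrow> norm (g X) \<le> B"
    using continuous_on_unitary_bound[OF cg] by blast
  \<comment> \<open>Difference quotients along the steps 1/(m+1): a sequence, to which dominated
    convergence applies.\<close>
  define q where "q m X = of_nat (Suc m) * (F (rot A (1 / real (Suc m)) ** X) - F X)" for m X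
  have q_lim: "(\<lambda>m. q m X) \<longlonglongrightarrow> g X" if "X \<in> unitary_group" for X
  proof -
    have "((\<lambda>h. norm (F (rot A (0 + h) ** X) - F (rot A 0 ** X) - h *\<^sub>R g X) / norm h) \<longlongrightarrow> 0) (at 0)"
      using d0[OF that] by (simp add: has_vector_derivative_def has_derivative_at)
    hence "((\<lambda>h. norm ((F (rot A (0 + h) ** X) - F (rot A 0 ** X)) /\<^sub>R h - g X)) \<longlongrightarrow> 0) (at 0)"
    proof (rule Lim_transform_eventually)
      have "norm (F (rot A (0 + h) ** X) - F (rot A 0 ** X) - h *\<^sub>R g X) / norm h
          = norm ((F (rot A (0 + h) ** X) - F (rot A 0 ** X)) /\<^sub>R h - g X)" if "h \<noteq> 0" for h
      proof -
        have "(F (rot A (0 + h) ** X) - F (rot A 0 ** X)) /\<^sub>R h - g X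
            = (F (rot A (0 + h) ** X) - F (rot A 0 ** X) - h *\<^sub>R g X) /\<^sub>R h"
          using that by (simp add: scaleR_diff_right)
        thus ?thesis by (simp add: divide_inverse mult.commute)
      qed
      thus "\<forall>\<^sub>F h in at 0. norm (F (rot A (0 + h) ** X) - F (rot A 0 ** X) - h *\<^sub>R g X) / norm h
          = norm ((F (rot A (0 + h) ** X) - F (rot A 0 ** X)) /\<^sub>R h - g X)"
        by (auto simp: eventually_at_filter)
    qed
    hence "((\<lambda>h. (F (rot A (0 + h) ** X) - F (rot A 0 ** X)) /\<^sub>R h) \<longlongrightarrow> g X) (at 0)"
      using tendsto_norm_zero_iff LIM_zero_iff by blast
    moreover have "(\<lambda>m. 1 / real (Suc m)) \<longlonglongrightarrow> 0"
      by (rule LIMSEQ_Suc[OF lim_1_over_n])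
    hence "filterlim (\<lambda>m. 1 / real (Suc m)) (at 0) sequentially"
      by (simp add: filterlim_at del: of_nat_Suc)
    ultimately have "(\<lambda>m. (F (rot A (0 + 1 / real (Suc m)) ** X) - F (rot A 0 ** X)) /\<^sub>R (1 / real (Suc m))) \<longlonglongrightarrow> g X"
      by (rule filterlim_compose)
    thus ?thesis by (simp add: q_def scaleR_conv_of_real)
  qed
  \<comment> \<open>The mean value inequality bounds all quotients by the bound \<open>B\<close> for
    the derivative on the compact group.\<close>
  have q_bound: "norm (q m X) \<le> B" if "X \<in> unitary_group" for m X
  proof -
    have "norm (F (rot A (1 / real (Suc m)) ** X) - F (rot A 0 ** X)) \<le> B * norm (1 / real (Suc m) - 0)"
    proof (rule differentiable_bound[where S = UNIV])
      show "((\<lambda>\<phi>. F (rot A \<phi> ** X)) has_derivative (\<lambda>h. h *\<^sub>R g (rot A \<psi> ** X))) (at \<psi> within UNIV)" for \<psi>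
        using d[OF that, of \<psi>] by (simp add: has_vector_derivative_def)
      show "onorm (\<lambda>h. h *\<^sub>R g (rot A \<psi> ** X)) \<le> B" for \<psi>
        using B(2)[of "rot A \<psi> ** X"] that
        by (intro onorm_le) (auto simp: unitary_group_mult rot_unitary A mult.commute[of B] intro: mult_left_mono)
    qed auto
    thus ?thesis unfolding q_def norm_mult norm_of_nat by (simp add: field_simps)
  qed
  have q0: "(LINT X|M. q m X) = 0" for m
    unfolding q_def using A
    by (simp add: haar_integral_translate[OF M cF] rot_unitary haar_integrable[OF M] cF cT)
  have "(\<lambda>m. LINT X|M. q m X) \<longlonglongrightarrow> (LINT X|M. g X)"
  proof (rule integral_dominated_convergence[where w = "\<lambda>_. B"])
    show "q m \<in> borel_measurable M" for m
      unfolding q_def by (intro haar_measurable[OF M] continuous_intros cT cF rot_unitary A)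
  qed (use q_lim q_bound haar_measurable[OF M cg] haar_prob_space[OF M] in auto)
  hence "(LINT X|M. g X) = 0" by (simp add: q0 LIMSEQ_const_iff)
  thus ?thesis by (simp add: g_def)
qed

text \<open>The rotation generators span all complex matrices.\<close>

lemma lie_deriv_integral:
  assumes M: "haar_prob M" and F: "lie_deriv F dF"
  shows "(LINT X|M. dF a b X) = 0"
proof -
  define I where "I a b = (LINT X|M. dF a b X)" for a b
  have c: "continuous_on unitary_group (dF a b)" for a b using F by (simp add: lie_deriv_def)
  have I: "(\<Sum>a\<in>UNIV. \<Sum>b\<in>UNIV. A $ a $ b * I a b) = 0" if "rot_generator A" for A
    using lie_deriv_integral_generator[OF M F that] by (simp add: I_def haar_integrable[OF M c])
  have S: "(\<Sum>a\<in>UNIV. \<Sum>b\<in>UNIV. of_bool (a = a' \<and> b = b') * I a b) = I a' b'" for a' b'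
  proof -
    have "(\<Sum>a\<in>UNIV. \<Sum>b\<in>UNIV. of_bool (a = a' \<and> b = b') * I a b)
       = (\<Sum>a\<in>UNIV. if a = a' then (\<Sum>b\<in>UNIV. if b = b' then I a b else 0) else 0)"
      by (intro sum.cong) (auto simp: if_distrib intro!: sum.cong)
    thus ?thesis by simp
  qed
  show ?thesis
  proof (cases "a = b")
    case True
    have "(\<Sum>a'\<in>UNIV. \<Sum>b'\<in>UNIV. \<i> * (of_bool (a' = a \<and> b' = a) * I a' b')) = 0"
      using I[OF rot_generator_diag[of a]] by (simp add: mult.assoc)
    hence "\<i> * I a a = 0" by (simp only: S flip: sum_distrib_left)
    thus ?thesis using True by (simp add: I_def)
  next
    \<comment> \<open>The skew generator yields \<open>I a b = I b a\<close>, the symmetric one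
      \<open>I a b = - I b a\<close>.\<close>
    case False
    have "(\<Sum>a'\<in>UNIV. \<Sum>b'\<in>UNIV. (of_bool (a' = a \<and> b' = b) - of_bool (a' = b \<and> b' = a)) * I a' b') = 0"
      using I[OF rot_generator_skew[OF False]] by simp
    hence "I a b - I b a = 0" by (simp only: left_diff_distrib sum_subtractf S)
    moreover have "(\<Sum>a'\<in>UNIV. \<Sum>b'\<in>UNIV. \<i> * ((of_bool (a' = a \<and> b' = b) + of_bool (a' = b \<and> b' = a)) * I a' b')) = 0"
      using I[OF rot_generator_sym[OF False]] by (simp add: mult.assoc)
    hence "\<i> * (I a b + I b a) = 0"
      by (simp only: distrib_right sum.distrib S flip: sum_distrib_left)
    ultimately show ?thesis by (simp add: I_def)
  qed
qed

section \<open>The Casimir operator on power traces\<close>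

primrec matpow :: "complex^'n^'n \<Rightarrow> nat \<Rightarrow> complex^'n^'n" where
  "matpow X 0 = mat 1"
| "matpow X (Suc k) = X ** matpow X k"

lemma matpow_add: "matpow X (k + l) = matpow X k ** matpow X l"
  by (induction k) (simp_all add: matrix_mul_assoc)

lemma matpow_Suc_right: "matpow X (Suc k) = matpow X k ** X"
  using matpow_add[of X k 1] by simp

lemma ctranspose_matpow: "ctranspose (matpow X k) = matpow (ctranspose X) k"
proof (induction k)
  case (Suc k)
  show ?case
    by (simp only: matpow_Suc_right[of X] matpow.simps(2)[of "ctranspose X"] ctranspose_mult Suc.IH)
qed simp

text \<open>The adjacent factors \<open>X\<close> and \<open>Y\<close> in the middle cancel pair by
  pair until one of the two powers is exhausted.\<close>

lemma matpow_mult_inverse: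
  assumes "X ** Y = mat 1"
  shows "matpow X m ** matpow Y n = (if n \<le> m then matpow X (m - n) else matpow Y (n - m))"
proof (induction n arbitrary: m)
  case (Suc n)
  show ?case
  proof (cases m)
    case (Suc m')
    have "matpow X m ** matpow Y (Suc n) = matpow X m' ** (X ** Y) ** matpow Y n"
      unfolding Suc matpow_Suc_right[of X m'] by (simp add: matrix_mul_assoc)
    thus ?thesis using Suc.IH[of m'] by (simp add: assms Suc)
  qed simp
qed simp

lemma sum_diag_product_eq_trace:
  "(\<Sum>a\<in>UNIV. \<Sum>b\<in>UNIV. A $ b $ b * B $ a $ a) = trace A * trace (B :: complex^'n^'n)"
  unfolding trace_def sum_product by (rule sum.swap)

lemma matpow_ctranspose_Suc_nth:
  "matpow (ctranspose X) (Suc r) $ i $ a = (\<Sum>l\<in>UNIV. cnj (X $ l $ i) * matpow (ctranspose X) r $ l $ a)"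
  by (simp add: matrix_matrix_mult_def)

text \<open>On the group the adjoint is the inverse, so these are the integer powers. In this form
  the entries stay polynomial in the entries of \<open>X\<close> and their conjugates.\<close>

definition unitary_powi :: "complex^'n^'n \<Rightarrow> int \<Rightarrow> complex^'n^'n" where
  "unitary_powi X k = (if k \<ge> 0 then matpow X (nat k) else matpow (ctranspose X) (nat (- k)))"

lemma unitary_powi_add:
  assumes "X \<in> unitary_group"
  shows "unitary_powi X (k + l) = unitary_powi X k ** unitary_powi X l"
proof -
  have XY: "X ** ctranspose X = mat 1" "ctranspose X ** X = mat 1"
    using assms by (auto simp: unitary_group_def)
  consider (pp) "k \<ge> 0" "l \<ge> 0" | (pn) "k \<ge> 0" "l < 0" | (np) "k < 0" "l \<ge> 0" | (nn) "k < 0" "l < 0"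
    by linarith
  thus ?thesis
  proof cases
    case pp
    thus ?thesis by (simp add: unitary_powi_def nat_add_distrib matpow_add)
  next
    case pn
    hence "nat k - nat (- l) = nat (k + l)" "nat (- l) - nat k = nat (- (k + l))" by linarith+
    thus ?thesis using pn by (auto simp: unitary_powi_def matpow_mult_inverse[OF XY(1)])
  next
    case np
    hence "nat (- k) - nat l = nat (- (k + l))" "nat l - nat (- k) = nat (k + l)" by linarith+
    thus ?thesis using np
      by (cases "k + l = 0") (auto simp: unitary_powi_def matpow_mult_inverse[OF XY(2)])
  next
    case nn
    hence "nat (- (k + l)) = nat (- k) + nat (- l)" by linarith
    thus ?thesis using nn by (simp add: unitary_powi_def matpow_add)
  qed
qed

definition power_trace :: "complex^'n^'n \<Rightarrow> int \<Rightarrow> complex" where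
  "power_trace X k = trace (unitary_powi X k)"

text \<open>Translation from the left replaces one factor \<open>X\<close> by \<open>E ** X\<close>,
  with \<open>E\<close> the matrix unit at \<open>(a, b)\<close>. Leibniz's rule then gives the sum
  of X^r E X^(k-r) over r < k.\<close>

lemma lie_deriv_matpow:
  "lie_deriv (\<lambda>X. matpow X k $ i $ j) (\<lambda>a b X. \<Sum>r<k. matpow X r $ i $ a * matpow X (k - r) $ b $ j)"
proof (induction k arbitrary: i)
  case 0
  thus ?case using lie_deriv_const by simp
next
  case (Suc k)
  have "lie_deriv (\<lambda>X. \<Sum>l\<in>UNIV. X $ i $ l * matpow X k $ l $ j)
     (\<lambda>a b X. \<Sum>l\<in>UNIV. (of_bool (a = i) * X $ b $ l) * matpow X k $ l $ j
        + X $ i $ l * (\<Sum>r<k. matpow X r $ l $ a * matpow X (k - r) $ b $ j))"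
    by (intro lie_deriv_sum lie_deriv_mult lie_deriv_entry Suc.IH)
  thus ?case
  proof (rule lie_deriv_cong)
    fix a b and X :: "complex^'a^'a"
    have "(\<Sum>l\<in>UNIV. X $ i $ l * (\<Sum>r<k. matpow X r $ l $ a * matpow X (k - r) $ b $ j))
      = (\<Sum>r<k. matpow X (Suc r) $ i $ a * matpow X (k - r) $ b $ j)"
      unfolding sum_distrib_left
      by (subst sum.swap) (simp add: matrix_matrix_mult_def sum_distrib_right mult.assoc)
    moreover have "(\<Sum>l\<in>UNIV. of_bool (a = i) * X $ b $ l * matpow X k $ l $ j)
      = matpow X 0 $ i $ a * matpow X (Suc k) $ b $ j"
      by (simp add: matrix_matrix_mult_def mat_def)
    ultimately show "(\<Sum>l\<in>UNIV. (of_bool (a = i) * X $ b $ l) * matpow X k $ l $ j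
        + X $ i $ l * (\<Sum>r<k. matpow X r $ l $ a * matpow X (k - r) $ b $ j))
      = (\<Sum>r<Suc k. matpow X r $ i $ a * matpow X (Suc k - r) $ b $ j)"
      unfolding sum.distrib sum.lessThan_Suc_shift by simp
  qed (simp add: matrix_matrix_mult_def)
qed

text \<open>The adjoint varies by minus itself times \<open>E\<close> on the right. Compared with
  \<open>X\<close> the unit \<open>E\<close> stands one place further right, whence the exponents
  r+1 and k-r-1.\<close>

lemma lie_deriv_matpow_ctranspose:
  "lie_deriv (\<lambda>X. matpow (ctranspose X) k $ i $ j)
     (\<lambda>a b X. - (\<Sum>r<k. matpow (ctranspose X) (Suc r) $ i $ a * matpow (ctranspose X) (k - Suc r) $ b $ j))"
proof (induction k arbitrary: i)
  case 0
  thus ?case using lie_deriv_const by simp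
next
  case (Suc k)
  have "lie_deriv (\<lambda>X. \<Sum>l\<in>UNIV. cnj (X $ l $ i) * matpow (ctranspose X) k $ l $ j)
     (\<lambda>a b X. \<Sum>l\<in>UNIV. (- of_bool (b = l) * cnj (X $ a $ i)) * matpow (ctranspose X) k $ l $ j
        + cnj (X $ l $ i) * (- (\<Sum>r<k. matpow (ctranspose X) (Suc r) $ l $ a * matpow (ctranspose X) (k - Suc r) $ b $ j)))"
    by (intro lie_deriv_sum lie_deriv_mult lie_deriv_cnj_entry Suc.IH)
  thus ?case
  proof (rule lie_deriv_cong)
    fix a b and X :: "complex^'a^'a"
    let ?Y = "ctranspose X"
    have "(\<Sum>l\<in>UNIV. cnj (X $ l $ i) * (- (\<Sum>r<k. matpow ?Y (Suc r) $ l $ a * matpow ?Y (k - Suc r) $ b $ j)))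
      = - (\<Sum>r<k. matpow ?Y (Suc (Suc r)) $ i $ a * matpow ?Y (k - Suc r) $ b $ j)"
      unfolding mult_minus_right sum_negf sum_distrib_left
      unfolding matpow_ctranspose_Suc_nth[of X "Suc _" i] sum_distrib_right mult.assoc
      by (subst sum.swap) (rule refl)
    moreover have "(\<Sum>l\<in>UNIV. - of_bool (b = l) * cnj (X $ a $ i) * matpow ?Y k $ l $ j)
       = (\<Sum>l\<in>UNIV. if l = b then - (cnj (X $ a $ i) * matpow ?Y k $ l $ j) else 0)"
      by (rule sum.cong) auto
    hence "(\<Sum>l\<in>UNIV. - of_bool (b = l) * cnj (X $ a $ i) * matpow ?Y k $ l $ j)
       = - (matpow ?Y (Suc 0) $ i $ a * matpow ?Y k $ b $ j)"
      by simp
    ultimately show "(\<Sum>l\<in>UNIV. (- of_bool (b = l) * cnj (X $ a $ i)) * matpow ?Y k $ l $ j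
        + cnj (X $ l $ i) * (- (\<Sum>r<k. matpow ?Y (Suc r) $ l $ a * matpow ?Y (k - Suc r) $ b $ j)))
      = - (\<Sum>r<Suc k. matpow ?Y (Suc r) $ i $ a * matpow ?Y (Suc k - Suc r) $ b $ j)"
      unfolding sum.distrib sum.lessThan_Suc_shift by (simp del: matpow.simps)
  qed (simp add: matrix_matrix_mult_def)
qed

text \<open>The Casimir element is the sum of E_ab E_ba over all matrix units, central in the
  enveloping algebra. The first and second derivatives appear as data because
  \<open>lie_deriv\<close> is a relation; \<open>CF\<close> is constrained on the group
  only.\<close>

definition casimir_deriv where
  "casimir_deriv F dF CF \<longleftrightarrow> lie_deriv F dF \<and>
     (\<exists>ddF. (\<forall>a b. lie_deriv (dF a b) (ddF a b)) \<and>
       (\<forall>X\<in>unitary_group. CF X = (\<Sum>a\<in>UNIV. \<Sum>b\<in>UNIV. ddF a b b a X)))"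

text \<open>Each summand of the second-order expression is itself a first derivative, namely of
  \<open>dF a b\<close>, and so has integral 0.\<close>

lemma casimir_deriv_integral:
  assumes M: "haar_prob M" and F: "casimir_deriv F dF CF"
  shows "(LINT X|M. CF X) = 0"
proof -
  obtain ddF where dd: "\<And>a b. lie_deriv (dF a b) (ddF a b)"
    "\<And>X. X \<in> unitary_group \<Longrightarrow> CF X = (\<Sum>a\<in>UNIV. \<Sum>b\<in>UNIV. ddF a b b a X)"
    using F by (auto simp: casimir_deriv_def)
  have c: "continuous_on unitary_group (ddF a b c d)" for a b c d
    using dd(1) by (simp add: lie_deriv_def)
  have "(LINT X|M. CF X) = (LINT X|M. (\<Sum>a\<in>UNIV. \<Sum>b\<in>UNIV. ddF a b b a X))"
    by (intro Bochner_Integration.integral_cong) (simp_all add: dd(2) haar_prob_space[OF M])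
  also have "\<dots> = (\<Sum>a\<in>UNIV. \<Sum>b\<in>UNIV. LINT X|M. ddF a b b a X)"
    by (simp add: haar_integrable[OF M c])
  also have "\<dots> = 0" by (simp add: lie_deriv_integral[OF M dd(1)])
  finally show ?thesis .
qed

lemma casimir_deriv_cong:
  assumes "casimir_deriv F dF CF" "\<And>X. X \<in> unitary_group \<Longrightarrow> CF X = CG X"
  shows "casimir_deriv F dF CG"
proof -
  obtain ddF where "\<And>a b. lie_deriv (dF a b) (ddF a b)"
    "\<And>X. X \<in> unitary_group \<Longrightarrow> CF X = (\<Sum>a\<in>UNIV. \<Sum>b\<in>UNIV. ddF a b b a X)"
    using assms(1) by (auto simp: casimir_deriv_def)
  thus ?thesis
    unfolding casimir_deriv_def using assms(1)[unfolded casimir_deriv_def]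
    by (intro conjI exI[of _ ddF]) (simp_all add: assms(2)[symmetric])
qed

text \<open>The product rule for a second-order operator. The two mixed sums agree after exchanging
  \<open>a\<close> and \<open>b\<close>, which accounts for the factor 2.\<close>

lemma casimir_deriv_mult:
  assumes F: "casimir_deriv F dF CF" and G: "casimir_deriv G dG CG"
  shows "casimir_deriv (\<lambda>X. F X * G X) (\<lambda>a b X. dF a b X * G X + F X * dG a b X)
     (\<lambda>X. CF X * G X + F X * CG X + 2 * (\<Sum>a\<in>UNIV. \<Sum>b\<in>UNIV. dF a b X * dG b a X))"
proof -
  obtain ddF where ddF: "\<And>a b. lie_deriv (dF a b) (ddF a b)"
    "\<And>X. X \<in> unitary_group \<Longrightarrow> CF X = (\<Sum>a\<in>UNIV. \<Sum>b\<in>UNIV. ddF a b b a X)"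
    using F by (auto simp: casimir_deriv_def)
  obtain ddG where ddG: "\<And>a b. lie_deriv (dG a b) (ddG a b)"
    "\<And>X. X \<in> unitary_group \<Longrightarrow> CG X = (\<Sum>a\<in>UNIV. \<Sum>b\<in>UNIV. ddG a b b a X)"
    using G by (auto simp: casimir_deriv_def)
  have FG: "lie_deriv F dF" "lie_deriv G dG" using F G by (auto simp: casimir_deriv_def)
  define dd where "dd a b a' b' X = (ddF a b a' b' X * G X + dF a b X * dG a' b' X)
     + (dF a' b' X * dG a b X + F X * ddG a b a' b' X)" for a b a' b' X
  have "lie_deriv (\<lambda>X. dF a b X * G X + F X * dG a b X) (dd a b)" for a b
    unfolding dd_def by (intro lie_deriv_add lie_deriv_mult ddF ddG FG)
  moreover have "CF X * G X + F X * CG X + 2 * (\<Sum>a\<in>UNIV. \<Sum>b\<in>UNIV. dF a b X * dG b a X)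
     = (\<Sum>a\<in>UNIV. \<Sum>b\<in>UNIV. dd a b b a X)" if "X \<in> unitary_group" for X
  proof -
    have "(\<Sum>a\<in>UNIV. \<Sum>b\<in>UNIV. dF b a X * dG a b X) = (\<Sum>a\<in>UNIV. \<Sum>b\<in>UNIV. dF a b X * dG b a X)"
      by (rule sum.swap)
    thus ?thesis
      by (simp add: dd_def ddF(2)[OF that] ddG(2)[OF that] sum.distrib sum_distrib_left sum_distrib_right)
  qed
  ultimately show ?thesis
    unfolding casimir_deriv_def using lie_deriv_mult[OF FG] by blast
qed

text \<open>Summing over the diagonal joins the two powers in each Leibniz term, so all |k| terms
  coincide. For negative \<open>k\<close> the sign comes from the derivative of the adjoint.\<close>

lemma lie_deriv_power_trace: "lie_deriv (\<lambda>X. power_trace X k) (\<lambda>a b X. of_int k * unitary_powi X k $ b $ a)"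
proof (cases "k \<ge> 0")
  case True
  define m where "m = nat k"
  have k: "k = int m" using True by (simp add: m_def)
  have "lie_deriv (\<lambda>X. \<Sum>i\<in>UNIV. matpow X m $ i $ i)
     (\<lambda>a b X. \<Sum>i\<in>UNIV. \<Sum>r<m. matpow X r $ i $ a * matpow X (m - r) $ b $ i)"
    by (intro lie_deriv_sum lie_deriv_matpow)
  thus ?thesis
  proof (rule lie_deriv_cong)
    fix a b :: 'a and X :: "complex^'a^'a"
    have "(\<Sum>i\<in>UNIV. \<Sum>r<m. matpow X r $ i $ a * matpow X (m - r) $ b $ i)
       = (\<Sum>r<m. (matpow X (m - r) ** matpow X r) $ b $ a)"
      by (subst sum.swap) (simp add: matrix_matrix_mult_def mult.commute)
    also have "\<dots> = (\<Sum>r<m. matpow X m $ b $ a)"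
      by (intro sum.cong) (simp_all flip: matpow_add)
    finally show "(\<Sum>i\<in>UNIV. \<Sum>r<m. matpow X r $ i $ a * matpow X (m - r) $ b $ i)
       = of_int k * unitary_powi X k $ b $ a"
      by (simp add: k unitary_powi_def)
  qed (simp add: power_trace_def trace_def unitary_powi_def k)
next
  case False
  define m where "m = nat (- k)"
  have k: "k = - int m" "m > 0" using False by (simp_all add: m_def)
  have "lie_deriv (\<lambda>X. \<Sum>i\<in>UNIV. matpow (ctranspose X) m $ i $ i)
     (\<lambda>a b X. \<Sum>i\<in>UNIV. - (\<Sum>r<m. matpow (ctranspose X) (Suc r) $ i $ a * matpow (ctranspose X) (m - Suc r) $ b $ i))"
    by (intro lie_deriv_sum lie_deriv_matpow_ctranspose)
  thus ?thesis
  proof (rule lie_deriv_cong)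
    fix a b :: 'a and X :: "complex^'a^'a"
    let ?Y = "ctranspose X"
    have "(\<Sum>i\<in>UNIV. - (\<Sum>r<m. matpow ?Y (Suc r) $ i $ a * matpow ?Y (m - Suc r) $ b $ i))
       = - (\<Sum>r<m. (matpow ?Y (m - Suc r) ** matpow ?Y (Suc r)) $ b $ a)"
      unfolding sum_negf
      by (subst sum.swap) (simp add: matrix_matrix_mult_def mult.commute del: matpow.simps)
    also have "\<dots> = - (\<Sum>r<m. matpow ?Y m $ b $ a)"
      by (intro arg_cong[of _ _ uminus] sum.cong) (simp_all flip: matpow_add del: matpow.simps)
    finally show "(\<Sum>i\<in>UNIV. - (\<Sum>r<m. matpow ?Y (Suc r) $ i $ a * matpow ?Y (m - Suc r) $ b $ i))
       = of_int k * unitary_powi X k $ b $ a"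
      using k by (simp add: unitary_powi_def)
  qed (use k in \<open>simp add: power_trace_def trace_def unitary_powi_def\<close>)
qed

text \<open>The image of a single power trace: for positive k it is k times the sum of p_i p_(k-i)
  over 0 <= i < k, reflected for negative k. The term i = 0 contains p_0 = N, the trace of the
  identity.\<close>

definition casimir_coeffs :: "int \<Rightarrow> (complex \<times> int list) list" where
  "casimir_coeffs k = map (\<lambda>i. (of_int \<bar>k\<bar>, [sgn k * int i, k - sgn k * int i])) [0..<nat \<bar>k\<bar>]"

text \<open>Differentiating the entry \<open>(b, a)\<close> of X^k once more, along the unit at
  \<open>(b, a)\<close>, cuts the power into X^r and X^(k-r) with diagonal indices \<open>b\<close>
  and \<open>a\<close>. The sum over both indices is a product of two traces.\<close>

lemma casimir_deriv_power_trace: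
  "casimir_deriv (\<lambda>X. power_trace X k) (\<lambda>a b X. of_int k * unitary_powi X k $ b $ a)
     (\<lambda>X. of_int \<bar>k\<bar> * (\<Sum>i<nat \<bar>k\<bar>. power_trace X (sgn k * int i) * power_trace X (k - sgn k * int i)))"
proof (cases "k \<ge> 0")
  case True
  define m where "m = nat k"
  have k: "k = int m" using True by (simp add: m_def)
  have "lie_deriv (\<lambda>X. of_int k * matpow X m $ b $ a)
     (\<lambda>a' b' X. of_int k * (\<Sum>r<m. matpow X r $ b $ a' * matpow X (m - r) $ b' $ a))" for a b :: 'a
    by (intro lie_deriv_cmult lie_deriv_matpow)
  moreover have "of_int \<bar>k\<bar> * (\<Sum>i<nat \<bar>k\<bar>. power_trace X (sgn k * int i) * power_trace X (k - sgn k * int i))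
     = (\<Sum>a\<in>UNIV. \<Sum>b\<in>UNIV. of_int k * (\<Sum>r<m. matpow X r $ b $ b * matpow X (m - r) $ a $ a))"
    for X :: "complex^'a^'a"
  proof -
    have "(\<Sum>a\<in>UNIV. \<Sum>b\<in>UNIV. (\<Sum>r<m. matpow X r $ b $ b * matpow X (m - r) $ a $ a))
        = (\<Sum>a\<in>UNIV. \<Sum>r<m. \<Sum>b\<in>UNIV. matpow X r $ b $ b * matpow X (m - r) $ a $ a)"
      by (intro sum.cong refl sum.swap)
    also have "\<dots> = (\<Sum>r<m. \<Sum>a\<in>UNIV. \<Sum>b\<in>UNIV. matpow X r $ b $ b * matpow X (m - r) $ a $ a)"
      by (rule sum.swap)
    also have "\<dots> = (\<Sum>r<m. power_trace X (int r) * power_trace X (int m - int r))"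
    proof (intro sum.cong refl)
      fix r assume "r \<in> {..<m}"
      hence "nat (int m - int r) = m - r" "int m - int r \<ge> 0" by auto
      thus "(\<Sum>a\<in>UNIV. \<Sum>b\<in>UNIV. matpow X r $ b $ b * matpow X (m - r) $ a $ a)
         = power_trace X (int r) * power_trace X (int m - int r)"
        by (simp add: power_trace_def unitary_powi_def sum_diag_product_eq_trace)
    qed
    finally show ?thesis
      by (cases "m = 0") (simp_all add: k flip: sum_distrib_left)
  qed
  ultimately show ?thesis
    unfolding casimir_deriv_def using lie_deriv_power_trace[of k] True
    by (intro conjI exI[of _ "\<lambda>a b a' b' X. of_int k * (\<Sum>r<m. matpow X r $ b $ a' * matpow X (m - r) $ b' $ a)"])
      (auto simp: unitary_powi_def m_def)
next
  case False
  define m where "m = nat (- k)"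
  have k: "k = - int m" "m > 0" using False by (simp_all add: m_def)
  have "lie_deriv (\<lambda>X. of_int k * matpow (ctranspose X) m $ b $ a)
     (\<lambda>a' b' X. of_int k * - (\<Sum>r<m. matpow (ctranspose X) (Suc r) $ b $ a' * matpow (ctranspose X) (m - Suc r) $ b' $ a))" for a b :: 'a
    by (intro lie_deriv_cmult lie_deriv_matpow_ctranspose)
  moreover have "of_int \<bar>k\<bar> * (\<Sum>i<nat \<bar>k\<bar>. power_trace X (sgn k * int i) * power_trace X (k - sgn k * int i))
     = (\<Sum>a\<in>UNIV. \<Sum>b\<in>UNIV. of_int k * - (\<Sum>r<m. matpow (ctranspose X) (Suc r) $ b $ b * matpow (ctranspose X) (m - Suc r) $ a $ a))"
    for X :: "complex^'a^'a"
  proof -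
    let ?Y = "ctranspose X"
    have "(\<Sum>a\<in>UNIV. \<Sum>b\<in>UNIV. (\<Sum>r<m. matpow ?Y (Suc r) $ b $ b * matpow ?Y (m - Suc r) $ a $ a))
        = (\<Sum>a\<in>UNIV. \<Sum>r<m. \<Sum>b\<in>UNIV. matpow ?Y (Suc r) $ b $ b * matpow ?Y (m - Suc r) $ a $ a)"
      by (intro sum.cong refl sum.swap)
    also have "\<dots> = (\<Sum>r<m. \<Sum>a\<in>UNIV. \<Sum>b\<in>UNIV. matpow ?Y (Suc r) $ b $ b * matpow ?Y (m - Suc r) $ a $ a)"
      by (rule sum.swap)
    \<comment> \<open>Reflecting r to m-1-r turns the exponents r+1 and m-r-1 into m-r and r, which
      matches the indices in the claim.\<close>
    also have "\<dots> = (\<Sum>r<m. \<Sum>a\<in>UNIV. \<Sum>b\<in>UNIV. matpow ?Y (m - r) $ b $ b * matpow ?Y r $ a $ a)"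
      by (subst sum.nat_diff_reindex[symmetric]) (intro sum.cong refl, simp add: Suc_diff_Suc del: matpow.simps)
    also have "\<dots> = (\<Sum>r<m. power_trace X (- int r) * power_trace X (- int m + int r))"
    proof (intro sum.cong refl)
      fix r assume "r \<in> {..<m}"
      hence "nat (int m - int r) = m - r" "- int m + int r < 0" by auto
      thus "(\<Sum>a\<in>UNIV. \<Sum>b\<in>UNIV. matpow ?Y (m - r) $ b $ b * matpow ?Y r $ a $ a)
         = power_trace X (- int r) * power_trace X (- int m + int r)"
        unfolding sum_diag_product_eq_trace by (auto simp: power_trace_def unitary_powi_def)
    qed
    finally show ?thesis
      using k by (simp flip: sum_distrib_left)
  qed
  ultimately show ?thesis
    unfolding casimir_deriv_def using lie_deriv_power_trace[of k] False
    by (intro conjI exI[of _ "\<lambda>a b a' b' X. of_int k * - (\<Sum>r<m. matpow (ctranspose X) (Suc r) $ b $ a' * matpow (ctranspose X) (m - Suc r) $ b' $ a)"])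
      (auto simp: unitary_powi_def m_def)
qed

text \<open>A list of pairs \<open>(c, ks)\<close> stands for the sum of the terms $c\,p_{k_1}\cdots p_{k_r}$ in the power
  sums $p_k$ of positive and negative index.\<close>

fun gradient_coeffs :: "int \<Rightarrow> int list \<Rightarrow> (complex \<times> int list) list" where
  "gradient_coeffs k [] = []"
| "gradient_coeffs k (l # ls) = (of_int (k * l), (k + l) # ls) #
     map (\<lambda>(c, ms). (c, l # ms)) (gradient_coeffs k ls)"

text \<open>The three parts of the product rule: the operator on p_k, the operator on the remaining
  product, and twice the pairing of their gradients. The gradients of p_k and p_l pair to k l
  p_(k+l); \<open>gradient_coeffs\<close> extends this to products by Leibniz's rule.\<close>

fun casimir :: "int list \<Rightarrow> (complex \<times> int list) list" where
  "casimir [] = []"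
| "casimir (k # ks) = map (\<lambda>(c, ms). (c, ms @ ks)) (casimir_coeffs k)
     @ map (\<lambda>(c, ms). (c, k # ms)) (casimir ks)
     @ map (\<lambda>(c, ms). (2 * c, ms)) (gradient_coeffs k ks)"

definition peval :: "(int \<Rightarrow> complex) \<Rightarrow> (complex \<times> int list) list \<Rightarrow> complex" where
  "peval p cs = (\<Sum>(c, ks)\<leftarrow>cs. c * prod_list (map p ks))"

lemma peval_Nil [simp]: "peval p [] = 0"
  by (simp add: peval_def)

lemma peval_Cons [simp]: "peval p (x # cs) = fst x * prod_list (map p (snd x)) + peval p cs"
  by (simp add: peval_def case_prod_unfold)

lemma peval_append [simp]: "peval p (cs @ ds) = peval p cs + peval p ds"
  by (induction cs) simp_all

lemma peval_map_Cons: "peval p (map (\<lambda>(c, ms). (c, k # ms)) cs) = p k * peval p cs"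
  by (induction cs) (simp_all add: case_prod_unfold distrib_left)

lemma peval_map_append: "peval p (map (\<lambda>(c, ms). (c, ms @ ks)) cs) = peval p cs * prod_list (map p ks)"
  by (induction cs) (simp_all add: case_prod_unfold distrib_right)

lemma peval_map_scale: "peval p (map (\<lambda>(c, ms). (d * c, ms)) cs) = d * peval p cs"
  by (induction cs) (simp_all add: case_prod_unfold distrib_left)

lemma peval_casimir_coeffs:
  "peval p (casimir_coeffs k) = of_int \<bar>k\<bar> * (\<Sum>i<nat \<bar>k\<bar>. p (sgn k * int i) * p (k - sgn k * int i))"
proof -
  have *: "peval p (map (\<lambda>i. (c, [f i, g i])) xs) = (\<Sum>i\<leftarrow>xs. c * (p (f i) * p (g i)))" for c f g xs
    by (induction xs) simp_all
  show ?thesis unfolding casimir_coeffs_def *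
    by (simp only: interv_sum_list_conv_sum_set_nat set_upt atLeast0LessThan sum_distrib_left)
qed

primrec power_trace_gradient :: "int list \<Rightarrow> 'n \<Rightarrow> 'n \<Rightarrow> complex^'n^'n \<Rightarrow> complex" where
  "power_trace_gradient [] a b X = 0"
| "power_trace_gradient (k # ks) a b X = of_int k * unitary_powi X k $ b $ a * prod_list (map (power_trace X) ks) + power_trace X k * power_trace_gradient ks a b X"

text \<open>Contracting X^k with X^l in transposed index pairs yields the trace of the product of
  the two powers, which is p_(k+l); for exponents of opposite sign this uses unitarity.\<close>

lemma power_trace_gradient_contract:
  assumes "X \<in> unitary_group"
  shows "(\<Sum>a\<in>UNIV. \<Sum>b\<in>UNIV. of_int k * unitary_powi X k $ b $ a * power_trace_gradient ks b a X)
     = peval (power_trace X) (gradient_coeffs k ks)"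
proof (induction ks)
  case (Cons l ks)
  have "(\<Sum>a\<in>UNIV. \<Sum>b\<in>UNIV. unitary_powi X k $ b $ a * unitary_powi X l $ a $ b)
      = (\<Sum>b\<in>UNIV. (unitary_powi X k ** unitary_powi X l) $ b $ b)"
    by (subst sum.swap) (simp add: matrix_matrix_mult_def)
  also have "\<dots> = power_trace X (k + l)"
    by (simp add: power_trace_def trace_def unitary_powi_add[OF assms])
  finally have 1: "(\<Sum>a\<in>UNIV. \<Sum>b\<in>UNIV. unitary_powi X k $ b $ a * unitary_powi X l $ a $ b) = power_trace X (k + l)" .
  have "(\<Sum>a\<in>UNIV. \<Sum>b\<in>UNIV. of_int k * unitary_powi X k $ b $ a * power_trace_gradient (l # ks) b a X)
     = of_int (k * l) * prod_list (map (power_trace X) ks) * (\<Sum>a\<in>UNIV. \<Sum>b\<in>UNIV. unitary_powi X k $ b $ a * unitary_powi X l $ a $ b)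
      + power_trace X l * (\<Sum>a\<in>UNIV. \<Sum>b\<in>UNIV. of_int k * unitary_powi X k $ b $ a * power_trace_gradient ks b a X)"
    by (simp add: sum_distrib_left distrib_left sum.distrib ac_simps)
  thus ?case by (simp add: 1 Cons.IH peval_map_Cons)
qed simp

lemma casimir_deriv_prod_power_trace:
  fixes dp :: "int list \<Rightarrow> 'n \<Rightarrow> 'n \<Rightarrow> complex^'n^'n \<Rightarrow> complex"
  defines "dp \<equiv> power_trace_gradient"
  shows "casimir_deriv (\<lambda>X. prod_list (map (power_trace X) ks)) (dp ks) (\<lambda>X. peval (power_trace X) (casimir ks))"
proof (induction ks)
  case Nil
  have "dp [] = (\<lambda>a b X. 0)" by (simp add: dp_def fun_eq_iff)
  moreover have "casimir_deriv (\<lambda>X. 1) (\<lambda>a b X. 0) (\<lambda>X::complex^'n^'n. 0)"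
    unfolding casimir_deriv_def by (auto intro: lie_deriv_const intro!: exI[of _ "\<lambda>a b c d X. 0"])
  ultimately show ?case by simp
next
  case (Cons k ks)
  have *: "dp (k # ks) = (\<lambda>a b X. of_int k * unitary_powi X k $ b $ a * prod_list (map (power_trace X) ks) + power_trace X k * dp ks a b X)"
    by (simp add: fun_eq_iff dp_def)
  have "casimir_deriv (\<lambda>X. power_trace X k * prod_list (map (power_trace X) ks)) (dp (k # ks))
    (\<lambda>X. of_int \<bar>k\<bar> * (\<Sum>i<nat \<bar>k\<bar>. power_trace X (sgn k * int i) * power_trace X (k - sgn k * int i)) * prod_list (map (power_trace X) ks)
      + power_trace X k * peval (power_trace X) (casimir ks)
      + 2 * (\<Sum>a\<in>UNIV. \<Sum>b\<in>UNIV. of_int k * unitary_powi X k $ b $ a * dp ks b a X))"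
    unfolding * by (rule casimir_deriv_mult[OF casimir_deriv_power_trace Cons.IH])
  hence "casimir_deriv (\<lambda>X. power_trace X k * prod_list (map (power_trace X) ks)) (dp (k # ks))
     (\<lambda>X. peval (power_trace X) (casimir (k # ks)))"
    by (rule casimir_deriv_cong)
      (simp add: dp_def power_trace_gradient_contract peval_map_Cons peval_map_append peval_map_scale peval_casimir_coeffs)
  thus ?case by simp
qed

lemma lie_deriv_continuous_on: "lie_deriv F dF \<Longrightarrow> continuous_on unitary_group F"
  by (simp add: lie_deriv_def)

lemma continuous_on_power_trace: "continuous_on unitary_group (\<lambda>X. power_trace X k)"
  by (rule lie_deriv_continuous_on[OF lie_deriv_power_trace])

lemma continuous_on_prod_power_trace: "continuous_on unitary_group (\<lambda>X. prod_list (map (power_trace X) ks))"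
  by (rule lie_deriv_continuous_on[OF conjunct1[OF casimir_deriv_prod_power_trace[unfolded casimir_deriv_def]]])

lemma continuous_on_peval_power_trace: "continuous_on unitary_group (\<lambda>X. peval (power_trace X) cs)"
proof (induction cs)
  case (Cons x cs)
  thus ?case
    unfolding peval_Cons
    by (intro continuous_on_add continuous_on_mult continuous_on_const continuous_on_prod_power_trace)
qed simp

definition casimir_poly :: "(complex \<times> int list) list \<Rightarrow> (complex \<times> int list) list" where
  "casimir_poly cs = concat (map (\<lambda>(c, ks). map (\<lambda>(d, ls). (c * d, ls)) (casimir ks)) cs)"

lemma peval_casimir_poly: "peval p (casimir_poly cs) = (\<Sum>(c, ks)\<leftarrow>cs. c * peval p (casimir ks))"
proof (induction cs)
  case (Cons x cs)
  obtain c ks where x: "x = (c, ks)" by (cases x)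
  have "casimir_poly (x # cs) = map (\<lambda>(d, ls). (c * d, ls)) (casimir ks) @ casimir_poly cs"
    by (simp add: casimir_poly_def x)
  thus ?case by (simp add: Cons.IH peval_map_scale x)
qed (simp add: casimir_poly_def)

lemma integral_casimir_poly:
  assumes M: "haar_prob M"
  shows "(LINT X|M. peval (power_trace X) (casimir_poly cs)) = 0"
proof (induction cs)
  case (Cons x cs)
  obtain c ks where x: "x = (c, ks)" by (cases x)
  have "(LINT X|M. peval (power_trace X) (casimir_poly (x # cs)))
     = (LINT X|M. c * peval (power_trace X) (casimir ks) + peval (power_trace X) (casimir_poly cs))"
    by (simp add: peval_casimir_poly x)
  also have "\<dots> = c * (LINT X|M. peval (power_trace X) (casimir ks)) + (LINT X|M. peval (power_trace X) (casimir_poly cs))"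
    by (simp add: haar_integrable[OF M continuous_on_peval_power_trace])
  also have "\<dots> = 0"
    by (simp add: Cons.IH casimir_deriv_integral[OF M casimir_deriv_prod_power_trace])
  finally show ?case .
qed (simp add: casimir_poly_def)

section \<open>The Casimir operator on alternants\<close>

text \<open>The index type carries no order, so some numbering by 0, ..., N-1 is fixed. It doubles
  as the exponent vector of the Vandermonde alternant.\<close>

definition rho :: "'n::finite \<Rightarrow> int" where
  "rho = (SOME r. bij_betw r UNIV {0..<int CARD('n)})"

lemma rho_bij: "bij_betw rho (UNIV :: 'n::finite set) {0..<int CARD('n)}"
proof -
  have "\<exists>r :: 'n \<Rightarrow> int. bij_betw r UNIV {0..<int CARD('n)}"
    by (rule finite_same_card_bij) auto
  thus ?thesis unfolding rho_def by (rule someI_ex)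
qed

lemma rho_inj: "rho x = rho y \<longleftrightarrow> x = y"
  using rho_bij by (auto simp: bij_betw_def inj_on_def)

lemma rho_range: "0 \<le> rho (x :: 'n::finite)" "rho x < int CARD('n)"
  using bij_betw_apply[OF rho_bij, of x] by auto

lemma rho_surj:
  assumes "0 \<le> i" "i < int CARD('n)"
  obtains x :: "'n::finite" where "rho x = i"
  using bij_betw_imp_surj_on[OF rho_bij] assms by (metis (no_types, lifting) atLeastLessThan_iff imageE)

lemma card_rho_less: "card {x :: 'n::finite. rho x < rho (m :: 'n)} = nat (rho m)"
proof -
  have "rho ` {x :: 'n. rho x < rho m} = {0..<rho m}"
  proof (intro equalityI subsetI)
    fix i assume i: "i \<in> {0..<rho m}"
    then obtain x :: 'n where "rho x = i"
      using rho_surj[of i, where 'n = 'n] rho_range(2)[of m] by auto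
    thus "i \<in> rho ` {x :: 'n. rho x < rho m}" using i by auto
  qed (auto simp: rho_range)
  moreover have "inj_on rho {x :: 'n. rho x < rho m}" by (simp add: inj_on_def rho_inj)
  ultimately have "card {0..<rho m} = card {x :: 'n. rho x < rho m}" by (metis card_image)
  thus ?thesis by simp
qed

lemma card_rho_greater: "card {x :: 'n::finite. rho (m :: 'n) < rho x} = nat (int CARD('n) - 1 - rho m)"
proof -
  have "rho ` {x :: 'n. rho m < rho x} = {rho m<..<int CARD('n)}"
  proof (intro equalityI subsetI)
    fix i assume i: "i \<in> {rho m<..<int CARD('n)}"
    then obtain x :: 'n where "rho x = i"
      using rho_surj[of i, where 'n = 'n] rho_range(1)[of m] by auto
    thus "i \<in> rho ` {x :: 'n. rho m < rho x}" using i by auto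
  qed (auto simp: rho_range)
  moreover have "inj_on rho {x :: 'n. rho m < rho x}" by (simp add: inj_on_def rho_inj)
  ultimately have "card {rho m<..<int CARD('n)} = card {x :: 'n. rho m < rho x}" by (metis card_image)
  thus ?thesis by simp
qed

text \<open>A Laurent polynomial in indeterminates indexed by \<open>'n\<close> is represented by its coefficient function;
  \<open>power_op k\<close> is multiplication by the \<open>k\<close>-th power sum and \<open>alternant \<mu>\<close> is the
  antisymmetrization of the monomial with exponent \<open>\<mu>\<close>.\<close>

definition power_op :: "int \<Rightarrow> (('n::finite \<Rightarrow> int) \<Rightarrow> complex) \<Rightarrow> ('n \<Rightarrow> int) \<Rightarrow> complex" where
  "power_op k g \<nu> = (\<Sum>n\<in>UNIV. g (\<nu>(n := \<nu> n - k)))"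

text \<open>On coefficients, this is the first-order operator given by the sum over n of z_n^k times
  the Euler operator z_n d/dz_n. These operators satisfy the relations of the Witt algebra.\<close>

definition witt_op :: "int \<Rightarrow> (('n::finite \<Rightarrow> int) \<Rightarrow> complex) \<Rightarrow> ('n \<Rightarrow> int) \<Rightarrow> complex" where
  "witt_op k g \<nu> = (\<Sum>n\<in>UNIV. of_int (\<nu> n - k) * g (\<nu>(n := \<nu> n - k)))"

definition alternant :: "('n::finite \<Rightarrow> int) \<Rightarrow> ('n \<Rightarrow> int) \<Rightarrow> complex" where
  "alternant \<mu> \<nu> = det (\<chi> x y. of_bool (\<nu> x = \<mu> y))"

definition quad :: "('n::finite \<Rightarrow> int) \<Rightarrow> int" where
  "quad \<nu> = (\<Sum>n\<in>UNIV. \<nu> n * (\<nu> n - (int CARD('n) - 1)))"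

text \<open>Subtracting the value at \<open>rho\<close> gives the constant function 1, which
  corresponds to \<open>alternant rho\<close>, the eigenvalue 0.\<close>

definition casimir_eigenvalue :: "('n::finite \<Rightarrow> int) \<Rightarrow> int" where
  "casimir_eigenvalue \<nu> = quad \<nu> - quad (rho :: 'n \<Rightarrow> int)"

lemma alternant_altdef:
  "alternant \<mu> \<nu> = (\<Sum>p | p permutes UNIV. of_int (sign p) * of_bool (\<nu> = \<mu> \<circ> p))"
proof -
  have "(\<Prod>x\<in>UNIV. of_bool (\<nu> x = \<mu> (p x))) = (of_bool (\<nu> = \<mu> \<circ> p) :: complex)" for p
    by (auto simp: fun_eq_iff)
  thus ?thesis by (simp add: alternant_def det_def)
qed

lemma alternant_nonzero:
  assumes "alternant \<mu> \<nu> \<noteq> 0"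
  obtains p where "p permutes UNIV" "\<nu> = \<mu> \<circ> p"
proof -
  have "\<exists>p\<in>{p. p permutes UNIV}. of_int (sign p) * of_bool (\<nu> = \<mu> \<circ> p) \<noteq> (0::complex)"
    using assms unfolding alternant_altdef by (meson sum.neutral)
  thus ?thesis using that by (auto split: if_splits)
qed

lemma alternant_eq_columns:
  assumes "n \<noteq> m" "\<mu> n = \<mu> m"
  shows "alternant \<mu> \<nu> = 0"
  unfolding alternant_def
  by (rule det_identical_columns[OF assms(1)]) (simp add: column_def vec_eq_iff assms(2))

lemma alternant_permute:
  fixes \<mu> \<nu> :: "'n::finite \<Rightarrow> int"
  assumes "p permutes UNIV"
  shows "alternant (\<mu> \<circ> p) \<nu> = of_int (sign p) * alternant \<mu> \<nu>"
  using det_permute_columns[OF assms, of "(\<chi> x y. of_bool (\<nu> x = \<mu> y)) :: complex^'n^'n"]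
  by (simp add: alternant_def)

lemma alternant_permute_arg:
  fixes \<mu> \<nu> :: "'n::finite \<Rightarrow> int"
  assumes "p permutes UNIV"
  shows "alternant \<mu> (\<nu> \<circ> p) = of_int (sign p) * alternant \<mu> \<nu>"
  using det_permute_rows[OF assms, of "(\<chi> x y. of_bool (\<nu> x = \<mu> y)) :: complex^'n^'n"]
  by (simp add: alternant_def)

lemma alternant_rho_rho: "alternant rho (rho :: 'n::finite \<Rightarrow> int) = 1"
proof -
  have "(\<chi> x y. of_bool (rho x = rho y)) = (mat 1 :: complex^'n^'n)"
    by (simp add: vec_eq_iff mat_def rho_inj)
  thus ?thesis by (simp add: alternant_def)
qed

text \<open>Shifting the argument back at \<open>n\<close> is the same as shifting the exponent
  forward at its image \<open>p n\<close>; in this way an operator on arguments becomes one on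
  exponents.\<close>

lemma permutes_fun_upd:
  fixes \<mu> \<nu> :: "'n \<Rightarrow> int"
  assumes "p permutes UNIV"
  shows "\<nu>(n := \<nu> n - k) = \<mu> \<circ> p \<longleftrightarrow> \<nu> = \<mu>(p n := \<mu> (p n) + k) \<circ> p" (is "?l \<longleftrightarrow> ?r")
proof -
  have inj: "p x = p y \<longleftrightarrow> x = y" for x y using permutes_inj[OF assms] by (auto dest: injD)
  show ?thesis
  proof
    assume l: ?l
    show ?r
    proof
      fix x show "\<nu> x = (\<mu>(p n := \<mu> (p n) + k) \<circ> p) x"
        using fun_cong[OF l, of x] by (cases "x = n") (simp_all add: inj diff_eq_eq)
    qed
  next
    assume r: ?r
    show ?l
    proof
      fix x show "(\<nu>(n := \<nu> n - k)) x = (\<mu> \<circ> p) x"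
        using fun_cong[OF r, of x] by (auto simp: inj algebra_simps split: if_splits)
    qed
  qed
qed

text \<open>The determinant is expanded and each permutation treated separately, reindexing
  \<open>n\<close> by \<open>p n\<close>. On the support \<open>\<nu> n - k = \<mu> (p n)\<close>,
  so any weight \<open>w\<close> can be carried along: the constant 1 serves
  \<open>power_op\<close>, and \<open>of_int\<close> serves \<open>witt_op\<close>.\<close>

lemma witt_power_alternant_aux:
  fixes w :: "int \<Rightarrow> complex"
  shows "(\<Sum>n\<in>UNIV. w (\<nu> n - k) * alternant \<mu> (\<nu>(n := \<nu> n - k)))
     = (\<Sum>n\<in>UNIV. w (\<mu> n) * alternant (\<mu>(n := \<mu> n + k)) \<nu>)"
proof -
  have "(\<Sum>n\<in>UNIV. w (\<nu> n - k) * of_bool (\<nu>(n := \<nu> n - k) = \<mu> \<circ> p))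
     = (\<Sum>n\<in>UNIV. w (\<mu> n) * of_bool (\<nu> = \<mu>(n := \<mu> n + k) \<circ> p))" if p: "p permutes UNIV" for p
  proof -
    have "(\<Sum>n\<in>UNIV. w (\<mu> n) * of_bool (\<nu> = \<mu>(n := \<mu> n + k) \<circ> p))
       = (\<Sum>n\<in>UNIV. w (\<mu> (p n)) * of_bool (\<nu> = \<mu>(p n := \<mu> (p n) + k) \<circ> p))"
      by (rule sum.reindex_bij_betw[symmetric]) (rule permutes_imp_bij[OF p])
    also have "\<dots> = (\<Sum>n\<in>UNIV. w (\<nu> n - k) * of_bool (\<nu>(n := \<nu> n - k) = \<mu> \<circ> p))"
      unfolding permutes_fun_upd[OF p, symmetric] by (intro sum.cong) (auto simp: fun_eq_iff split: if_splits)
    finally show ?thesis ..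
  qed
  hence *: "(\<Sum>p | p permutes UNIV. of_int (sign p) * (\<Sum>n\<in>UNIV. w (\<nu> n - k) * of_bool (\<nu>(n := \<nu> n - k) = \<mu> \<circ> p)))
     = (\<Sum>p | p permutes UNIV. of_int (sign p) * (\<Sum>n\<in>UNIV. w (\<mu> n) * of_bool (\<nu> = \<mu>(n := \<mu> n + k) \<circ> p)))"
    by (intro sum.cong) auto
  show ?thesis
    unfolding alternant_altdef sum_distrib_left
    by (subst (1 2) sum.swap)
      (use *[unfolded sum_distrib_left] in \<open>simp only: mult.left_commute\<close>)
qed

lemma power_op_alternant:
  "power_op k (alternant \<mu>) \<nu> = (\<Sum>n\<in>UNIV. alternant (\<mu>(n := \<mu> n + k)) \<nu>)"
  using witt_power_alternant_aux[of "\<lambda>_. 1" \<nu> k \<mu>] by (simp add: power_op_def)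

lemma witt_op_alternant:
  "witt_op k (alternant \<mu>) \<nu> = (\<Sum>n\<in>UNIV. of_int (\<mu> n) * alternant (\<mu>(n := \<mu> n + k)) \<nu>)"
  using witt_power_alternant_aux[of of_int \<nu> k \<mu>] by (simp add: witt_op_def)

lemma power_op_linear: "power_op k (\<lambda>\<nu>. c * g \<nu> + h \<nu>) = (\<lambda>\<nu>. c * power_op k g \<nu> + power_op k h \<nu>)"
  by (simp add: power_op_def fun_eq_iff sum.distrib sum_distrib_left)

lemma power_op_zero: "power_op k (\<lambda>\<nu>. 0) = (\<lambda>\<nu>. 0)"
  by (simp add: power_op_def fun_eq_iff)

lemma power_op_sum: "power_op k (\<lambda>\<nu>. \<Sum>i\<in>I. g i \<nu>) = (\<lambda>\<nu>. \<Sum>i\<in>I. power_op k (g i) \<nu>)"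
  unfolding power_op_def by (rule ext) (rule sum.swap)

lemma power_op_commute: "power_op k (power_op l g) = power_op l (power_op k g)"
proof
  fix \<nu> :: "'a \<Rightarrow> int"
  have "\<nu>(n := \<nu> n - k, m := (\<nu>(n := \<nu> n - k)) m - l) = \<nu>(m := \<nu> m - l, n := (\<nu>(m := \<nu> m - l)) n - k)" for n m
    by (auto simp: fun_eq_iff)
  thus "power_op k (power_op l g) \<nu> = power_op l (power_op k g) \<nu>"
    unfolding power_op_def by (subst sum.swap) simp
qed

text \<open>The commutator of z^(k+1) d/dz with multiplication by z^l is l z^(k+l). Operators in
  different variables commute, so only the terms \<open>n = m\<close> differ.\<close>

lemma witt_op_power_op:
  "witt_op k (power_op l g) \<nu> = power_op l (witt_op k g) \<nu> + of_int l * power_op (k + l) g \<nu>"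
proof -
  have upd: "\<nu>(n := \<nu> n - k, m := (\<nu>(n := \<nu> n - k)) m - l) = \<nu>(m := \<nu> m - l, n := (\<nu>(m := \<nu> m - l)) n - k)" for n m
    by (auto simp: fun_eq_iff)
  have "power_op l (witt_op k g) \<nu>
     = (\<Sum>m\<in>UNIV. \<Sum>n\<in>UNIV. of_int (\<nu> n - k) * g (\<nu>(m := \<nu> m - l, n := (\<nu>(m := \<nu> m - l)) n - k))
         - (if n = m then of_int l * g (\<nu>(m := \<nu> m - (k + l))) else 0))"
    unfolding power_op_def witt_op_def
    by (intro sum.cong refl) (auto simp: algebra_simps)
  also have "\<dots> = (\<Sum>m\<in>UNIV. \<Sum>n\<in>UNIV. of_int (\<nu> n - k) * g (\<nu>(m := \<nu> m - l, n := (\<nu>(m := \<nu> m - l)) n - k)))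
       - of_int l * power_op (k + l) g \<nu>"
    by (simp add: sum_subtractf power_op_def sum_distrib_left)
  also have "(\<Sum>m\<in>UNIV. \<Sum>n\<in>UNIV. of_int (\<nu> n - k) * g (\<nu>(m := \<nu> m - l, n := (\<nu>(m := \<nu> m - l)) n - k)))
     = witt_op k (power_op l g) \<nu>"
    unfolding power_op_def witt_op_def sum_distrib_left upd by (rule sum.swap)
  finally show ?thesis by simp
qed

lemma quad_fun_upd:
  fixes \<nu> :: "'n::finite \<Rightarrow> int"
  shows "quad \<nu> = quad (\<nu>(n := \<nu> n - k)) + (2 * k * (\<nu> n - k) + k\<^sup>2 - (int CARD('n) - 1) * k)"
proof -
  have "quad \<mu> = \<mu> n * (\<mu> n - (int CARD('n) - 1)) + (\<Sum>m\<in>UNIV - {n}. \<mu> m * (\<mu> m - (int CARD('n) - 1)))"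
    for \<mu> :: "'n \<Rightarrow> int"
    unfolding quad_def by (rule sum.remove) auto
  from this[of \<nu>] this[of "\<nu>(n := \<nu> n - k)"] show ?thesis
    by (simp add: algebra_simps power2_eq_square)
qed

text \<open>\<open>quad\<close> is quadratic, so its commutator with a shift by \<open>k\<close> is
  of first order: the linear part is \<open>witt_op\<close>, the rest a multiple of
  \<open>power_op\<close>.\<close>

lemma casimir_eigenvalue_power_op:
  fixes g :: "('n::finite \<Rightarrow> int) \<Rightarrow> complex"
  shows "of_int (casimir_eigenvalue \<nu>) * power_op k g \<nu> = power_op k (\<lambda>\<nu>. of_int (casimir_eigenvalue \<nu>) * g \<nu>) \<nu>
     + 2 * of_int k * witt_op k g \<nu> + of_int (k\<^sup>2 - (int CARD('n) - 1) * k) * power_op k g \<nu>"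
proof -
  have "of_int (casimir_eigenvalue \<nu>) * g (\<nu>(n := \<nu> n - k)) = of_int (casimir_eigenvalue (\<nu>(n := \<nu> n - k))) * g (\<nu>(n := \<nu> n - k))
     + 2 * of_int k * (of_int (\<nu> n - k) * g (\<nu>(n := \<nu> n - k)))
     + of_int (k\<^sup>2 - (int CARD('n) - 1) * k) * g (\<nu>(n := \<nu> n - k))" for n
    unfolding casimir_eigenvalue_def by (subst quad_fun_upd[of \<nu> n k]) (simp add: algebra_simps)
  thus ?thesis
    by (simp add: power_op_def witt_op_def sum_distrib_left sum.distrib del: of_int_diff of_int_mult)
qed

lemma quad_permute: "p permutes UNIV \<Longrightarrow> quad (\<mu> \<circ> p) = quad \<mu>"
  unfolding quad_def o_def by (rule sum.reindex_bij_betw) (rule permutes_imp_bij)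

text \<open>The support of \<open>alternant rho\<close> consists of permutations of
  \<open>rho\<close>, on which \<open>quad\<close> is constant.\<close>

lemma casimir_eigenvalue_alternant_rho: "of_int (casimir_eigenvalue \<nu>) * alternant rho \<nu> = 0"
proof (cases "alternant rho \<nu> = 0")
  case False
  then obtain p where "p permutes UNIV" "\<nu> = rho \<circ> p" by (rule alternant_nonzero)
  thus ?thesis by (simp add: casimir_eigenvalue_def quad_permute)
qed simp

text \<open>The summands with \<open>0 < i < \<bar>rho m - rho n\<bar>\<close> have a repeated exponent, and
  \<open>i \<mapsto> k + \<bar>rho m - rho n\<bar> - i\<close> swaps the two exponents in the remaining ones with \<open>i > 0\<close>.\<close>

lemma alternant_sum_pair:
  fixes n m :: "'n::finite"
  assumes s: "\<bar>s\<bar> = 1" and d: "s * (rho m - rho n) > 0"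
  shows "(\<Sum>i\<in>{0..int k}. alternant (rho(n := rho n + s * i, m := rho m + s * (int k - i))) \<nu>)
     = alternant (rho(m := rho m + s * int k)) \<nu>"
proof -
  define d where "d = s * (rho m - rho n)"
  define B where "B i = alternant (rho(n := rho n + s * i, m := rho m + s * (int k - i))) \<nu>" for i
  have nm: "n \<noteq> m" and d0: "d > 0" using d by (auto simp: d_def)
  have ss: "s * (s * x) = x" for x
  proof -
    from s consider "s = 1" | "s = -1" by linarith
    thus ?thesis by cases auto
  qed
  have sd: "s * d = rho m - rho n" by (simp add: d_def ss)
  have B0: "B i = 0" if "0 < i" "i < d" for i
  proof -
    have "0 \<le> rho n + s * i" "rho n + s * i < int CARD('n)"
    proof -
      have "(s = 1 \<and> i < rho m - rho n) \<or> (s = -1 \<and> i < rho n - rho m)"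
        using s that(2) by (cases "s = 1") (simp_all add: d_def abs_if split: if_splits)
      thus "0 \<le> rho n + s * i" "rho n + s * i < int CARD('n)"
        using rho_range[of n] rho_range[of m] that(1) by (elim disjE conjE; simp)+
    qed
    then obtain n' :: 'n where n': "rho n' = rho n + s * i" by (rule rho_surj)
    have "n' \<noteq> n"
    proof
      assume "n' = n"
      hence "s * i = 0" using n' by simp
      thus False using that(1) ss[of i] by simp
    qed
    have "n' \<noteq> m"
    proof
      assume "n' = m"
      hence "s * d = s * i" using n' sd by simp
      thus False using that(2) ss[of d] ss[of i] by simp
    qed
    thus ?thesis using \<open>n' \<noteq> n\<close> nm n' unfolding B_def
      by (intro alternant_eq_columns[of n n']) auto
  qed
  have swap: "B (int k + d - i) = - B i" for i
  proof -
    let ?t = "Transposition.transpose n m"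
    have "rho n + s * (int k + d - i) = rho m + s * (int k - i)"
      "rho m + s * (int k - (int k + d - i)) = rho n + s * i"
      using sd by (simp_all add: algebra_simps)
    hence "rho(n := rho n + s * (int k + d - i), m := rho m + s * (int k - (int k + d - i)))
       = rho(n := rho n + s * i, m := rho m + s * (int k - i)) \<circ> ?t"
      using nm by (simp add: fun_eq_iff Transposition.transpose_def)
    moreover have "?t permutes UNIV" by (simp add: permutes_swap_id)
    moreover have "sign ?t = -1" using nm by (simp add: sign_swap_id)
    ultimately show ?thesis by (simp add: B_def alternant_permute)
  qed
  have "(\<Sum>i\<in>{d..int k}. B i) = (\<Sum>i\<in>{d..int k}. B (int k + d - i))"
    by (rule sum.reindex_bij_witness[of _ "\<lambda>i. int k + d - i" "\<lambda>i. int k + d - i"]) auto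
  also have "\<dots> = - (\<Sum>i\<in>{d..int k}. B i)" by (simp add: swap sum_negf)
  finally have tail: "(\<Sum>i\<in>{d..int k}. B i) = 0" by simp
  have "(\<Sum>i\<in>{0..int k}. B i) = (\<Sum>i\<in>insert 0 {d..int k}. B i)"
  proof (rule sum.mono_neutral_right)
    show "\<forall>i\<in>{0..int k} - insert 0 {d..int k}. B i = 0"
    proof
      fix i assume "i \<in> {0..int k} - insert 0 {d..int k}"
      thus "B i = 0" by (intro B0) auto
    qed
  qed (use d0 in auto)
  also have "\<dots> = B 0" using d0 tail by simp
  finally show ?thesis by (simp add: B_def fun_upd_idem[of rho n])
qed

text \<open>The end term \<open>i = k\<close> is removed from the full sum of
  \<open>alternant_sum_pair\<close>. In the opposite order of \<open>rho n\<close> and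
  \<open>rho m\<close>, reflecting \<open>i\<close> to \<open>k - i\<close> exchanges the two
  indices, and the full sum is then equal to the removed term.\<close>

lemma alternant_sum_pair':
  fixes n m :: "'n::finite"
  assumes s: "\<bar>s\<bar> = 1" and nm: "n \<noteq> m"
  shows "(\<Sum>i\<in>{0..<int k}. alternant (rho(n := rho n + s * i, m := rho m + s * (int k - i))) \<nu>)
     = (if s * (rho m - rho n) > 0 then alternant (rho(m := rho m + s * int k)) \<nu> - alternant (rho(n := rho n + s * int k)) \<nu> else 0)"
proof -
  define B where "B n m i = alternant (rho(n := rho n + s * i, m := rho m + s * (int k - i))) \<nu>" for n m i
  have "{0..int k} = insert (int k) {0..<int k}" by auto
  hence 1: "(\<Sum>i\<in>{0..int k}. B n m i) = B n m (int k) + (\<Sum>i\<in>{0..<int k}. B n m i)" by simp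
  have 2: "B n m (int k) = alternant (rho(n := rho n + s * int k)) \<nu>"
    using nm by (simp add: B_def fun_upd_idem)
  have rho: "rho m \<noteq> rho n" using nm by (simp add: rho_inj)
  show ?thesis
  proof (cases "s * (rho m - rho n) > 0")
    case True
    thus ?thesis using 1 2 alternant_sum_pair[OF s True, of k \<nu>] by (simp add: B_def)
  next
    case False
    have "s * (rho m - rho n) \<noteq> 0" using s rho by auto
    hence d: "s * (rho n - rho m) > 0" using False by (simp only: right_diff_distrib)
    have "(\<Sum>i\<in>{0..int k}. B n m i) = (\<Sum>i\<in>{0..int k}. B m n i)"
      by (rule sum.reindex_bij_witness[of _ "\<lambda>i. int k - i" "\<lambda>i. int k - i"])
        (use nm in \<open>auto simp: B_def fun_upd_twist\<close>)
    thus ?thesis using 1 2 alternant_sum_pair[OF s d, of k \<nu>] False by (simp add: B_def)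
  qed
qed

text \<open>Both sides are combinations of the alternants \<open>C n\<close> in which a single
  exponent is shifted by \<open>k\<close>. On the left the coefficient is k^2 + k (2 rho n - (N-1)).
  On the right each pair of distinct indices collapses to 0 or a difference
  \<open>C m - C n\<close>, so the coefficient counts indices below and above
  \<open>n\<close>.\<close>

lemma casimir_base:
  fixes \<nu> :: "'n::finite \<Rightarrow> int"
  shows "of_int (casimir_eigenvalue \<nu>) * power_op k (alternant rho) \<nu>
     = of_int \<bar>k\<bar> * (\<Sum>i<nat \<bar>k\<bar>. power_op (sgn k * int i) (power_op (k - sgn k * int i) (alternant rho)) \<nu>)"
proof (cases "k = 0")
  case True
  have "power_op 0 (alternant rho) = (\<lambda>\<nu>. of_nat CARD('n) * alternant rho (\<nu> :: 'n \<Rightarrow> int))"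
    by (simp add: power_op_def fun_eq_iff)
  thus ?thesis using True casimir_eigenvalue_alternant_rho[of \<nu>] by simp
next
  case False
  define s where "s = sgn k"
  define K where "K = nat \<bar>k\<bar>"
  have s: "\<bar>s\<bar> = 1" and k: "k = s * int K" and K: "\<bar>k\<bar> = int K"
    using False by (auto simp: s_def K_def sgn_if)
  define C where "C n = alternant (rho(n := rho n + k)) \<nu>" for n
  have "of_int (casimir_eigenvalue \<nu>) * power_op k (alternant rho) \<nu>
     = 2 * of_int k * witt_op k (alternant rho) \<nu> + of_int (k\<^sup>2 - (int CARD('n) - 1) * k) * power_op k (alternant rho) \<nu>"
    by (simp add: casimir_eigenvalue_power_op casimir_eigenvalue_alternant_rho power_op_zero)
  also have "\<dots> = (\<Sum>n\<in>UNIV. of_int (k\<^sup>2 + k * (2 * rho n - (int CARD('n) - 1))) * C n)"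
    unfolding witt_op_alternant power_op_alternant sum_distrib_left sum.distrib[symmetric]
    by (intro sum.cong refl) (simp add: C_def algebra_simps)
  finally have lhs: "of_int (casimir_eigenvalue \<nu>) * power_op k (alternant rho) \<nu> = \<dots>" .
  \<comment> \<open>For \<open>m = n\<close> the two shifts add up to \<open>k\<close>, whatever
    \<open>i\<close> is.\<close>
  have "power_op (s * int i) (power_op (k - s * int i) (alternant rho)) \<nu>
     = (\<Sum>n\<in>UNIV. \<Sum>m\<in>UNIV. if m = n then C n
          else alternant (rho(n := rho n + s * int i, m := rho m + s * (int K - int i))) \<nu>)" for i
  proof -
    have "power_op (s * int i) (power_op (k - s * int i) (alternant rho)) \<nu>
      = power_op (k - s * int i) (power_op (s * int i) (alternant rho)) \<nu>"
      by (simp add: power_op_commute)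
    also have "power_op (s * int i) (alternant rho) = (\<lambda>\<nu>. \<Sum>n\<in>UNIV. alternant (rho(n := rho n + s * int i)) (\<nu> :: 'n \<Rightarrow> int))"
      by (simp add: fun_eq_iff power_op_alternant)
    also have "power_op (k - s * int i) \<dots> \<nu>
       = (\<Sum>n\<in>UNIV. \<Sum>m\<in>UNIV. alternant ((rho(n := rho n + s * int i))(m := (rho(n := rho n + s * int i)) m + (k - s * int i))) \<nu>)"
      by (simp add: power_op_sum power_op_alternant del: fun_upd_apply)
    also have "\<dots> = (\<Sum>n\<in>UNIV. \<Sum>m\<in>UNIV. if m = n then C n
          else alternant (rho(n := rho n + s * int i, m := rho m + s * (int K - int i))) \<nu>)"
      by (intro sum.cong refl) (auto simp: C_def k algebra_simps)
    finally show ?thesis .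
  qed
  hence "(\<Sum>i<K. power_op (s * int i) (power_op (k - s * int i) (alternant rho)) \<nu>)
     = (\<Sum>n\<in>UNIV. \<Sum>m\<in>UNIV. \<Sum>i<K. if m = n then C n
          else alternant (rho(n := rho n + s * int i, m := rho m + s * (int K - int i))) \<nu>)"
    by (simp only:) (subst sum.swap, intro sum.cong refl, rule sum.swap)
  also have "\<dots> = (\<Sum>n\<in>UNIV. \<Sum>m\<in>UNIV. (if m = n then of_nat K * C n else 0)
        + (if s * (rho m - rho n) > 0 then C m - C n else 0))"
  proof (intro sum.cong refl)
    fix n m :: 'n
    have "(\<Sum>i<K. alternant (rho(n := rho n + s * int i, m := rho m + s * (int K - int i))) \<nu>)
       = (\<Sum>i\<in>{0..<int K}. alternant (rho(n := rho n + s * i, m := rho m + s * (int K - i))) \<nu>)"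
      by (rule sum.reindex_bij_witness[of _ nat int]) auto
    thus "(\<Sum>i<K. if m = n then C n
          else alternant (rho(n := rho n + s * int i, m := rho m + s * (int K - int i))) \<nu>)
       = (if m = n then of_nat K * C n else 0) + (if s * (rho m - rho n) > 0 then C m - C n else 0)"
      using alternant_sum_pair'[OF s, of n m K \<nu>] by (auto simp: C_def k)
  qed
  also have "\<dots> = of_nat K * (\<Sum>n\<in>UNIV. C n)
      + (\<Sum>n\<in>UNIV. \<Sum>m\<in>UNIV. if s * (rho m - rho n) > 0 then C m - C n else 0)"
    by (simp add: sum.distrib sum_distrib_left)
  also have "(\<Sum>n\<in>UNIV. \<Sum>m\<in>UNIV. if s * (rho m - rho n) > 0 then C m - C n else 0)
     = (\<Sum>n\<in>UNIV. \<Sum>m\<in>UNIV. (if s * (rho (m::'n) - rho (n::'n)) > 0 then C m else 0))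
      - (\<Sum>n\<in>UNIV. \<Sum>m\<in>UNIV. (if s * (rho (m::'n) - rho (n::'n)) > 0 then C n else 0))"
  proof -
    have "(if P then x - y else 0) = (if P then x else 0) - (if P then y else (0::complex))" for P x y by simp
    thus ?thesis by (simp only: sum_subtractf)
  qed
  also have "(\<Sum>n\<in>UNIV. \<Sum>m\<in>UNIV. (if s * (rho (m::'n) - rho (n::'n)) > 0 then C m else 0))
     = (\<Sum>m\<in>UNIV. of_nat (card {n :: 'n. s * (rho m - rho n) > 0}) * C m)"
    by (subst sum.swap) (simp flip: sum.inter_filter)
  also have "(\<Sum>n\<in>UNIV. \<Sum>m\<in>UNIV. (if s * (rho (m::'n) - rho (n::'n)) > 0 then C n else 0))
     = (\<Sum>n\<in>UNIV. of_nat (card {m :: 'n. s * (rho m - rho n) > 0}) * C n)"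
    by (simp flip: sum.inter_filter)
  finally have rhs: "(\<Sum>i<K. power_op (s * int i) (power_op (k - s * int i) (alternant rho)) \<nu>)
     = (\<Sum>n\<in>UNIV. (of_nat K + of_nat (card {m :: 'n. s * (rho n - rho m) > 0}) - of_nat (card {m :: 'n. s * (rho m - rho n) > 0})) * C n)"
    by (simp add: sum_distrib_left sum.distrib sum_subtractf algebra_simps)
  \<comment> \<open>There are rho n numbers below and N-1-rho n above; the difference, with the sign
    of \<open>k\<close>, is the linear term on the left.\<close>
  have "int K * (int K + int (card {m :: 'n. s * (rho n - rho m) > 0}) - int (card {m :: 'n. s * (rho m - rho n) > 0}))
      = k\<^sup>2 + k * (2 * rho n - (int CARD('n) - 1))" for n :: 'n
  proof -
    have c: "int (card {x :: 'n. rho x < rho n}) = rho n" "int (card {x :: 'n. rho n < rho x}) = int CARD('n) - 1 - rho n"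
      using rho_range[of n] by (simp_all add: card_rho_less card_rho_greater)
    have "s = 1 \<or> s = -1" using s by linarith
    hence "int (card {m :: 'n. s * (rho n - rho m) > 0}) - int (card {m :: 'n. s * (rho m - rho n) > 0})
        = s * (2 * rho n - (int CARD('n) - 1))" and ss: "s * s = 1"
      using c by auto
    hence "int K * (int K + (int (card {m :: 'n. s * (rho n - rho m) > 0}) - int (card {m :: 'n. s * (rho m - rho n) > 0})))
        = (s * s) * int K * int K + k * (2 * rho n - (int CARD('n) - 1))"
      by (simp add: k distrib_left ss)
    thus ?thesis by (simp add: k power2_eq_square ac_simps add_diff_eq)
  qed
  note int_eq = this
  have eqC: "of_nat K * (of_nat K + of_nat (card {m :: 'n. s * (rho n - rho m) > 0}) - of_nat (card {m :: 'n. s * (rho m - rho n) > 0}))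
      = (of_int (k\<^sup>2 + k * (2 * rho n - (int CARD('n) - 1))) :: complex)" for n :: 'n
    unfolding int_eq[symmetric] by (simp only: of_int_mult of_int_add of_int_diff of_int_of_nat_eq)
  have "of_int (casimir_eigenvalue \<nu>) * power_op k (alternant rho) \<nu>
     = of_nat K * (\<Sum>i<K. power_op (s * int i) (power_op (k - s * int i) (alternant rho)) \<nu>)"
    unfolding lhs rhs sum_distrib_left by (intro sum.cong refl) (simp only: eqC mult.assoc[symmetric])
  thus ?thesis by (simp add: K flip: s_def)
qed

section \<open>Products of power sums acting on alternants\<close>

primrec power_ops :: "int list \<Rightarrow> (('n::finite \<Rightarrow> int) \<Rightarrow> complex) \<Rightarrow> ('n \<Rightarrow> int) \<Rightarrow> complex" where
  "power_ops [] g = g"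
| "power_ops (k # ks) g = power_op k (power_ops ks g)"

lemma power_ops_append: "power_ops (ks @ ls) g = power_ops ks (power_ops ls g)"
  by (induction ks) simp_all

lemma power_ops_commute1: "power_ops ks (power_op k g) = power_op k (power_ops ks g)"
  by (induction ks) (simp_all add: power_op_commute)

lemma power_ops_commute: "power_ops ks (power_ops ls g) = power_ops ls (power_ops ks g)"
  by (induction ks) (simp_all add: power_ops_commute1)

lemma power_ops_linear: "power_ops ks (\<lambda>\<nu>. c * g \<nu> + h \<nu>) = (\<lambda>\<nu>. c * power_ops ks g \<nu> + power_ops ks h \<nu>)"
  by (induction ks) (simp_all add: power_op_linear)

lemma power_ops_scale: "power_ops ks (\<lambda>\<nu>. c * g \<nu>) = (\<lambda>\<nu>. c * power_ops ks g \<nu>)"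
proof (induction ks)
  case (Cons k ks)
  thus ?case using power_op_linear[of k c "power_ops ks g" "\<lambda>\<nu>. 0"] by (simp add: power_op_zero)
qed simp

lemma power_ops_zero: "power_ops ks (\<lambda>\<nu>. 0) = (\<lambda>\<nu>. 0)"
  by (induction ks) (simp_all add: power_op_zero)

text \<open>The formal counterpart of \<open>peval\<close>: the same list of terms, read as
  multiplication operators on coefficient functions.\<close>

definition peval_op :: "(complex \<times> int list) list \<Rightarrow> (('n::finite \<Rightarrow> int) \<Rightarrow> complex) \<Rightarrow> ('n \<Rightarrow> int) \<Rightarrow> complex" where
  "peval_op cs g \<nu> = (\<Sum>(c, ks)\<leftarrow>cs. c * power_ops ks g \<nu>)"

lemma peval_op_Nil [simp]: "peval_op [] g = (\<lambda>\<nu>. 0)"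
  by (simp add: peval_op_def fun_eq_iff)

lemma peval_op_Cons [simp]: "peval_op (x # cs) g = (\<lambda>\<nu>. fst x * power_ops (snd x) g \<nu> + peval_op cs g \<nu>)"
  by (simp add: peval_op_def fun_eq_iff case_prod_unfold)

lemma peval_op_append: "peval_op (cs @ ds) g \<nu> = peval_op cs g \<nu> + peval_op ds g \<nu>"
  by (simp add: peval_op_def)

lemma peval_op_map_Cons:
  "peval_op (map (\<lambda>(c, ms). (c, k # ms)) cs) g = power_op k (peval_op cs g)"
  by (induction cs) (simp_all add: case_prod_unfold power_op_linear power_op_zero)

lemma peval_op_map_append:
  "peval_op (map (\<lambda>(c, ms). (c, ms @ ks)) cs) g = power_ops ks (peval_op cs g)"
  by (induction cs)
    (simp_all add: case_prod_unfold power_ops_linear power_ops_zero power_ops_append power_ops_commute[of ks])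

lemma peval_op_map_scale: "peval_op (map (\<lambda>(c, ms). (d * c, ms)) cs) g \<nu> = d * peval_op cs g \<nu>"
  by (induction cs) (simp_all add: case_prod_unfold distrib_left)

lemma peval_op_casimir_coeffs:
  "peval_op (casimir_coeffs k) g \<nu> = of_int \<bar>k\<bar> * (\<Sum>i<nat \<bar>k\<bar>. power_op (sgn k * int i) (power_op (k - sgn k * int i) g) \<nu>)"
proof -
  have *: "peval_op (map (\<lambda>i. (c, [f i, h i])) xs) g \<nu> = (\<Sum>i\<leftarrow>xs. c * power_op (f i) (power_op (h i) g) \<nu>)" for c f h xs
    by (induction xs) simp_all
  show ?thesis unfolding casimir_coeffs_def *
    by (simp only: interv_sum_list_conv_sum_set_nat set_upt atLeast0LessThan sum_distrib_left)
qed

text \<open>Each passage of \<open>witt_op k\<close> past a factor p_l leaves the commutator l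
  p_(k+l); collecting these is the recursion of \<open>gradient_coeffs\<close>.\<close>

lemma witt_op_power_ops:
  "of_int k * witt_op k (power_ops ks g) \<nu>
     = of_int k * power_ops ks (witt_op k g) \<nu> + peval_op (gradient_coeffs k ks) g \<nu>"
proof (induction ks arbitrary: \<nu>)
  case (Cons l ks)
  have "of_int k * witt_op k (power_ops (l # ks) g) \<nu>
     = power_op l (\<lambda>\<nu>. of_int k * witt_op k (power_ops ks g) \<nu> + 0) \<nu> + of_int k * of_int l * power_op (k + l) (power_ops ks g) \<nu>"
    by (subst power_op_linear) (simp add: witt_op_power_op distrib_left mult.assoc power_op_zero)
  also have "(\<lambda>\<nu>. of_int k * witt_op k (power_ops ks g) \<nu> + 0)
     = (\<lambda>\<nu>. of_int k * power_ops ks (witt_op k g) \<nu> + peval_op (gradient_coeffs k ks) g \<nu>)"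
    by (simp add: Cons.IH)
  finally show ?case by (simp add: power_op_linear peval_op_map_Cons)
qed simp

text \<open>The list that came out of differentiating traces also describes the diagonal operator on
  the formal side. Moving that operator past the factors one by one reproduces the product rule:
  commutators give the gradient terms, and what reaches the alternant is
  \<open>casimir_base\<close>.\<close>

lemma casimir_eigenvalue_power_ops:
  fixes \<nu> :: "'n::finite \<Rightarrow> int"
  shows "of_int (casimir_eigenvalue \<nu>) * power_ops ks (alternant rho) \<nu> = peval_op (casimir ks) (alternant rho) \<nu>"
proof (induction ks arbitrary: \<nu>)
  case Nil
  thus ?case using casimir_eigenvalue_alternant_rho by simp
next
  case (Cons k ks)
  let ?a = "alternant (rho :: 'n \<Rightarrow> int)"
  let ?q = "of_int (k\<^sup>2 - (int CARD('n) - 1) * k) :: complex"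
  \<comment> \<open>The diagonal operator annihilates \<open>alternant rho\<close>, so its value on
    p_k times the alternant is just the commutator.\<close>
  have base: "2 * of_int k * witt_op k ?a \<nu> + ?q * power_op k ?a \<nu> = peval_op (casimir_coeffs k) ?a \<nu>" for \<nu>
  proof -
    have "of_int (casimir_eigenvalue \<nu>) * power_op k ?a \<nu> = 2 * of_int k * witt_op k ?a \<nu> + ?q * power_op k ?a \<nu>"
      by (simp add: casimir_eigenvalue_power_op casimir_eigenvalue_alternant_rho power_op_zero)
    thus ?thesis by (simp only: casimir_base peval_op_casimir_coeffs)
  qed
  have "of_int (casimir_eigenvalue \<nu>) * power_ops (k # ks) ?a \<nu>
     = power_op k (\<lambda>\<nu>. of_int (casimir_eigenvalue \<nu>) * power_ops ks ?a \<nu>) \<nu>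
       + 2 * (of_int k * witt_op k (power_ops ks ?a) \<nu>) + ?q * power_op k (power_ops ks ?a) \<nu>"
    by (simp add: casimir_eigenvalue_power_op mult.assoc)
  also have "\<dots> = power_op k (peval_op (casimir ks) ?a) \<nu> + 2 * peval_op (gradient_coeffs k ks) ?a \<nu>
      + (2 * of_int k * power_ops ks (witt_op k ?a) \<nu> + ?q * power_op k (power_ops ks ?a) \<nu>)"
    by (simp add: Cons.IH witt_op_power_ops distrib_left)
  \<comment> \<open>Multiplication operators commute, so the remaining factors are taken outside and
    the base identity applies directly at the alternant.\<close>
  also have "2 * of_int k * power_ops ks (witt_op k ?a) \<nu> + ?q * power_op k (power_ops ks ?a) \<nu>
     = power_ops ks (peval_op (casimir_coeffs k) ?a) \<nu>"
  proof -
    have "power_ops ks (\<lambda>\<nu>. 2 * of_int k * witt_op k ?a \<nu> + ?q * power_op k ?a \<nu>) \<nu>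
       = 2 * of_int k * power_ops ks (witt_op k ?a) \<nu> + ?q * power_op k (power_ops ks ?a) \<nu>"
      by (simp only: power_ops_linear power_ops_scale power_ops_commute1)
    moreover have "(\<lambda>\<nu>. 2 * of_int k * witt_op k ?a \<nu> + ?q * power_op k ?a \<nu>) = peval_op (casimir_coeffs k) ?a"
      by (rule ext) (rule base)
    ultimately show ?thesis by (simp only:)
  qed
  finally show ?case
    by (simp add: peval_op_append peval_op_map_Cons peval_op_map_append peval_op_map_scale)
qed

lemma peval_op_casimir_poly:
  fixes \<nu> :: "'n::finite \<Rightarrow> int"
  shows "peval_op (casimir_poly cs) (alternant rho) \<nu> = of_int (casimir_eigenvalue \<nu>) * peval_op cs (alternant rho) \<nu>"
proof (induction cs)
  case (Cons x cs)
  obtain c ks where x: "x = (c, ks)" by (cases x)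
  have "casimir_poly (x # cs) = map (\<lambda>(d, ls). (c * d, ls)) (casimir ks) @ casimir_poly cs"
    by (simp add: casimir_poly_def x)
  thus ?case
    by (simp add: Cons.IH peval_op_append peval_op_map_scale x distrib_left casimir_eigenvalue_power_ops[symmetric] mult.left_commute)
qed (simp add: casimir_poly_def)

section \<open>Antisymmetry and elimination of eigenvalues\<close>

lemma power_op_permute_arg:
  assumes p: "p permutes UNIV" and g: "\<And>\<nu>. g (\<nu> \<circ> p) = c * g \<nu>"
  shows "power_op k g (\<nu> \<circ> p) = c * power_op k g \<nu>"
proof -
  have inj: "p x = p y \<longleftrightarrow> x = y" for x y using permutes_inj[OF p] by (auto dest: injD)
  have "(\<nu> \<circ> p)(n := (\<nu> \<circ> p) n - k) = \<nu>(p n := \<nu> (p n) - k) \<circ> p" for n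
    by (auto simp: fun_eq_iff inj)
  hence "power_op k g (\<nu> \<circ> p) = (\<Sum>n\<in>UNIV. c * g (\<nu>(p n := \<nu> (p n) - k)))"
    by (simp add: power_op_def g)
  also have "\<dots> = (\<Sum>n\<in>UNIV. c * g (\<nu>(n := \<nu> n - k)))"
    by (rule sum.reindex_bij_betw) (rule permutes_imp_bij[OF p])
  finally show ?thesis by (simp add: power_op_def sum_distrib_left)
qed

lemma power_ops_alternant_permute:
  assumes "p permutes UNIV"
  shows "power_ops ks (alternant \<mu>) (\<nu> \<circ> p) = of_int (sign p) * power_ops ks (alternant \<mu>) \<nu>"
proof (induction ks arbitrary: \<nu>)
  case (Cons k ks)
  show ?case unfolding power_ops.simps
    by (rule power_op_permute_arg[where g = "power_ops ks (alternant \<mu>)", OF assms Cons.IH])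
qed (simp add: alternant_permute_arg[OF assms])

text \<open>The transposition of \<open>n\<close> and \<open>m\<close> fixes \<open>\<nu>\<close>
  but reverses the sign of the coefficient, since multiplication by symmetric functions preserves
  antisymmetry.\<close>

lemma power_ops_alternant_not_inj:
  assumes "n \<noteq> m" "\<nu> n = \<nu> m"
  shows "power_ops ks (alternant \<mu>) \<nu> = 0"
proof -
  let ?t = "Transposition.transpose n m"
  have "\<nu> \<circ> ?t = \<nu>" using assms by (auto simp: fun_eq_iff Transposition.transpose_def)
  moreover have "?t permutes UNIV" by (simp add: permutes_swap_id)
  moreover have "sign ?t = -1" using assms by (simp add: sign_swap_id)
  ultimately show ?thesis using power_ops_alternant_permute[of ?t ks \<mu> \<nu>] by simp
qed

text \<open>Q is nonpositive at 0, ..., N-1 and positive at all other integers. Once common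
  exponents are cancelled, a sum of positive terms over exponents outside this range equals a sum of
  nonpositive terms over the missing ones, so none lie outside. N distinct values within the range
  fill it.\<close>

lemma casimir_eigenvalue_zero_imp_permutation:
  fixes \<nu> :: "'n::finite \<Rightarrow> int"
  assumes inj: "inj \<nu>" and 0: "casimir_eigenvalue \<nu> = 0"
  obtains p where "p permutes UNIV" "\<nu> = rho \<circ> p"
proof -
  let ?N = "int CARD('n)"
  define Q where "Q i = i * (i - (?N - 1))" for i :: int
  define S R where "S = range \<nu>" and "R = {0..<?N}"
  have R: "R = range (rho :: 'n \<Rightarrow> int)" using rho_bij[where 'n = 'n] by (simp add: R_def bij_betw_def)
  have fin: "finite S" "finite R" by (simp_all add: S_def R)
  have "quad \<nu> = sum Q S" using inj by (simp add: quad_def Q_def S_def sum.reindex)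
  moreover have "quad (rho :: 'n \<Rightarrow> int) = sum Q R"
    unfolding R by (subst sum.reindex) (simp_all add: quad_def Q_def inj_on_def rho_inj)
  ultimately have "sum Q S = sum Q R" using 0 by (simp add: casimir_eigenvalue_def)
  moreover have "sum Q S = sum Q (S - R) + sum Q (S \<inter> R)" "sum Q R = sum Q (R - S) + sum Q (S \<inter> R)"
    using fin by (simp_all add: sum.Int_Diff[of S Q R] sum.Int_Diff[of R Q S] Int_commute)
  ultimately have eq: "sum Q (S - R) = sum Q (R - S)" by simp
  have "sum Q (R - S) \<le> 0"
    by (intro sum_nonpos) (auto simp: R_def Q_def mult_nonneg_nonpos)
  moreover have pos: "Q i > 0" if "i \<in> S - R" for i
  proof (cases "i < 0")
    case True
    moreover have "?N \<ge> 1" by simp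
    ultimately show ?thesis unfolding Q_def by (intro mult_neg_neg) linarith+
  next
    case False
    hence "i \<ge> ?N" using that by (simp add: R_def)
    moreover have "?N \<ge> 1" by simp
    ultimately show ?thesis unfolding Q_def by (intro mult_pos_pos) linarith+
  qed
  ultimately have "S - R = {}"
    using sum_pos[of "S - R" Q] eq fin by fastforce
  moreover have "card S = card R"
    using inj by (simp add: S_def R_def card_image)
  ultimately have SR: "S = R" using fin by (metis Diff_eq_empty_iff card_subset_eq)
  define p where "p = (\<lambda>x. inv (rho :: 'n \<Rightarrow> int) (\<nu> x))"
  have rp: "rho (p x) = \<nu> x" for x
  proof -
    have "\<nu> x \<in> range (rho :: 'n \<Rightarrow> int)" using SR R by (auto simp: S_def)
    thus ?thesis unfolding p_def by (rule f_inv_into_f)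
  qed
  have "inj p" using inj rp by (metis injD injI)
  hence "p permutes UNIV"
    by (intro bij_imp_permutes) (simp_all add: finite_UNIV_inj_surj bij_def)
  moreover have "\<nu> = rho \<circ> p" using rp by auto
  ultimately show ?thesis using that by blast
qed

lemma finite_support_power_ops:
  assumes "finite {\<nu>. g \<nu> \<noteq> 0}"
  shows "finite {\<nu>. power_ops ks g \<nu> \<noteq> 0}"
proof (induction ks)
  case (Cons k ks)
  have "{\<nu>. power_op k (power_ops ks g) \<nu> \<noteq> 0}
     \<subseteq> (\<Union>n\<in>UNIV. (\<lambda>\<nu>. \<nu>(n := \<nu> n + k)) ` {\<nu>. power_ops ks g \<nu> \<noteq> 0})"
  proof
    fix \<nu> assume "\<nu> \<in> {\<nu>. power_op k (power_ops ks g) \<nu> \<noteq> 0}"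
    then obtain n where "power_ops ks g (\<nu>(n := \<nu> n - k)) \<noteq> 0"
      unfolding power_op_def by (auto elim: sum.not_neutral_contains_not_neutral)
    thus "\<nu> \<in> (\<Union>n\<in>UNIV. (\<lambda>\<nu>. \<nu>(n := \<nu> n + k)) ` {\<nu>. power_ops ks g \<nu> \<noteq> 0})"
      by (auto intro!: exI[of _ n] image_eqI[of _ _ "\<nu>(n := \<nu> n - k)"])
  qed
  thus ?case using Cons.IH by (auto intro: finite_subset)
qed (use assms in simp)

lemma finite_support_alternant: "finite {\<nu> :: 'n::finite \<Rightarrow> int. alternant \<mu> \<nu> \<noteq> 0}"
proof (rule finite_subset)
  show "{\<nu>. alternant \<mu> \<nu> \<noteq> 0} \<subseteq> (\<lambda>p. \<mu> \<circ> p) ` {p. p permutes (UNIV :: 'n set)}"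
    by (auto elim: alternant_nonzero)
qed (simp add: finite_permutations)

text \<open>Applying \<open>1 - casimir / \<lambda>\<close> for each \<open>\<lambda> \<in> \<Lambda>\<close> leaves the expectation unchanged and kills the
  eigenvalues in \<open>\<Lambda>\<close>.\<close>

lemma casimir_eliminate:
  fixes M :: "(complex^'n^'n) measure"
  assumes M: "haar_prob M" and "finite \<Lambda>" "0 \<notin> \<Lambda>"
  shows "\<exists>cs. (LINT X|M. peval (power_trace X) cs) = (LINT X|M. prod_list (map (power_trace X) ks)) \<and>
    (\<forall>\<nu> :: 'n \<Rightarrow> int. peval_op cs (alternant rho) \<nu>
       = (\<Prod>l\<in>\<Lambda>. 1 - of_int (casimir_eigenvalue \<nu>) / of_int l) * power_ops ks (alternant rho) \<nu>)"
  using assms(2,3)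
proof (induction \<Lambda> rule: finite_induct)
  case empty
  show ?case by (rule exI[of _ "[(1, ks)]"]) simp
next
  case (insert l \<Lambda>)
  then obtain cs where int: "(LINT X|M. peval (power_trace X) cs) = (LINT X|M. prod_list (map (power_trace X) ks))"
    and ev: "\<And>\<nu> :: 'n \<Rightarrow> int. peval_op cs (alternant rho) \<nu>
       = (\<Prod>l\<in>\<Lambda>. 1 - of_int (casimir_eigenvalue \<nu>) / of_int l) * power_ops ks (alternant rho) \<nu>"
    by auto
  define ds where "ds = cs @ map (\<lambda>(c, ms). (- 1 / of_int l * c, ms)) (casimir_poly cs)"
  have "(LINT X|M. peval (power_trace X) ds)
     = (LINT X|M. peval (power_trace X) cs + (- 1 / of_int l) * peval (power_trace X) (casimir_poly cs))"
    by (simp only: ds_def peval_append peval_map_scale)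
  also have "\<dots> = (LINT X|M. peval (power_trace X) cs)"
    by (simp add: haar_integrable[OF M continuous_on_peval_power_trace] integral_casimir_poly[OF M])
  finally have "(LINT X|M. peval (power_trace X) ds) = (LINT X|M. prod_list (map (power_trace X) ks))" by (simp add: int)
  moreover have "peval_op ds (alternant rho) \<nu>
       = (\<Prod>l\<in>insert l \<Lambda>. 1 - of_int (casimir_eigenvalue \<nu>) / of_int l) * power_ops ks (alternant rho) \<nu>" for \<nu> :: "'n \<Rightarrow> int"
    unfolding ds_def peval_op_append peval_op_map_scale peval_op_casimir_poly
    by (simp only: ev prod.insert[OF insert.hyps]) (simp add: algebra_simps)
  ultimately show ?case by blast
qed

text \<open>Three cases: a nonzero eigenvalue on the support is killed by its factor; a repeated
  exponent has coefficient 0 by antisymmetry; every other exponent is a permutation of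
  \<open>rho\<close>, where the sign rule determines the coefficient from its value at
  \<open>rho\<close>.\<close>

lemma casimir_eliminate_all:
  fixes M :: "(complex^'n^'n) measure"
  assumes M: "haar_prob M"
  obtains cs where "(LINT X|M. peval (power_trace X) cs) = (LINT X|M. prod_list (map (power_trace X) ks))"
    "\<And>\<nu> :: 'n \<Rightarrow> int. peval_op cs (alternant rho) \<nu> = power_ops ks (alternant rho) (rho :: 'n \<Rightarrow> int) * alternant rho \<nu>"
proof -
  let ?g = "power_ops ks (alternant (rho :: 'n \<Rightarrow> int))"
  \<comment> \<open>Only eigenvalues on the finite support are listed. Leaving out 0 keeps the
    quotients meaningful and preserves the coefficients at permutations of
    \<open>rho\<close>.\<close>
  define \<Lambda> where "\<Lambda> = casimir_eigenvalue ` {\<nu>. ?g \<nu> \<noteq> 0} - {0}"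
  have fin: "finite \<Lambda>" "0 \<notin> \<Lambda>"
    unfolding \<Lambda>_def by (auto intro!: finite_support_power_ops finite_support_alternant)
  obtain cs where int: "(LINT X|M. peval (power_trace X) cs) = (LINT X|M. prod_list (map (power_trace X) ks))"
    and ev: "\<And>\<nu> :: 'n \<Rightarrow> int. peval_op cs (alternant rho) \<nu> = (\<Prod>l\<in>\<Lambda>. 1 - of_int (casimir_eigenvalue \<nu>) / of_int l) * ?g \<nu>"
    using casimir_eliminate[OF M fin, of ks] by blast
  have "peval_op cs (alternant rho) \<nu> = ?g rho * alternant rho \<nu>" for \<nu> :: "'n \<Rightarrow> int"
  proof (cases "casimir_eigenvalue \<nu> = 0")
    case False
    have "alternant rho \<nu> = 0" using casimir_eigenvalue_alternant_rho[of \<nu>] False by simp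
    moreover have "(\<Prod>l\<in>\<Lambda>. 1 - of_int (casimir_eigenvalue \<nu>) / of_int l) * ?g \<nu> = 0"
    proof (cases "?g \<nu> = 0")
      case False
      hence "casimir_eigenvalue \<nu> \<in> \<Lambda>" using \<open>casimir_eigenvalue \<nu> \<noteq> 0\<close> by (auto simp: \<Lambda>_def)
      thus ?thesis using fin \<open>casimir_eigenvalue \<nu> \<noteq> 0\<close> by (auto simp: prod_zero_iff intro!: bexI[of _ "casimir_eigenvalue \<nu>"])
    qed simp
    ultimately show ?thesis by (simp add: ev)
  next
    case True
    show ?thesis
    proof (cases "inj \<nu>")
      case False
      then obtain n m where "n \<noteq> m" "\<nu> n = \<nu> m" by (auto simp: inj_on_def)
      thus ?thesis
        using power_ops_alternant_not_inj[of n m \<nu> ks rho] power_ops_alternant_not_inj[of n m \<nu> "[]" rho]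
        by (simp add: ev)
    next
      case inj: True
      obtain p where p: "p permutes UNIV" "\<nu> = rho \<circ> p"
        using casimir_eigenvalue_zero_imp_permutation[OF inj True] .
      have "peval_op cs (alternant rho) \<nu> = ?g \<nu>" by (simp add: ev True)
      thus ?thesis
        by (simp add: p(2) power_ops_alternant_permute[OF p(1)] alternant_permute_arg[OF p(1)] alternant_rho_rho)
    qed
  qed
  with int show ?thesis using that by blast
qed

section \<open>Joint moments of power traces\<close>

definition laurent_eval :: "('n::finite \<Rightarrow> complex) \<Rightarrow> (('n \<Rightarrow> int) \<Rightarrow> complex) \<Rightarrow> complex" where
  "laurent_eval z g = (\<Sum>\<nu> | g \<nu> \<noteq> 0. g \<nu> * (\<Prod>n\<in>UNIV. z n powi \<nu> n))"

lemma laurent_eval_superset: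
  assumes "finite F" "{\<nu>. g \<nu> \<noteq> 0} \<subseteq> F"
  shows "laurent_eval z g = (\<Sum>\<nu>\<in>F. g \<nu> * (\<Prod>n\<in>UNIV. z n powi \<nu> n))"
  unfolding laurent_eval_def by (rule sum.mono_neutral_left) (use assms in auto)

lemma laurent_eval_linear:
  assumes "finite {\<nu>. g \<nu> \<noteq> 0}" "finite {\<nu>. h \<nu> \<noteq> 0}"
  shows "laurent_eval z (\<lambda>\<nu>. c * g \<nu> + h \<nu>) = c * laurent_eval z g + laurent_eval z h"
proof -
  let ?F = "{\<nu>. g \<nu> \<noteq> 0} \<union> {\<nu>. h \<nu> \<noteq> 0}"
  have fin: "finite ?F" using assms by simp
  have "laurent_eval z (\<lambda>\<nu>. c * g \<nu> + h \<nu>) = (\<Sum>\<nu>\<in>?F. (c * g \<nu> + h \<nu>) * (\<Prod>n\<in>UNIV. z n powi \<nu> n))"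
    by (rule laurent_eval_superset[OF fin]) auto
  also have "\<dots> = c * (\<Sum>\<nu>\<in>?F. g \<nu> * (\<Prod>n\<in>UNIV. z n powi \<nu> n)) + (\<Sum>\<nu>\<in>?F. h \<nu> * (\<Prod>n\<in>UNIV. z n powi \<nu> n))"
    by (simp add: distrib_right sum.distrib sum_distrib_left mult.assoc)
  also have "(\<Sum>\<nu>\<in>?F. g \<nu> * (\<Prod>n\<in>UNIV. z n powi \<nu> n)) = laurent_eval z g"
    by (rule laurent_eval_superset[OF fin, symmetric]) auto
  also have "(\<Sum>\<nu>\<in>?F. h \<nu> * (\<Prod>n\<in>UNIV. z n powi \<nu> n)) = laurent_eval z h"
    by (rule laurent_eval_superset[OF fin, symmetric]) auto
  finally show ?thesis .
qed

text \<open>Nonzero coordinates allow a power with shifted exponent to be split even if exponents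
  are negative. The set \<open>G\<close> of all shifts of the support is a common finite domain for
  the rearrangement.\<close>

lemma laurent_eval_power_op:
  assumes fin: "finite {\<nu>. g \<nu> \<noteq> 0}" and z: "\<And>n. z n \<noteq> 0"
  shows "laurent_eval z (power_op k g) = (\<Sum>n\<in>UNIV. z n powi k) * laurent_eval z g"
proof -
  define m where "m \<nu> = (\<Prod>n\<in>UNIV. z n powi \<nu> n)" for \<nu>
  define F where "F = {\<nu>. g \<nu> \<noteq> 0}"
  define up where "up n \<nu> = \<nu>(n := \<nu> n + k)" for n :: 'a and \<nu> :: "'a \<Rightarrow> int"
  define G where "G = (\<Union>n\<in>UNIV. up n ` F)"
  have up: "up n (\<nu>(n := \<nu> n - k)) = \<nu>" "(up n \<nu>)(n := up n \<nu> n - k) = \<nu>" for n \<nu>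
    by (auto simp: up_def)
  have m_up: "m (up n \<nu>) = z n powi k * m \<nu>" for n \<nu>
    unfolding m_def by (subst (1 2) prod.remove[of UNIV n]) (simp_all add: up_def power_int_add z)
  have finG: "finite G" using fin by (simp add: G_def F_def)
  have supp: "\<nu> \<in> up n ` F" if "g (\<nu>(n := \<nu> n - k)) \<noteq> 0" for n \<nu>
    using that up(1)[of n \<nu>] by (metis (mono_tags, lifting) F_def image_eqI mem_Collect_eq)
  have "laurent_eval z (power_op k g) = (\<Sum>\<nu>\<in>G. power_op k g \<nu> * m \<nu>)"
    unfolding m_def
  proof (rule laurent_eval_superset[OF finG], rule subsetI)
    fix \<nu> assume "\<nu> \<in> {\<nu>. power_op k g \<nu> \<noteq> 0}"
    then obtain n where "g (\<nu>(n := \<nu> n - k)) \<noteq> 0"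
      unfolding power_op_def by (auto elim: sum.not_neutral_contains_not_neutral)
    hence "\<nu> \<in> up n ` F" by (rule supp)
    thus "\<nu> \<in> G" unfolding G_def by blast
  qed
  also have "\<dots> = (\<Sum>n\<in>UNIV. \<Sum>\<nu>\<in>G. g (\<nu>(n := \<nu> n - k)) * m \<nu>)"
    unfolding power_op_def sum_distrib_right by (rule sum.swap)
  also have "\<dots> = (\<Sum>n\<in>UNIV. \<Sum>\<nu>\<in>up n ` F. g (\<nu>(n := \<nu> n - k)) * m \<nu>)"
  proof (rule sum.cong[OF refl], rule sum.mono_neutral_right[OF finG])
    fix n :: 'a
    show "up n ` F \<subseteq> G" by (auto simp: G_def)
    show "\<forall>\<nu>\<in>G - up n ` F. g (\<nu>(n := \<nu> n - k)) * m \<nu> = 0" using supp by auto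
  qed
  also have "\<dots> = (\<Sum>n\<in>UNIV. \<Sum>\<nu>\<in>F. g \<nu> * (z n powi k * m \<nu>))"
  proof (rule sum.cong[OF refl])
    fix n :: 'a
    have "inj_on (up n) F" by (rule inj_on_inverseI[of _ "\<lambda>\<nu>. \<nu>(n := \<nu> n - k)"]) (rule up(2))
    thus "(\<Sum>\<nu>\<in>up n ` F. g (\<nu>(n := \<nu> n - k)) * m \<nu>) = (\<Sum>\<nu>\<in>F. g \<nu> * (z n powi k * m \<nu>))"
      by (simp add: sum.reindex up(2) m_up)
  qed
  also have "\<dots> = (\<Sum>n\<in>UNIV. z n powi k) * laurent_eval z g"
    unfolding laurent_eval_def sum_product by (intro sum.cong) (simp_all add: F_def m_def ac_simps)
  finally show ?thesis .
qed

lemma laurent_eval_alternant: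
  "laurent_eval z (alternant \<mu>) = det (\<chi> x y. z x powi \<mu> y)"
proof -
  let ?P = "{p. p permutes (UNIV :: 'a set)}"
  let ?F = "(\<lambda>p. \<mu> \<circ> p) ` ?P"
  have finP: "finite ?P" by (simp add: finite_permutations)
  have "laurent_eval z (alternant \<mu>) = (\<Sum>\<nu>\<in>?F. alternant \<mu> \<nu> * (\<Prod>n\<in>UNIV. z n powi \<nu> n))"
    by (rule laurent_eval_superset) (use finP in \<open>auto elim: alternant_nonzero\<close>)
  also have "\<dots> = (\<Sum>p\<in>?P. \<Sum>\<nu>\<in>?F. of_int (sign p) * of_bool (\<nu> = \<mu> \<circ> p) * (\<Prod>n\<in>UNIV. z n powi \<nu> n))"
    unfolding alternant_altdef sum_distrib_right by (rule sum.swap)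
  also have "\<dots> = (\<Sum>p\<in>?P. of_int (sign p) * (\<Prod>n\<in>UNIV. z n powi \<mu> (p n)))"
  proof (rule sum.cong[OF refl])
    fix p assume p: "p \<in> ?P"
    have "(\<Sum>\<nu>\<in>?F. of_int (sign p) * of_bool (\<nu> = \<mu> \<circ> p) * (\<Prod>n\<in>UNIV. z n powi \<nu> n))
       = (\<Sum>\<nu>\<in>?F. if \<nu> = \<mu> \<circ> p then of_int (sign p) * (\<Prod>n\<in>UNIV. z n powi (\<mu> \<circ> p) n) else 0)"
      by (intro sum.cong) auto
    also have "\<dots> = of_int (sign p) * (\<Prod>n\<in>UNIV. z n powi (\<mu> \<circ> p) n)"
      using p finP by (subst sum.delta) auto
    finally show "(\<Sum>\<nu>\<in>?F. of_int (sign p) * of_bool (\<nu> = \<mu> \<circ> p) * (\<Prod>n\<in>UNIV. z n powi \<nu> n))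
       = of_int (sign p) * (\<Prod>n\<in>UNIV. z n powi \<mu> (p n))" by simp
  qed
  finally show ?thesis by (simp add: det_def)
qed

text \<open>A vector in the kernel lists the coefficients of a polynomial of degree below N with the
  N distinct roots \<open>z x\<close>, and so is 0.\<close>

lemma vandermonde_nonzero:
  fixes z :: "'n::finite \<Rightarrow> complex"
  assumes "inj z"
  shows "det (\<chi> x y. z x powi rho y :: complex^'n^'n) \<noteq> 0"
proof -
  let ?A = "(\<chi> x y. z x powi rho y) :: complex^'n^'n"
  have "c = 0" if c: "?A *v c = 0" for c
  proof -
    define p where "p = (\<Sum>y\<in>UNIV. monom (c $ y) (nat (rho (y :: 'n))))"
    have "poly p (z x) = 0" for x
    proof -
      have "poly p (z x) = (?A *v c) $ x"
        by (simp add: p_def poly_sum poly_monom matrix_vector_mult_def power_int_def rho_range mult.commute)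
      thus ?thesis by (simp add: c)
    qed
    hence roots: "range z \<subseteq> {x. poly p x = 0}" by auto
    have "degree p \<le> CARD('n) - 1"
      unfolding p_def
    proof (rule degree_sum_le)
      fix y :: 'n
      have "degree (monom (c $ y) (nat (rho y))) \<le> nat (rho y)" by (rule degree_monom_le)
      also have "\<dots> \<le> CARD('n) - 1" using rho_range[of y] by linarith
      finally show "degree (monom (c $ y) (nat (rho y))) \<le> CARD('n) - 1" .
    qed simp
    hence deg: "degree p < CARD('n)" using zero_less_card_finite[where 'a = 'n] by linarith
    have "p = 0"
    proof (rule ccontr)
      assume p: "p \<noteq> 0"
      have "CARD('n) = card (range z)" using assms by (simp add: card_image)
      also have "\<dots> \<le> card {x. poly p x = 0}" by (intro card_mono roots poly_roots_finite p)
      also have "\<dots> \<le> degree p" by (intro card_poly_roots_bound p)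
      finally show False using deg by simp
    qed
    have "c $ y = 0" for y
    proof -
      have "coeff p (nat (rho y)) = (\<Sum>x\<in>UNIV. if x = y then c $ x else 0)"
        unfolding p_def coeff_sum coeff_monom
        by (intro sum.cong refl) (auto simp: rho_range nat_eq_iff2 rho_inj)
      thus ?thesis using \<open>p = 0\<close> by simp
    qed
    thus ?thesis by (simp add: vec_eq_iff)
  qed
  hence "invertible ?A" unfolding invertible_left_inverse matrix_left_invertible_ker by blast
  thus ?thesis by (simp add: invertible_det_nz)
qed

lemma laurent_eval_power_ops:
  assumes "finite {\<nu>. g \<nu> \<noteq> 0}" "\<And>n. z n \<noteq> 0"
  shows "laurent_eval z (power_ops ks g) = prod_list (map (\<lambda>k. \<Sum>n\<in>UNIV. z n powi k) ks) * laurent_eval z g"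
  by (induction ks) (simp_all add: laurent_eval_power_op finite_support_power_ops assms mult.assoc)

lemma finite_support_peval_op:
  assumes "finite {\<nu>. g \<nu> \<noteq> 0}"
  shows "finite {\<nu>. peval_op cs g \<nu> \<noteq> 0}"
proof (induction cs)
  case (Cons x cs)
  have "{\<nu>. peval_op (x # cs) g \<nu> \<noteq> 0} \<subseteq> {\<nu>. power_ops (snd x) g \<nu> \<noteq> 0} \<union> {\<nu>. peval_op cs g \<nu> \<noteq> 0}"
    by auto
  thus ?case using Cons.IH finite_support_power_ops[OF assms] by (auto intro: finite_subset)
qed simp

lemma laurent_eval_peval_op:
  assumes "finite {\<nu>. g \<nu> \<noteq> 0}" "\<And>n. z n \<noteq> 0"
  shows "laurent_eval z (peval_op cs g) = peval (\<lambda>k. \<Sum>n\<in>UNIV. z n powi k) cs * laurent_eval z g"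
proof (induction cs)
  case (Cons x cs)
  have "laurent_eval z (peval_op (x # cs) g)
     = fst x * laurent_eval z (power_ops (snd x) g) + laurent_eval z (peval_op cs g)"
    unfolding peval_op_Cons
    by (intro laurent_eval_linear finite_support_power_ops finite_support_peval_op assms)
  thus ?case by (simp add: Cons.IH laurent_eval_power_ops assms distrib_right mult.assoc)
qed (simp add: laurent_eval_def)

text \<open>Evaluating the formal identity at \<open>z\<close> produces the Vandermonde determinant
  as a factor on both sides; for distinct coordinates it can be cancelled.\<close>

lemma peval_power_sums_inj:
  fixes z :: "'n::finite \<Rightarrow> complex"
  assumes cs: "\<And>\<nu> :: 'n \<Rightarrow> int. peval_op cs (alternant rho) \<nu> = c * alternant rho \<nu>"
    and z: "\<And>n. z n \<noteq> 0" "inj z"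
  shows "peval (\<lambda>k. \<Sum>n\<in>UNIV. z n powi k) cs = c"
proof -
  let ?a = "alternant (rho :: 'n \<Rightarrow> int)"
  have "peval_op cs ?a = (\<lambda>\<nu>. c * ?a \<nu> + 0)" using cs by auto
  hence "laurent_eval z (peval_op cs ?a) = c * laurent_eval z ?a + laurent_eval z (\<lambda>_. 0)"
    by (simp only:) (rule laurent_eval_linear, rule finite_support_alternant, simp)
  hence "peval (\<lambda>k. \<Sum>n\<in>UNIV. z n powi k) cs * laurent_eval z ?a = c * laurent_eval z ?a"
    by (simp add: laurent_eval_peval_op finite_support_alternant z laurent_eval_def[of z "\<lambda>_. 0"])
  moreover have "laurent_eval z ?a \<noteq> 0"
    by (simp add: laurent_eval_alternant vandermonde_nonzero z)
  ultimately show ?thesis by simp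
qed

lemma tendsto_peval:
  assumes "\<And>k. ((\<lambda>x. p x k) \<longlongrightarrow> q k) F"
  shows "((\<lambda>x. peval (p x) cs) \<longlongrightarrow> peval q cs) F"
proof -
  have "((\<lambda>x. prod_list (map (p x) ks)) \<longlongrightarrow> prod_list (map q ks)) F" for ks
    by (induction ks) (auto intro!: tendsto_intros assms)
  thus ?thesis by (induction cs) (auto intro!: tendsto_intros)
qed

text \<open>Perturbing \<open>z n\<close> to \<open>z n + x * rho n\<close> separates the coordinates for all but finitely many \<open>x\<close>.\<close>

lemma peval_power_sums:
  fixes z :: "'n::finite \<Rightarrow> complex"
  assumes cs: "\<And>\<nu> :: 'n \<Rightarrow> int. peval_op cs (alternant rho) \<nu> = c * alternant rho \<nu>"
    and z: "\<And>n. z n \<noteq> 0"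
  shows "peval (\<lambda>k. \<Sum>n\<in>UNIV. z n powi k) cs = c"
proof -
  define w where "w x n = z n + x * of_int (rho n)" for x n
  \<comment> \<open>At these points two coordinates meet or one vanishes. Quotients with denominator
    0 have the default value 0, which is harmless since the limit at 0 leaves that point
    out.\<close>
  define bad where "bad = (\<lambda>(n, m). (z n - z m) / of_int (rho m - rho n)) ` UNIV \<union> (\<lambda>n. - z n / of_int (rho n)) ` UNIV"
  have good: "inj (w x) \<and> (\<forall>n. w x n \<noteq> 0)" if x: "x \<notin> bad" for x
  proof (intro conjI allI injI)
    fix n m assume w: "w x n = w x m"
    show "n = m"
    proof (rule ccontr)
      assume "n \<noteq> m"
      hence "of_int (rho m - rho n) \<noteq> (0 :: complex)" by (simp add: rho_inj del: of_int_diff)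
      hence "x = (z n - z m) / of_int (rho m - rho n)"
        using w by (simp add: w_def field_simps)
      thus False using x by (auto simp: bad_def)
    qed
  next
    fix n show "w x n \<noteq> 0"
    proof
      assume w: "w x n = 0"
      have "rho n \<noteq> 0" using w z[of n] by (auto simp: w_def)
      hence "x = - z n / of_int (rho n)" using w by (simp add: w_def field_simps add_eq_0_iff)
      thus False using x by (auto simp: bad_def)
    qed
  qed
  have "finite bad" by (simp add: bad_def)
  hence "\<forall>\<^sub>F x in at 0. x \<notin> bad"
    using finite_imp_closed[of "bad - {0}"] by (auto simp: eventually_at_topological intro!: exI[of _ "- (bad - {0})"])
  hence "\<forall>\<^sub>F x in at 0. peval (\<lambda>k. \<Sum>n\<in>UNIV. w x n powi k) cs = c"
    by eventually_elim (use peval_power_sums_inj[OF cs] good in auto)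
  hence "((\<lambda>x. peval (\<lambda>k. \<Sum>n\<in>UNIV. w x n powi k) cs) \<longlongrightarrow> c) (at 0)"
    by (rule tendsto_eventually)
  moreover have "((\<lambda>x. w x n) \<longlongrightarrow> z n) (at 0)" for n
    unfolding w_def by (auto intro!: tendsto_eq_intros)
  hence "((\<lambda>x. peval (\<lambda>k. \<Sum>n\<in>UNIV. w x n powi k) cs) \<longlongrightarrow> peval (\<lambda>k. \<Sum>n\<in>UNIV. z n powi k) cs) (at 0)"
    using z by (intro tendsto_peval tendsto_sum tendsto_power_int) auto
  ultimately show ?thesis using tendsto_unique[of "at (0::complex)"] by auto
qed

text \<open>After the elimination the integrand is constant on the group, and the total mass is
  1.\<close>

lemma haar_integral_prod_power_trace:
  fixes M :: "(complex^'n^'n) measure"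
  assumes M: "haar_prob M"
    and eig: "\<And>X :: complex^'n^'n. X \<in> unitary_group \<Longrightarrow> \<exists>z :: 'n \<Rightarrow> complex. (\<forall>n. z n \<noteq> 0) \<and> (\<forall>k. power_trace X k = (\<Sum>n\<in>UNIV. z n powi k))"
  shows "(LINT X|M. prod_list (map (power_trace X) ks)) = power_ops ks (alternant rho) (rho :: 'n \<Rightarrow> int)"
proof -
  interpret prob_space M by (rule haar_prob_prob_space) fact
  obtain cs where int: "(LINT X|M. peval (power_trace X) cs) = (LINT X|M. prod_list (map (power_trace X) ks))"
    and cs: "\<And>\<nu> :: 'n \<Rightarrow> int. peval_op cs (alternant rho) \<nu> = power_ops ks (alternant rho) (rho :: 'n \<Rightarrow> int) * alternant rho \<nu>"
    using casimir_eliminate_all[OF M, of ks] by blast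
  have "peval (power_trace X) cs = power_ops ks (alternant rho) (rho :: 'n \<Rightarrow> int)" if X: "X \<in> unitary_group" for X :: "complex^'n^'n"
  proof -
    obtain z :: "'n \<Rightarrow> complex" where z: "\<And>n. z n \<noteq> 0" "power_trace X = (\<lambda>k. \<Sum>n\<in>UNIV. z n powi k)"
      using eig[OF X] by auto
    show ?thesis unfolding z(2) by (rule peval_power_sums[OF cs z(1)])
  qed
  hence "(LINT X|M. peval (power_trace X) cs) = (LINT X|M. power_ops ks (alternant rho) (rho :: 'n \<Rightarrow> int))"
    by (intro Bochner_Integration.integral_cong refl) (simp add: haar_prob_space[OF M])
  thus ?thesis by (simp add: int prob_space)
qed

section \<open>Eigenvalues\<close>

definition mpoly :: "complex poly \<Rightarrow> complex^'n^'n \<Rightarrow> complex^'n^'n" where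
  "mpoly p X = fold_coeffs (\<lambda>a A. mat a + X ** A) p 0"

lemma mpoly_0 [simp]: "mpoly 0 X = 0"
  by (simp add: mpoly_def)

lemma mpoly_pCons [simp]: "mpoly (pCons a p) X = mat a + X ** mpoly p X"
proof (cases "p = 0 \<and> a = 0")
  case False
  thus ?thesis unfolding mpoly_def by (cases "p = 0") auto
qed (simp add: mpoly_def)

lemma mat_add: "mat (a + b) = mat a + (mat b :: complex^'n^'n)"
  by (simp add: vec_eq_iff mat_def)

lemma mat_mult: "mat (a * b) = mat a ** (mat b :: complex^'n^'n)"
  by (simp add: vec_eq_iff) (simp add: mat_def)

lemma mat_commute: "mat a ** A = A ** (mat a :: complex^'n^'n)"
  by (simp add: vec_eq_iff mult.commute)

lemma mpoly_add: "mpoly (p + q) X = mpoly p X + mpoly q X"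
  by (induction p q rule: poly_induct2) (simp_all add: mat_add matrix_add_ldistrib)

lemma mpoly_smult: "mpoly (smult c p) X = mat c ** mpoly p X"
proof (induction p)
  case (pCons a p)
  have "X ** (mat c ** mpoly p X) = mat c ** (X ** mpoly p X)"
    by (metis mat_commute matrix_mul_assoc)
  thus ?case by (simp add: pCons.IH mat_mult matrix_add_ldistrib)
qed simp

lemma mpoly_mult: "mpoly (p * q) X = mpoly p X ** mpoly q X"
  by (induction p) (simp_all add: mpoly_add mpoly_smult matrix_add_rdistrib matrix_mul_assoc)

lemma mpoly_monom: "mpoly (monom 1 k) X = matpow X k"
  by (induction k) (simp_all add: monom_0 monom_Suc)

lemma det_mat: "det (mat c :: complex^'n^'n) = c ^ CARD('n)"
proof -
  have "det (mat c :: complex^'n^'n) = (\<Prod>i\<in>UNIV. (mat c :: complex^'n^'n) $ i $ i)"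
    by (rule det_diagonal) (simp add: mat_def)
  thus ?thesis by (simp add: mat_def)
qed

text \<open>Spectral mapping in determinant form, without diagonalization: the fundamental theorem
  of algebra splits off a root of \<open>q\<close>, and the determinant of each linear factor is the
  characteristic polynomial up to sign.\<close>

lemma det_mpoly:
  fixes X :: "complex^'n^'n"
  assumes eig: "\<And>w. det (mat w - X) = (\<Prod>n\<in>UNIV. w - z n)"
  shows "det (mpoly q X) = (\<Prod>n\<in>(UNIV::'n set). poly q (z n))"
proof (induction "degree q" arbitrary: q)
  case 0
  then obtain c where "q = [:c:]" by (metis degree_eq_zeroE)
  thus ?case by (simp add: det_mat)
next
  case (Suc d)
  have "\<not> constant (poly q)" using Suc.hyps(2) by (simp add: constant_degree)
  then obtain r where "poly q r = 0" using fundamental_theorem_of_algebra by blast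
  then obtain q' where q: "q = [:- r, 1:] * q'" by (auto simp: poly_eq_0_iff_dvd elim: dvdE)
  have "q' \<noteq> 0" using Suc.hyps(2) q by auto
  hence "degree q = Suc (degree q')" unfolding q by (subst degree_mult_eq) auto
  hence IH: "det (mpoly q' X) = (\<Prod>n\<in>UNIV. poly q' (z n))" using Suc.hyps by simp
  have "mat (- r) + X = mat (- 1) ** (mat r - X)"
    by (simp add: vec_eq_iff) (simp add: mat_def)
  hence "det (mat (- r) + X) = (- 1) ^ CARD('n) * (\<Prod>n\<in>UNIV. r - z n)"
    by (simp only: det_mul det_mat eig)
  also have "\<dots> = (\<Prod>n\<in>UNIV. z n - r)"
    by (simp flip: prod_uminus)
  finally have "det (mpoly [:- r, 1:] X) = (\<Prod>n\<in>UNIV. z n - r)" by simp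
  hence "det (mpoly q X) = (\<Prod>n\<in>UNIV. (z n - r) * poly q' (z n))"
    unfolding q mpoly_mult det_mul IH by (simp only: prod.distrib)
  thus ?case by (simp add: q algebra_simps)
qed

text \<open>Both sides are the derivative of the hypothesis at s = 0. In the expansion of the
  determinant only the identity permutation contributes to it.\<close>

lemma trace_eq_sum:
  fixes Y :: "complex^'n^'n" and y :: "'n \<Rightarrow> complex"
  assumes "\<And>s. det (mat 1 + mat s ** Y) = (\<Prod>n\<in>UNIV. 1 + s * y n)"
  shows "trace Y = (\<Sum>n\<in>UNIV. y n)"
proof -
  let ?P = "{p. p permutes (UNIV :: 'n set)}"
  have d: "((\<lambda>s. \<Prod>i\<in>UNIV. (mat 1 :: complex^'n^'n) $ i $ p i + s * Y $ i $ p i) has_field_derivative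
      of_bool (p = id) * trace Y) (at 0)" if p: "p \<in> ?P" for p
  proof -
    have *: "((\<lambda>s. \<Prod>i\<in>UNIV. (mat 1 :: complex^'n^'n) $ i $ p i + s * Y $ i $ p i) has_field_derivative
      (\<Sum>i\<in>UNIV. Y $ i $ p i * (\<Prod>j\<in>UNIV - {i}. (mat 1 :: complex^'n^'n) $ j $ p j + 0 * Y $ j $ p j))) (at 0)"
      by (rule has_field_derivative_prod) (auto intro!: derivative_eq_intros)
    have "(\<Sum>i\<in>UNIV. Y $ i $ p i * (\<Prod>j\<in>UNIV - {i}. (mat 1 :: complex^'n^'n) $ j $ p j + 0 * Y $ j $ p j))
       = of_bool (p = id) * trace Y"
    proof (cases "p = id")
      case True
      thus ?thesis by (simp add: mat_def trace_def)
    next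
      case False
      \<comment> \<open>A permutation other than the identity moves at least two points.
        Differentiation removes at most one of the two off-diagonal factors, and the other vanishes
        at s = 0.\<close>
      have zero: "(\<Prod>j\<in>UNIV - {i}. (mat 1 :: complex^'n^'n) $ j $ p j + 0 * Y $ j $ p j) = 0" for i
      proof -
        obtain j where j: "p j \<noteq> j" using False by (auto simp: fun_eq_iff)
        have "p (p j) \<noteq> p j" using j permutes_inj[of p UNIV] p by (auto dest: injD)
        then obtain j' where "j' \<noteq> i" "p j' \<noteq> j'" using j by metis
        thus ?thesis by (intro prod_zero) (auto simp: mat_def intro!: bexI[of _ j'])
      qed
      show ?thesis unfolding zero using False by simp
    qed
    with * show ?thesis by (simp only:)
  qed
  have "((\<lambda>s. \<Sum>p\<in>?P. of_int (sign p) * (\<Prod>i\<in>UNIV. (mat 1 :: complex^'n^'n) $ i $ p i + s * Y $ i $ p i)) has_field_derivative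
      (\<Sum>p\<in>?P. of_int (sign p) * (of_bool (p = id) * trace Y))) (at 0)"
    by (intro DERIV_sum DERIV_cmult d)
  also have "(\<Sum>p\<in>?P. of_int (sign p) * (of_bool (p = id) * trace Y)) = (\<Sum>p\<in>?P. if p = id then trace Y else 0)"
    by (intro sum.cong) (auto simp: sign_id)
  also have "\<dots> = trace Y" by (subst sum.delta) (simp_all add: finite_permutations permutes_id)
  also have "(\<lambda>s. \<Sum>p\<in>?P. of_int (sign p) * (\<Prod>i\<in>UNIV. (mat 1 :: complex^'n^'n) $ i $ p i + s * Y $ i $ p i))
     = (\<lambda>s. det (mat 1 + mat s ** Y))"
    by (simp add: det_def fun_eq_iff)
  also have "\<dots> = (\<lambda>s. \<Prod>n\<in>UNIV. 1 + s * y n)" by (simp add: assms)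
  finally have "((\<lambda>s. \<Prod>n\<in>UNIV. 1 + s * y n) has_field_derivative trace Y) (at 0)" .
  moreover have "((\<lambda>s. \<Prod>n\<in>UNIV. 1 + s * y n) has_field_derivative
      (\<Sum>n\<in>UNIV. y n * (\<Prod>m\<in>UNIV - {n}. 1 + 0 * y m))) (at 0)"
    by (rule has_field_derivative_prod) (auto intro!: derivative_eq_intros)
  ultimately show ?thesis by (auto dest: DERIV_unique)
qed

text \<open>The matrix 1 + s X^k is a polynomial in \<open>X\<close>, so \<open>det_mpoly\<close>
  factors its determinant over the eigenvalues.\<close>

lemma trace_matpow:
  fixes X :: "complex^'n^'n" and z :: "'n \<Rightarrow> complex"
  assumes eig: "\<And>w. det (mat w - X) = (\<Prod>n\<in>UNIV. w - z n)"
  shows "trace (matpow X k) = (\<Sum>n\<in>UNIV. z n ^ k)"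
proof (rule trace_eq_sum)
  fix s
  have "mat 1 + mat s ** matpow X k = mpoly (1 + smult s (monom 1 k)) X"
    by (simp add: mpoly_add mpoly_smult mpoly_monom one_pCons)
  thus "det (mat 1 + mat s ** matpow X k) = (\<Prod>n\<in>UNIV. 1 + s * z n ^ k)"
    by (simp add: det_mpoly[OF eig] poly_monom)
qed

lemma trace_ctranspose: "trace (ctranspose X) = cnj (trace X)"
  by (simp add: trace_def)

lemma power_trace_eigenangles:
  assumes "eigenangles X \<theta>"
  shows "power_trace X k = (\<Sum>n\<in>UNIV. cis (\<theta> n) powi k)"
proof -
  have t: "trace (matpow X m) = (\<Sum>n\<in>UNIV. cis (\<theta> n) ^ m)" for m
    using assms by (intro trace_matpow) (simp add: eigenangles_def)
  show ?thesis
  proof (cases "k \<ge> 0")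
    case True
    thus ?thesis by (simp add: power_trace_def unitary_powi_def t power_int_def)
  next
    case False
    thus ?thesis
      by (simp add: power_trace_def unitary_powi_def flip: ctranspose_matpow) (simp add: trace_ctranspose t power_int_def cis_cnj)
  qed
qed

lemma det_ctranspose: "det (ctranspose A) = cnj (det A)"
proof -
  have "ctranspose A = transpose (\<chi> i j. cnj (A $ i $ j))"
    by (simp add: vec_eq_iff transpose_def)
  hence "det (ctranspose A) = det (\<chi> i j. cnj (A $ i $ j))" by simp
  thus ?thesis by (simp add: det_def)
qed

lemma Lam_ctranspose_eigenangles:
  assumes "eigenangles X \<theta>"
  shows "Lam (ctranspose X) s = (\<Prod>n\<in>UNIV. 1 - s * cis (\<theta> n))"
proof -
  have *: "mat 1 - mat s ** X = mpoly [:1, - s:] X"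
    by (simp add: vec_eq_iff)
  thus ?thesis
    unfolding Lam_def ctranspose_ctranspose * using det_mpoly[of X "\<lambda>n. cis (\<theta> n)" "[:1, - s:]"] assms
    by (simp add: eigenangles_def mult.commute del: mpoly_pCons)
qed

lemma Lam_eigenangles:
  assumes "eigenangles X \<theta>"
  shows "Lam X s = (\<Prod>n\<in>UNIV. 1 - s * cis (- \<theta> n))"
proof -
  have "mat 1 - mat s ** ctranspose X = ctranspose (mat 1 - mat (cnj s) ** X)"
    by (simp add: vec_eq_iff) (simp add: mat_def)
  hence "Lam X s = cnj (Lam (ctranspose X) (cnj s))"
    by (simp add: Lam_def det_ctranspose)
  thus ?thesis by (simp add: Lam_ctranspose_eigenangles[OF assms] cis_cnj)
qed

lemma haar_integral_power_sums:
  fixes M :: "(complex^'n^'n) measure" and \<theta> :: "complex^'n^'n \<Rightarrow> 'n \<Rightarrow> real"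
  assumes M: "haar_prob M" and eig: "\<And>X. X \<in> unitary_group \<Longrightarrow> eigenangles X (\<theta> X)"
  shows "(LINT X|M. prod_list (map (\<lambda>k. \<Sum>n\<in>UNIV. cis (\<theta> X n) powi k) ks)) = power_ops ks (alternant rho) (rho :: 'n \<Rightarrow> int)"
proof -
  have "(LINT X|M. prod_list (map (\<lambda>k. \<Sum>n\<in>UNIV. cis (\<theta> X n) powi k) ks)) = (LINT X|M. prod_list (map (power_trace X) ks))"
    by (intro Bochner_Integration.integral_cong refl)
      (simp add: haar_prob_space[OF M] power_trace_eigenangles[OF eig] cong: map_cong)
  also have "\<dots> = power_ops ks (alternant rho) (rho :: 'n \<Rightarrow> int)"
  proof (rule haar_integral_prod_power_trace[OF M])
    fix X :: "complex^'n^'n" assume "X \<in> unitary_group"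
    thus "\<exists>z :: 'n \<Rightarrow> complex. (\<forall>n. z n \<noteq> 0) \<and> (\<forall>k. power_trace X k = (\<Sum>n\<in>UNIV. z n powi k))"
      by (intro exI[of _ "\<lambda>n. cis (\<theta> X n)"]) (simp add: power_trace_eigenangles[OF eig])
  qed
  finally show ?thesis .
qed

text \<open>\<open>hop1\<close>, \<open>hop2\<close>, \<open>hop3\<close> below are sums of the determinants with entries \<open>hop (x i) (a i) (x j)\<close>: the
  determinantal structure of the eigenvalue process on the Fourier side.\<close>

definition hop :: "'n::finite \<Rightarrow> int \<Rightarrow> 'n \<Rightarrow> complex" where
  "hop x a y = of_bool (rho x + a = rho y)"

text \<open>Columns with unshifted exponent are columns of an identity matrix, so a contributing
  permutation fixes their indices. The alternant at \<open>rho\<close> thus reduces to a determinant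
  indexed by \<open>S\<close>.\<close>

lemma alternant_rho_local:
  fixes \<mu> :: "'n::finite \<Rightarrow> int"
  assumes "\<And>n. n \<notin> S \<Longrightarrow> \<mu> n = rho n"
  shows "alternant \<mu> rho = (\<Sum>p | p permutes S. of_int (sign p) * (\<Prod>n\<in>S. of_bool (\<mu> n = rho (p n))))"
proof -
  have "alternant \<mu> rho = det (transpose (\<chi> x y. of_bool (rho x = \<mu> y)) :: complex^'n^'n)"
    by (simp add: alternant_def)
  also have "\<dots> = (\<Sum>p | p permutes UNIV. of_int (sign p) * (\<Prod>n\<in>UNIV. of_bool (rho (p n) = \<mu> n)))"
    by (simp add: det_def transpose_def)
  also have "\<dots> = (\<Sum>p | p permutes S. of_int (sign p) * (\<Prod>n\<in>UNIV. of_bool (rho (p n) = \<mu> n)))"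
  proof (rule sum.mono_neutral_right)
    show "\<forall>p\<in>{p. p permutes UNIV} - {p. p permutes S}. of_int (sign p) * (\<Prod>n\<in>UNIV. of_bool (rho (p n) = \<mu> n)) = (0 :: complex)"
    proof
      fix p assume p: "p \<in> {p. p permutes UNIV} - {p. p permutes S}"
      then obtain n where "n \<notin> S" "p n \<noteq> n"
        by (auto simp: permutes_def)
      hence "rho (p n) \<noteq> \<mu> n" using assms[of n] by (simp add: rho_inj)
      hence "(\<Prod>n\<in>UNIV. of_bool (rho (p n) = \<mu> n)) = (0 :: complex)" by (intro prod_zero) auto
      thus "of_int (sign p) * (\<Prod>n\<in>UNIV. of_bool (rho (p n) = \<mu> n)) = (0 :: complex)" by simp
    qed
  qed (auto simp: finite_permutations intro: permutes_subset)
  also have "\<dots> = (\<Sum>p | p permutes S. of_int (sign p) * (\<Prod>n\<in>S. of_bool (\<mu> n = rho (p n))))"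
  proof (intro sum.cong refl)
    fix p assume p: "p \<in> {p. p permutes S}"
    have "(\<Prod>n\<in>UNIV. of_bool (rho (p n) = \<mu> n)) = (\<Prod>n\<in>S. of_bool (rho (p n) = \<mu> n) :: complex)"
      by (rule prod.mono_neutral_right) (use p assms in \<open>auto simp: permutes_def\<close>)
    thus "of_int (sign p) * (\<Prod>n\<in>UNIV. of_bool (rho (p n) = \<mu> n))
       = (of_int (sign p) * (\<Prod>n\<in>S. of_bool (\<mu> n = rho (p n))) :: complex)"
      by (simp add: eq_commute)
  qed
  finally show ?thesis .
qed

lemma alternant_rho_shift1: "alternant (rho(x := rho x + a)) rho = hop x a x"
  by (subst alternant_rho_local[of "{x}"]) (simp_all add: hop_def sign_id)

lemma alternant_rho_shift2:
  assumes "x \<noteq> y"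
  shows "alternant (rho(y := rho y + b, x := rho x + a)) rho = hop x a x * hop y b y - hop x a y * hop y b x"
  using assms
  by (subst alternant_rho_local[of "{x, y}"])
    (simp_all add: sum_over_permutations_insert sign_compose sign_swap_id permutation_swap_id sign_id hop_def
      Transposition.transpose_def)

lemma alternant_rho_shift3:
  assumes "x \<noteq> y" "x \<noteq> w" "y \<noteq> w"
  shows "alternant (rho(w := rho w + c, y := rho y + b, x := rho x + a)) rho
     = hop x a x * hop y b y * hop w c w - hop x a y * hop y b x * hop w c w
       - hop x a w * hop w c x * hop y b y - hop y b w * hop w c y * hop x a x
       + hop x a y * hop y b w * hop w c x + hop x a w * hop w c y * hop y b x"
  using assms
  by (subst alternant_rho_local[of "{x, y, w}"])
    (simp_all add: sum_over_permutations_insert sign_compose sign_swap_id permutation_swap_id permutation_compose sign_id hop_def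
      Transposition.transpose_def algebra_simps)

definition hop1 :: "int \<Rightarrow> 'n::finite itself \<Rightarrow> complex" where
  "hop1 a _ = (\<Sum>x\<in>(UNIV::'n set). hop x a x)"

definition hop2 :: "int \<Rightarrow> int \<Rightarrow> 'n::finite itself \<Rightarrow> complex" where
  "hop2 a b _ = (\<Sum>x\<in>(UNIV::'n set). \<Sum>y\<in>UNIV. hop x a x * hop y b y - hop x a y * hop y b x)"

definition hop3 :: "int \<Rightarrow> int \<Rightarrow> int \<Rightarrow> 'n::finite itself \<Rightarrow> complex" where
  "hop3 a b c _ = (\<Sum>x\<in>(UNIV::'n set). \<Sum>y\<in>UNIV. \<Sum>w\<in>UNIV.
     hop x a x * hop y b y * hop w c w - hop x a y * hop y b x * hop w c w
       - hop x a w * hop w c x * hop y b y - hop y b w * hop w c y * hop x a x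
       + hop x a y * hop y b w * hop w c x + hop x a w * hop w c y * hop y b x)"

lemma double_sum_split:
  fixes G :: "'n::finite \<Rightarrow> 'n \<Rightarrow> complex"
  shows "(\<Sum>x\<in>UNIV. \<Sum>y\<in>UNIV. G x y) = (\<Sum>x\<in>UNIV. \<Sum>y\<in>UNIV. if x \<noteq> y then G x y else 0) + (\<Sum>x\<in>UNIV. G x x)"
proof -
  have "(\<Sum>x\<in>UNIV. \<Sum>y\<in>UNIV. G x y) = (\<Sum>x\<in>UNIV. \<Sum>y\<in>UNIV. (if x \<noteq> y then G x y else 0) + (if y = x then G x x else 0))"
    by (intro sum.cong refl) auto
  thus ?thesis by (simp add: sum.distrib)
qed

text \<open>One sum for each of the five partitions of the three indices into classes of equal
  ones.\<close>

lemma triple_sum_split: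
  fixes G :: "'n::finite \<Rightarrow> 'n \<Rightarrow> 'n \<Rightarrow> complex"
  shows "(\<Sum>x\<in>UNIV. \<Sum>y\<in>UNIV. \<Sum>w\<in>UNIV. G x y w)
    = (\<Sum>x\<in>UNIV. \<Sum>y\<in>UNIV. \<Sum>w\<in>UNIV. if x \<noteq> y \<and> x \<noteq> w \<and> y \<noteq> w then G x y w else 0)
      + (\<Sum>x\<in>UNIV. \<Sum>w\<in>UNIV. if x \<noteq> w then G x x w else 0)
      + (\<Sum>x\<in>UNIV. \<Sum>y\<in>UNIV. if x \<noteq> y then G x y x else 0)
      + (\<Sum>x\<in>UNIV. \<Sum>y\<in>UNIV. if x \<noteq> y then G x y y else 0)
      + (\<Sum>x\<in>UNIV. G x x x)"
proof -
  have "(\<Sum>x\<in>UNIV. \<Sum>y\<in>UNIV. \<Sum>w\<in>UNIV. G x y w)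
     = (\<Sum>x\<in>UNIV. (\<Sum>y\<in>UNIV. \<Sum>w\<in>UNIV. if x \<noteq> y then G x y w else 0) + (\<Sum>w\<in>UNIV. G x x w))"
  proof (intro sum.cong refl)
    fix x
    have "(\<Sum>y\<in>UNIV. \<Sum>w\<in>UNIV. G x y w)
       = (\<Sum>y\<in>UNIV. (\<Sum>w\<in>UNIV. if x \<noteq> y then G x y w else 0) + (if y = x then (\<Sum>w\<in>UNIV. G x x w) else 0))"
      by (intro sum.cong refl) auto
    thus "(\<Sum>y\<in>UNIV. \<Sum>w\<in>UNIV. G x y w)
       = (\<Sum>y\<in>UNIV. \<Sum>w\<in>UNIV. if x \<noteq> y then G x y w else 0) + (\<Sum>w\<in>UNIV. G x x w)"
      by (simp add: sum.distrib)
  qed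
  also have "\<dots> = (\<Sum>x\<in>UNIV. \<Sum>y\<in>UNIV. (\<Sum>w\<in>UNIV. if x \<noteq> y \<and> x \<noteq> w \<and> y \<noteq> w then G x y w else 0)
        + (if x \<noteq> y then G x y x else 0) + (if x \<noteq> y then G x y y else 0)) + (\<Sum>x\<in>UNIV. \<Sum>w\<in>UNIV. G x x w)"
    unfolding sum.distrib
  proof (intro arg_cong2[of _ _ _ _ "(+)"] refl, unfold sum.distrib[symmetric], intro sum.cong refl)
    fix x y :: 'n
    have "(\<Sum>w\<in>UNIV. if x \<noteq> y then G x y w else 0)
       = (\<Sum>w\<in>UNIV. (if x \<noteq> y \<and> x \<noteq> w \<and> y \<noteq> w then G x y w else 0) + (if w = x then (if x \<noteq> y then G x y x else 0) else 0)
          + (if w = y then (if x \<noteq> y then G x y y else 0) else 0))"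
      by (intro sum.cong refl) auto
    thus "(\<Sum>w\<in>UNIV. if x \<noteq> y then G x y w else 0)
       = (\<Sum>w\<in>UNIV. if x \<noteq> y \<and> x \<noteq> w \<and> y \<noteq> w then G x y w else 0)
        + (if x \<noteq> y then G x y x else 0) + (if x \<noteq> y then G x y y else 0)"
      by (simp add: sum.distrib)
  qed
  finally show ?thesis
    by (simp add: sum.distrib double_sum_split[of "\<lambda>x w. G x x w"])
qed

lemma power_ops1: "power_ops [a] (alternant rho) (rho :: 'n::finite \<Rightarrow> int) = hop1 a TYPE('n)"
  by (simp add: power_op_alternant alternant_rho_shift1 hop1_def)

lemma power_ops2:
  "power_ops [a, b] (alternant rho) (rho :: 'n::finite \<Rightarrow> int) = hop2 a b TYPE('n) + hop1 (a + b) TYPE('n)"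
proof -
  have b: "power_op b (alternant rho) = (\<lambda>\<nu>. \<Sum>y\<in>UNIV. alternant (rho(y := rho y + b)) (\<nu> :: 'n \<Rightarrow> int))"
    by (simp add: power_op_alternant fun_eq_iff)
  have "power_ops [a, b] (alternant rho) (rho :: 'n \<Rightarrow> int)
     = (\<Sum>y\<in>(UNIV::'n set). \<Sum>x\<in>UNIV. alternant ((rho(y := rho y + b))(x := (rho(y := rho y + b)) x + a)) rho)"
    by (simp add: b power_op_sum power_op_alternant del: fun_upd_apply)
  also have "\<dots> = (\<Sum>y\<in>(UNIV::'n set). \<Sum>x\<in>UNIV. if y \<noteq> x then hop x a x * hop y b y - hop x a y * hop y b x else 0)
      + (\<Sum>x\<in>(UNIV::'n set). hop x (a + b) x)"
    by (subst double_sum_split, intro arg_cong2[of _ _ _ _ "(+)"] sum.cong refl)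
      (auto simp: alternant_rho_shift2 alternant_rho_shift1 add.assoc add.commute[of b])
  also have "(\<Sum>y\<in>(UNIV::'n set). \<Sum>x\<in>UNIV. if y \<noteq> x then hop x a x * hop y b y - hop x a y * hop y b x else 0) = hop2 a b TYPE('n)"
    unfolding hop2_def by (subst sum.swap, intro sum.cong refl) auto
  finally show ?thesis by (simp add: hop1_def)
qed

text \<open>Each of the five coincidence patterns contributes the determinant of its classes, with
  the shifts inside a class added. Degenerate determinants have equal columns and vanish, so the
  sums extend to all indices.\<close>

lemma power_ops3:
  "power_ops [a, b, c] (alternant rho) (rho :: 'n::finite \<Rightarrow> int)
     = hop3 a b c TYPE('n) + hop2 (b + c) a TYPE('n) + hop2 (a + c) b TYPE('n) + hop2 (a + b) c TYPE('n)
       + hop1 (a + b + c) TYPE('n)"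
proof -
  have c: "power_op c (alternant rho) = (\<lambda>\<nu>. \<Sum>w\<in>UNIV. alternant (rho(w := rho w + c)) (\<nu> :: 'n \<Rightarrow> int))"
    by (simp add: power_op_alternant fun_eq_iff)
  have bc: "power_op b (power_op c (alternant rho)) = (\<lambda>\<nu>. \<Sum>w\<in>UNIV. \<Sum>y\<in>UNIV.
      alternant ((rho(w := rho w + c))(y := (rho(w := rho w + c)) y + b)) (\<nu> :: 'n \<Rightarrow> int))"
    by (simp add: c power_op_sum power_op_alternant fun_eq_iff del: fun_upd_apply)
  define G where "G w y x = alternant ((rho(w := rho w + c, y := (rho(w := rho w + c)) y + b))
      (x := (rho(w := rho w + c, y := (rho(w := rho w + c)) y + b)) x + a)) rho" for w y x :: 'n
  have G1: "G w y x = hop x a x * hop y b y * hop w c w - hop x a y * hop y b x * hop w c w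
       - hop x a w * hop w c x * hop y b y - hop y b w * hop w c y * hop x a x
       + hop x a y * hop y b w * hop w c x + hop x a w * hop w c y * hop y b x"
    if "w \<noteq> y \<and> w \<noteq> x \<and> y \<noteq> x" for w y x
  proof -
    have neq: "y \<noteq> w" "x \<noteq> w" "x \<noteq> y" using that by auto
    hence "G w y x = alternant (rho(w := rho w + c, y := rho y + b, x := rho x + a)) rho"
      by (simp add: G_def)
    thus ?thesis using alternant_rho_shift3[of x y w] neq by simp
  qed
  have G2: "G w w x = hop x a x * hop w (b + c) w - hop x a w * hop w (b + c) x" if "w \<noteq> x" for w x
    using alternant_rho_shift2[of x w "b + c" a] that by (simp add: G_def ac_simps)
  have G3: "G w y w = hop w (a + c) w * hop y b y - hop w (a + c) y * hop y b w" if "w \<noteq> y" for w y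
  proof -
    have "G w y w = alternant (rho(y := rho y + b, w := rho w + (a + c))) rho"
      using that by (simp add: G_def fun_upd_twist[of w y] ac_simps)
    thus ?thesis using alternant_rho_shift2[OF that] by simp
  qed
  have G4: "G w y y = hop y (a + b) y * hop w c w - hop y (a + b) w * hop w c y" if "w \<noteq> y" for w y
    using alternant_rho_shift2[of y w c "a + b"] that by (simp add: G_def ac_simps)
  have G5: "G x x x = hop x (a + b + c) x" for x
    using alternant_rho_shift1[of x "a + b + c"] by (simp add: G_def ac_simps)
  have "power_ops [a, b, c] (alternant rho) (rho :: 'n \<Rightarrow> int)
     = (\<Sum>w\<in>(UNIV::'n set). \<Sum>y\<in>UNIV. \<Sum>x\<in>UNIV. G w y x)"
    by (simp only: power_ops.simps bc power_op_sum power_op_alternant G_def)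
  also have "\<dots> = (\<Sum>w\<in>(UNIV::'n set). \<Sum>y\<in>UNIV. \<Sum>x\<in>UNIV. if w \<noteq> y \<and> w \<noteq> x \<and> y \<noteq> x then
       hop x a x * hop y b y * hop w c w - hop x a y * hop y b x * hop w c w
       - hop x a w * hop w c x * hop y b y - hop y b w * hop w c y * hop x a x
       + hop x a y * hop y b w * hop w c x + hop x a w * hop w c y * hop y b x else 0)
      + (\<Sum>w\<in>(UNIV::'n set). \<Sum>x\<in>UNIV. if w \<noteq> x then hop x a x * hop w (b + c) w - hop x a w * hop w (b + c) x else 0)
      + (\<Sum>w\<in>(UNIV::'n set). \<Sum>y\<in>UNIV. if w \<noteq> y then hop w (a + c) w * hop y b y - hop w (a + c) y * hop y b w else 0)
      + (\<Sum>w\<in>(UNIV::'n set). \<Sum>y\<in>UNIV. if w \<noteq> y then hop y (a + b) y * hop w c w - hop y (a + b) w * hop w c y else 0)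
      + (\<Sum>x\<in>(UNIV::'n set). hop x (a + b + c) x)"
    by (subst triple_sum_split, intro arg_cong2[of _ _ _ _ "(+)"] sum.cong refl if_cong)
      (erule G1 G2 G3 G4 | rule G5)+
  also have "(\<Sum>w\<in>(UNIV::'n set). \<Sum>y\<in>UNIV. \<Sum>x\<in>UNIV. if w \<noteq> y \<and> w \<noteq> x \<and> y \<noteq> x then
       hop x a x * hop y b y * hop w c w - hop x a y * hop y b x * hop w c w
       - hop x a w * hop w c x * hop y b y - hop y b w * hop w c y * hop x a x
       + hop x a y * hop y b w * hop w c x + hop x a w * hop w c y * hop y b x else 0) = hop3 a b c TYPE('n)"
  proof -
    have "hop3 a b c TYPE('n) = (\<Sum>w\<in>(UNIV::'n set). \<Sum>y\<in>UNIV. \<Sum>x\<in>UNIV.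
       hop x a x * hop y b y * hop w c w - hop x a y * hop y b x * hop w c w
       - hop x a w * hop w c x * hop y b y - hop y b w * hop w c y * hop x a x
       + hop x a y * hop y b w * hop w c x + hop x a w * hop w c y * hop y b x)"
      unfolding hop3_def
      by (subst sum.swap, subst (2) sum.swap, subst sum.swap) (rule refl)
    thus ?thesis by (simp only:) (intro sum.cong refl, auto simp: algebra_simps)
  qed
  also have "(\<Sum>w\<in>(UNIV::'n set). \<Sum>x\<in>UNIV. if w \<noteq> x then hop x a x * hop w (b + c) w - hop x a w * hop w (b + c) x else 0)
      = hop2 (b + c) a TYPE('n)"
    unfolding hop2_def by (intro sum.cong refl) auto
  also have "(\<Sum>w\<in>(UNIV::'n set). \<Sum>y\<in>UNIV. if w \<noteq> y then hop w (a + c) w * hop y b y - hop w (a + c) y * hop y b w else 0)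
      = hop2 (a + c) b TYPE('n)"
    unfolding hop2_def by (intro sum.cong refl) auto
  also have "(\<Sum>w\<in>(UNIV::'n set). \<Sum>y\<in>UNIV. if w \<noteq> y then hop y (a + b) y * hop w c w - hop y (a + b) w * hop w c y else 0)
      = hop2 (a + b) c TYPE('n)"
    unfolding hop2_def by (subst sum.swap, intro sum.cong refl) auto
  finally show ?thesis by (simp add: hop1_def)
qed

section \<open>Counting closed walks on the exponents\<close>

lemma sum_rho: "(\<Sum>x\<in>(UNIV::'n::finite set). f (rho x)) = (\<Sum>i\<in>{0..<int CARD('n)}. f i)"
  by (rule sum.reindex_bij_betw[OF rho_bij])

lemma hop1_eq: "hop1 a TYPE('n::finite) = of_bool (a = 0) * of_nat CARD('n)"
  by (simp add: hop1_def hop_def)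

text \<open>The sum counts closed walks i, i+a, i within 0, ..., N-1. They require a + b = 0, and
  the admissible starting points form an interval of length N - |a|, or none if this is
  negative.\<close>

lemma hop_cycle2:
  "(\<Sum>x\<in>(UNIV::'n::finite set). \<Sum>y\<in>UNIV. hop x a y * hop y b x)
     = of_bool (a + b = 0) * of_nat (CARD('n) - nat \<bar>a\<bar>)"
proof -
  let ?R = "{0..<int CARD('n)}"
  have "(\<Sum>x\<in>(UNIV::'n set). \<Sum>y\<in>UNIV. hop x a y * hop y b x)
     = (\<Sum>i\<in>?R. \<Sum>j\<in>?R. of_bool (i + a = j) * of_bool (j + b = i))"
    unfolding hop_def sum_rho[of "\<lambda>j. of_bool (_ + a = j) * of_bool (j + b = _)", where 'n = 'n]
    by (rule sum_rho)
  also have "\<dots> = (\<Sum>i\<in>?R. \<Sum>j\<in>?R. if j = i + a then of_bool (a + b = 0) else 0)"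
    by (intro sum.cong refl) (auto simp: of_bool_def)
  also have "\<dots> = (\<Sum>i\<in>?R. if i + a \<in> ?R then of_bool (a + b = 0) else 0)"
    by (intro sum.cong refl) (subst sum.delta, simp_all)
  also have "\<dots> = of_nat (card {i \<in> ?R. i + a \<in> ?R}) * of_bool (a + b = 0)"
    by (simp flip: sum.inter_filter)
  also have "{i \<in> ?R. i + a \<in> ?R} = {max 0 (-a)..<min (int CARD('n)) (int CARD('n) - a)}"
    by auto
  also have "card \<dots> = CARD('n) - nat \<bar>a\<bar>" unfolding card_atLeastLessThan_int by arith
  finally show ?thesis by simp
qed

lemma hop_cycle3:
  "(\<Sum>x\<in>(UNIV::'n::finite set). \<Sum>y\<in>UNIV. \<Sum>w\<in>UNIV. hop x a y * hop y b w * hop w c x)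
     = of_bool (a + b + c = 0) * of_nat (card {i \<in> {0..<int CARD('n)}. i + a \<in> {0..<int CARD('n)} \<and> i + a + b \<in> {0..<int CARD('n)}})"
proof -
  let ?R = "{0..<int CARD('n)}"
  have "(\<Sum>x\<in>(UNIV::'n set). \<Sum>y\<in>UNIV. \<Sum>w\<in>UNIV. hop x a y * hop y b w * hop w c x)
     = (\<Sum>i\<in>?R. \<Sum>j\<in>?R. \<Sum>k\<in>?R. of_bool (i + a = j) * of_bool (j + b = k) * of_bool (k + c = i))"
    unfolding hop_def
      sum_rho[of "\<lambda>k. of_bool (_ = _) * of_bool (_ + b = k) * of_bool (k + c = _)", where 'n = 'n]
      sum_rho[of "\<lambda>j. \<Sum>k\<in>?R. of_bool (_ = j) * of_bool (j + b = k) * of_bool (k + c = _)", where 'n = 'n]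
    by (rule sum_rho)
  also have "\<dots> = (\<Sum>i\<in>?R. \<Sum>j\<in>?R. if j = i + a then (\<Sum>k\<in>?R. if k = i + a + b then of_bool (a + b + c = 0) else 0) else 0)"
  proof (intro sum.cong refl)
    fix i j
    have "(\<Sum>k\<in>?R. of_bool (i + a = j) * of_bool (j + b = k) * of_bool (k + c = i))
      = (\<Sum>k\<in>?R. if j = i + a then if k = i + a + b then of_bool (a + b + c = 0) else 0 else (0::complex))"
      by (intro sum.cong refl) (auto simp: of_bool_def)
    thus "(\<Sum>k\<in>?R. of_bool (i + a = j) * of_bool (j + b = k) * of_bool (k + c = i))
      = (if j = i + a then (\<Sum>k\<in>?R. if k = i + a + b then of_bool (a + b + c = 0) else 0) else (0::complex))"
      by (cases "j = i + a") simp_all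
  qed
  also have "\<dots> = (\<Sum>i\<in>?R. if i + a \<in> ?R \<and> i + a + b \<in> ?R then of_bool (a + b + c = 0) else 0)"
    by (intro sum.cong refl) (subst (1 2) sum.delta, simp_all)
  also have "\<dots> = of_nat (card {i \<in> ?R. i + a \<in> ?R \<and> i + a + b \<in> ?R}) * of_bool (a + b + c = 0)"
    by (simp flip: sum.inter_filter)
  finally show ?thesis by simp
qed

lemma hop2_eq:
  assumes "a \<noteq> 0 \<or> b \<noteq> 0"
  shows "hop2 a b TYPE('n::finite) = - (of_bool (a + b = 0) * of_nat (CARD('n) - nat \<bar>a\<bar>))"
proof -
  have hz: "hop x a x * hop y b y = 0" for x y :: 'n using assms by (auto simp: hop_def)
  have "hop2 a b TYPE('n) = - (\<Sum>x\<in>(UNIV::'n set). \<Sum>y\<in>UNIV. hop x a y * hop y b x)"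
    unfolding hop2_def hz by (simp add: sum_negf)
  thus ?thesis by (simp add: hop_cycle2)
qed

text \<open>For equal indices the value is min(j, N), the classical second moment of a power trace;
  truncated subtraction expresses the minimum.\<close>

lemma power_ops_pair:
  assumes "j > 0" "l > 0"
  shows "power_ops [- int j, int l] (alternant rho) (rho :: 'n::finite \<Rightarrow> int)
    = of_bool (j = l) * (of_nat CARD('n) - of_nat (CARD('n) - j))"
  unfolding power_ops2 hop1_eq using assms by (auto simp: hop2_eq)

text \<open>No shift is 0, so every term of \<open>hop3\<close> with a fixed index vanishes and only
  the two three-cycles remain, each counting N - (j+k) walks. One copy cancels against the pair term
  for -(j+k) and l; the other two pair terms are the subtractions in the result.\<close>

lemma power_ops_triple:
  assumes "j > 0" "k > 0" "l > 0"
  shows "power_ops [- int j, - int k, int l] (alternant rho) (rho :: 'n::finite \<Rightarrow> int)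
    = of_bool (l = j + k) * (of_nat CARD('n) + of_nat (CARD('n) - (j + k)) - of_nat (CARD('n) - j) - of_nat (CARD('n) - k))"
proof -
  let ?R = "{0..<int CARD('n)}"
  have z: "hop x (- int j) x = 0" "hop x (- int k) x = 0" "hop x (int l) x = 0" for x :: 'n
    using assms by (auto simp: hop_def)
  have "hop3 (- int j) (- int k) (int l) TYPE('n)
     = (\<Sum>x\<in>(UNIV::'n set). \<Sum>y\<in>UNIV. \<Sum>w\<in>UNIV. hop x (- int j) y * hop y (- int k) w * hop w (int l) x)
      + (\<Sum>x\<in>(UNIV::'n set). \<Sum>w\<in>UNIV. \<Sum>y\<in>UNIV. hop x (- int j) w * hop w (int l) y * hop y (- int k) x)"
    unfolding hop3_def z by (simp add: sum.distrib) (rule sum.cong[OF refl], rule sum.swap)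
  also have "\<dots> = of_bool (l = j + k) * (2 * of_nat (CARD('n) - (j + k)))"
  proof (cases "l = j + k")
    case True
    have s1: "{i \<in> ?R. i + - int j \<in> ?R \<and> i + - int j + - int k \<in> ?R} = {int (j + k)..<int CARD('n)}"
      by auto
    have s2: "{i \<in> ?R. i + - int j \<in> ?R \<and> i + - int j + int l \<in> ?R} = {int j..<int CARD('n) - int k}"
      using True by auto
    have "nat (int CARD('n) - int (j + k)) = CARD('n) - (j + k)"
      "nat (int CARD('n) - int k - int j) = CARD('n) - (j + k)" by arith+
    thus ?thesis unfolding hop_cycle3 s1 s2 card_atLeastLessThan_int using True by simp
  next
    case False
    hence "- int j + - int k + int l \<noteq> 0" "- int j + int l + - int k \<noteq> 0" by auto
    thus ?thesis using False by (simp add: hop_cycle3)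
  qed
  finally have 3: "hop3 (- int j) (- int k) (int l) TYPE('n) = of_bool (l = j + k) * (2 * of_nat (CARD('n) - (j + k)))" .
  show ?thesis
    unfolding power_ops3 3 hop1_eq using assms
    by (cases "l = j + k") (auto simp: hop2_eq nat_minus_as_int algebra_simps)
qed

text \<open>Inclusion-exclusion for the i below N with i < j and i + k >= N. On the right the
  dependence on \<open>j\<close> and \<open>k\<close> is separated, so the double generating series
  factors for each \<open>i\<close>.\<close>

lemma count_identity:
  "of_nat N + of_nat (N - (j + k)) - of_nat (N - j) - of_nat (N - k)
     = (\<Sum>i<N. of_bool (i < j) * of_bool (N - Suc i < k) :: complex)"
proof -
  have "(\<Sum>i<N. of_bool (i < j) * of_bool (N - Suc i < k) :: complex)
     = (\<Sum>i<N. 1 + of_bool (j \<le> i \<and> i + k < N) - of_bool (j \<le> i) - of_bool (i + k < N))"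
    by (intro sum.cong refl) (auto simp: of_bool_def)
  also have "\<dots> = of_nat N + of_nat (card {i \<in> {..<N}. j \<le> i \<and> i + k < N})
      - of_nat (card {i \<in> {..<N}. j \<le> i}) - of_nat (card {i \<in> {..<N}. i + k < N})"
    by (simp add: sum.distrib sum_subtractf of_bool_def flip: sum.inter_filter)
  also have "{i \<in> {..<N}. j \<le> i \<and> i + k < N} = {j..<N - k}" by auto
  also have "{i \<in> {..<N}. j \<le> i} = {j..<N}" by auto
  also have "{i \<in> {..<N}. i + k < N} = {..<N - k}" by auto
  finally show ?thesis by (simp add: add.commute)
qed

text \<open>The case \<open>k = N\<close>, in which the second condition always holds.\<close>

lemma count_identity_single:
  "of_nat N - of_nat (N - j) = (\<Sum>i<N. of_bool (i < j) :: complex)"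
proof -
  have "of_nat N + of_nat (N - (j + N)) - of_nat (N - j) - of_nat (N - N) = (of_nat N - of_nat (N - j) :: complex)"
    by simp
  moreover have "(\<Sum>i<N. of_bool (i < j) * of_bool (N - Suc i < N) :: complex) = (\<Sum>i<N. of_bool (i < j))"
    by (intro sum.cong) auto
  ultimately show ?thesis using count_identity[of N j N] by (simp only:)
qed

section \<open>Averages of logarithmic derivatives\<close>

lemma sums_geometric_tail:
  fixes u :: complex
  assumes "norm u < 1"
  shows "(\<lambda>j. of_bool (i < Suc j) * u ^ Suc j) sums (u ^ Suc i / (1 - u))"
    and "summable (\<lambda>j. norm (of_bool (i < Suc j) * u ^ Suc j))"
proof -
  have "(\<lambda>j. u ^ Suc i * u ^ j) sums (u ^ Suc i * (1 / (1 - u)))"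
    by (intro sums_mult geometric_sums assms)
  hence "(\<lambda>j. of_bool (i < Suc (j + i)) * u ^ Suc (j + i)) sums (u ^ Suc i / (1 - u))"
    by (simp add: power_add mult_ac)
  thus "(\<lambda>j. of_bool (i < Suc j) * u ^ Suc j) sums (u ^ Suc i / (1 - u))"
    by (subst (asm) sums_iff_shift) (simp add: sum.neutral)
  show "summable (\<lambda>j. norm (of_bool (i < Suc j) * u ^ Suc j))"
  proof (rule summable_comparison_test')
    show "summable (\<lambda>j. norm u ^ Suc j)"
      using assms by (simp add: summable_mult summable_geometric)
    show "norm (norm (of_bool (i < Suc j) * u ^ Suc j)) \<le> norm u ^ Suc j" if "j \<ge> 0" for j
      by (simp add: norm_mult norm_power)
  qed
qed

text \<open>\<open>u\<close> and \<open>v\<close> are $e^{-\alpha_1-\beta}$ and $e^{-\alpha_2-\beta}$. The sum is $(u^N-v^N)/(u-v)$ without the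
  removable singularity.\<close>

definition J3_cont :: "nat \<Rightarrow> complex \<Rightarrow> complex \<Rightarrow> complex" where
  "J3_cont N u v = u * v / ((1 - u) * (1 - v)) * (\<Sum>i<N. u ^ i * v ^ (N - Suc i))"

definition J2_cont :: "nat \<Rightarrow> complex \<Rightarrow> complex" where
  "J2_cont N u = u / (1 - u) * (\<Sum>i<N. u ^ i)"

text \<open>For fixed \<open>i\<close> the double series is the product of two geometric tails,
  starting at the exponents i+1 and N-i. Absolute convergence permits summation along diagonals, as
  a Cauchy product.\<close>

lemma J3_cont_sums:
  assumes u: "norm u < 1" and v: "norm v < 1"
  shows "(\<lambda>n. \<Sum>j\<le>n. u ^ Suc j * v ^ Suc (n - j) * (of_nat N + of_nat (N - (Suc j + Suc (n - j))) - of_nat (N - Suc j) - of_nat (N - Suc (n - j))))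
     sums J3_cont N u v"
proof -
  have "(\<lambda>n. \<Sum>j\<le>n. (of_bool (i < Suc j) * u ^ Suc j) * (of_bool (N - Suc i < Suc (n - j)) * v ^ Suc (n - j)))
     sums (u ^ Suc i / (1 - u) * (v ^ Suc (N - Suc i) / (1 - v)))" for i
    using Cauchy_product_sums[OF sums_geometric_tail(2)[OF u] sums_geometric_tail(2)[OF v]]
      sums_unique[OF sums_geometric_tail(1)[OF u]] sums_unique[OF sums_geometric_tail(1)[OF v]]
    by (simp del: power_Suc)
  hence "(\<lambda>n. \<Sum>i<N. \<Sum>j\<le>n. (of_bool (i < Suc j) * u ^ Suc j) * (of_bool (N - Suc i < Suc (n - j)) * v ^ Suc (n - j)))
     sums (\<Sum>i<N. u ^ Suc i / (1 - u) * (v ^ Suc (N - Suc i) / (1 - v)))"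
    by (intro sums_sum) auto
  moreover have "(\<Sum>i<N. \<Sum>j\<le>n. (of_bool (i < Suc j) * u ^ Suc j) * (of_bool (N - Suc i < Suc (n - j)) * v ^ Suc (n - j)))
     = (\<Sum>j\<le>n. u ^ Suc j * v ^ Suc (n - j) * (of_nat N + of_nat (N - (Suc j + Suc (n - j))) - of_nat (N - Suc j) - of_nat (N - Suc (n - j))))" for n
    unfolding count_identity sum_distrib_left
    by (subst sum.swap) (intro sum.cong refl, simp only: mult_ac)
  moreover have "(\<Sum>i<N. u ^ Suc i / (1 - u) * (v ^ Suc (N - Suc i) / (1 - v))) = J3_cont N u v"
    unfolding J3_cont_def sum_distrib_left by (intro sum.cong refl) (simp add: mult_ac)
  ultimately show ?thesis by simp
qed

lemma J2_cont_sums: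
  assumes u: "norm u < 1"
  shows "(\<lambda>j. u ^ Suc j * (of_nat N - of_nat (N - Suc j))) sums J2_cont N u"
proof -
  have "(\<lambda>j. \<Sum>i<N. of_bool (i < Suc j) * u ^ Suc j) sums (\<Sum>i<N. u ^ Suc i / (1 - u))"
    by (intro sums_sum sums_geometric_tail u)
  moreover have "(\<Sum>i<N. of_bool (i < Suc j) * u ^ Suc j) = u ^ Suc j * (of_nat N - of_nat (N - Suc j))" for j
    unfolding count_identity_single by (simp only: sum_distrib_left mult.commute)
  moreover have "(\<Sum>i<N. u ^ Suc i / (1 - u)) = J2_cont N u"
    unfolding J2_cont_def sum_distrib_left by (intro sum.cong refl) simp
  ultimately show ?thesis by (simp only:)
qed

section \<open>Power series of logarithmic derivatives\<close>

lemma norm_power_sum_le: "norm (\<Sum>n\<in>(UNIV::'n::finite set). cis (\<phi> n) powi k) \<le> real CARD('n)"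
proof -
  have "norm (\<Sum>n\<in>(UNIV::'n set). cis (\<phi> n) powi k) \<le> (\<Sum>n\<in>(UNIV::'n set). norm (cis (\<phi> n) powi k))"
    by (rule norm_sum)
  thus ?thesis by (simp add: norm_power_int)
qed

text \<open>A factor 1 - s c with c on the unit circle contributes s c / (1 - s c) to minus s L'/L,
  and this expands geometrically for |s| < 1.\<close>

lemma logderiv_product_sums:
  fixes \<phi> :: "'n::finite \<Rightarrow> real"
  assumes s: "norm s < 1"
    and L: "\<And>s. L s = (\<Prod>n\<in>(UNIV::'n set). 1 - s * cis (\<phi> n))"
  shows "(\<lambda>k. s ^ Suc k * (\<Sum>n\<in>UNIV. cis (\<phi> n) powi int (Suc k))) sums (- (s * (deriv L s / L s)))"
proof -
  have ne: "1 - s * cis (\<phi> n) \<noteq> 0" for n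
  proof
    assume "1 - s * cis (\<phi> n) = 0"
    hence "norm (s * cis (\<phi> n)) = 1" by simp
    thus False using s by (simp add: norm_mult)
  qed
  have "(L has_field_derivative (L s * (\<Sum>n\<in>UNIV. (- cis (\<phi> n)) / (1 - s * cis (\<phi> n))))) (at s)"
    unfolding L[abs_def] using ne
    by (intro has_field_derivative_prod') (auto intro!: derivative_eq_intros)
  moreover have "L s \<noteq> 0" using ne by (simp add: L)
  ultimately have "deriv L s / L s = (\<Sum>n\<in>UNIV. (- cis (\<phi> n)) / (1 - s * cis (\<phi> n)))"
    by (simp add: DERIV_imp_deriv)
  hence eq: "- (s * (deriv L s / L s)) = (\<Sum>n\<in>UNIV. (s * cis (\<phi> n)) * (1 / (1 - s * cis (\<phi> n))))"
    by (simp add: sum_distrib_left sum_negf[symmetric])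
  have "(\<lambda>k. \<Sum>n\<in>UNIV. (s * cis (\<phi> n)) * (s * cis (\<phi> n)) ^ k) sums (\<Sum>n\<in>UNIV. (s * cis (\<phi> n)) * (1 / (1 - s * cis (\<phi> n))))"
    by (intro sums_sum sums_mult geometric_sums) (simp add: norm_mult s)
  moreover have "(\<Sum>n\<in>UNIV. (s * cis (\<phi> n)) * (s * cis (\<phi> n)) ^ k) = s ^ Suc k * (\<Sum>n\<in>UNIV. cis (\<phi> n) powi int (Suc k))" for k
    unfolding sum_distrib_left by (intro sum.cong refl) (simp add: power_int_def power_mult_distrib nat_add_distrib mult_ac)
  ultimately show ?thesis unfolding eq by (simp only:)
qed

section \<open>The explicit formulas as rational functions\<close>

lemma z_logderiv_eq:
  assumes "exp (- x) \<noteq> 1"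
  shows "z_logderiv x = - exp (- x) / (1 - exp (- x))"
proof -
  have ne: "1 - exp (- x) \<noteq> 0" using assms by simp
  have "(zfun has_field_derivative - exp (- x) / (1 - exp (- x))\<^sup>2) (at x)"
    unfolding zfun_def[abs_def] using ne
    by (auto intro!: derivative_eq_intros simp: power2_eq_square)
  hence "deriv zfun x = - exp (- x) / (1 - exp (- x))\<^sup>2" by (rule DERIV_imp_deriv)
  thus ?thesis using ne by (simp add: z_logderiv_def zfun_def power2_eq_square)
qed

lemma deriv_z_logderiv:
  assumes "exp (- x) \<noteq> 1"
  shows "deriv z_logderiv x = exp (- x) / (1 - exp (- x))\<^sup>2"
proof -
  have ne: "1 - exp (- x) \<noteq> 0" using assms by simp
  have "((\<lambda>y. - exp (- y) / (1 - exp (- y))) has_field_derivative exp (- x) / (1 - exp (- x))\<^sup>2) (at x)"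
    using ne by (auto intro!: derivative_eq_intros simp: power2_eq_square divide_simps) (simp add: algebra_simps)
  moreover have "open {y :: complex. exp (- y) \<noteq> 1}"
    by (intro open_Collect_neq continuous_intros)
  ultimately have "(z_logderiv has_field_derivative exp (- x) / (1 - exp (- x))\<^sup>2) (at x)"
    by (rule has_field_derivative_transform_within_open[where S = "{y. exp (- y) \<noteq> 1}"])
      (use assms in \<open>auto simp: z_logderiv_eq\<close>)
  thus ?thesis by (rule DERIV_imp_deriv)
qed

text \<open>With x = \<alpha> + \<beta> and u = exp(-x), the derivative of z'/z at x is u/(1-u)^2,
  and z(x) z(-x) is its negative. The sum is u (1 - u^N)/(1-u)^2.\<close>

lemma J2_eq_J2_cont:
  assumes "exp (- (\<alpha> + \<beta>)) \<noteq> 1"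
  shows "J2 N \<alpha> \<beta> = J2_cont N (exp (- (\<alpha> + \<beta>)))"
proof -
  define u where "u = exp (- (\<alpha> + \<beta>))"
  have u: "u \<noteq> 0" "u \<noteq> 1" using assms by (simp_all add: u_def)
  have e: "exp (- (- \<alpha> - \<beta>)) = 1 / u" by (simp add: u_def exp_minus field_simps exp_add exp_diff)
  have n: "exp (- of_nat N * (\<alpha> + \<beta>)) = u ^ N"
    by (simp only: u_def exp_of_nat_mult[symmetric] mult_minus_left mult_minus_right)
  have "J2 N \<alpha> \<beta> = u / (1 - u)\<^sup>2 + u ^ N * (1 / (1 - u)) * (1 / (1 - 1 / u))"
    unfolding J2_def deriv_z_logderiv[OF assms] zfun_def e n by (simp add: u_def)
  also have "\<dots> = u / (1 - u) * ((u ^ N - 1) / (u - 1))"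
    using u by (simp add: divide_simps power2_eq_square) (simp add: algebra_simps)
  also have "(u ^ N - 1) / (u - 1) = (\<Sum>i<N. u ^ i)" using u by (simp add: geometric_sum)
  finally show ?thesis by (simp add: J2_cont_def u_def)
qed

lemma J3_cont_eq:
  assumes "u \<noteq> v"
  shows "J3_cont N u v = u * v * (u ^ N - v ^ N) / ((1 - u) * (1 - v) * (u - v))"
proof -
  have "u ^ N - v ^ N = (u - v) * (\<Sum>i<N. u ^ i * v ^ (N - Suc i))"
    using power_diff_sumr2[of u N v] by (simp add: mult.commute)
  thus ?thesis using assms by (simp add: J3_cont_def)
qed

lemma J3_formula_eq_J3_cont:
  assumes "(\<alpha>1, \<alpha>2, \<beta>) \<in> J3_regular"
  shows "J3_formula N (\<alpha>1, \<alpha>2, \<beta>) = J3_cont N (exp (- (\<alpha>1 + \<beta>))) (exp (- (\<alpha>2 + \<beta>)))"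
proof -
  define u v where "u = exp (- (\<alpha>1 + \<beta>))" and "v = exp (- (\<alpha>2 + \<beta>))"
  have u0: "u \<noteq> 0" "v \<noteq> 0" by (simp_all add: u_def v_def)
  have e: "exp (- (- \<alpha>1 - \<beta>)) = 1 / u" "exp (- (- \<alpha>2 - \<beta>)) = 1 / v"
    "exp (- (\<alpha>2 - \<alpha>1)) = v / u" "exp (- (\<alpha>1 - \<alpha>2)) = u / v"
    by (simp_all add: u_def v_def exp_minus field_simps exp_add exp_diff)
  have r: "u \<noteq> 1" "v \<noteq> 1" "u \<noteq> v"
    using assms by (auto simp: J3_regular_def u_def v_def exp_minus exp_add exp_diff field_simps)
  have n: "exp (- of_nat N * (\<alpha>1 + \<beta>)) = u ^ N" "exp (- of_nat N * (\<alpha>2 + \<beta>)) = v ^ N"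
    by (simp_all only: u_def v_def exp_of_nat_mult[symmetric] mult_minus_left mult_minus_right)
  have z: "z_logderiv (\<alpha>2 - \<alpha>1) = - (v / u) / (1 - v / u)" "z_logderiv (\<alpha>1 - \<alpha>2) = - (u / v) / (1 - u / v)"
    "z_logderiv (\<alpha>2 + \<beta>) = - v / (1 - v)" "z_logderiv (\<alpha>1 + \<beta>) = - u / (1 - u)"
  proof -
    have zf: "z_logderiv x = - w / (1 - w)" if "exp (- x) = w" "w \<noteq> 1" for x w
      using that by (simp add: z_logderiv_eq)
    have "v / u \<noteq> 1" "u / v \<noteq> 1" using r u0 by auto
    thus "z_logderiv (\<alpha>2 - \<alpha>1) = - (v / u) / (1 - v / u)" "z_logderiv (\<alpha>1 - \<alpha>2) = - (u / v) / (1 - u / v)"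
      using zf[OF e(3)] zf[OF e(4)] by simp_all
    show "z_logderiv (\<alpha>2 + \<beta>) = - v / (1 - v)" "z_logderiv (\<alpha>1 + \<beta>) = - u / (1 - u)"
      using zf[OF u_def[symmetric] r(1)] zf[OF v_def[symmetric] r(2)] by simp_all
  qed
  \<comment> \<open>One computation serves both halves of the formula: the second is the first with
    \<open>u\<close> and \<open>v\<close> exchanged. The exchange changes the sign of the
    coefficient and so produces the difference u^N - v^N.\<close>
  have coeff: "1 / (1 - u) * (1 / (1 - 1 / u)) * (- (v / u) / (1 - v / u) - - v / (1 - v))
      = u * v / ((1 - u) * (1 - v) * (u - v))" if "u \<noteq> 0" "u \<noteq> 1" "v \<noteq> 1" "u \<noteq> v" for u v :: complex
  proof -
    have "- (v / u) / (1 - v / u) = - v / (u - v)" "1 / (1 - 1 / u) = u / (u - 1)"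
      using that by (simp_all add: field_simps)
    moreover have "- v / (u - v) - - v / (1 - v) = v * (u - 1) / ((u - v) * (1 - v))"
      using that by (simp add: divide_simps) (simp add: algebra_simps)
    ultimately show ?thesis using that by (simp add: divide_simps)
  qed
  have "J3_formula N (\<alpha>1, \<alpha>2, \<beta>)
     = u ^ N * (1 / (1 - u) * (1 / (1 - 1 / u)) * (- (v / u) / (1 - v / u) - - v / (1 - v)))
     + v ^ N * (1 / (1 - v) * (1 / (1 - 1 / v)) * (- (u / v) / (1 - u / v) - - u / (1 - u)))"
    unfolding J3_formula_def prod.case z n zfun_def e u_def[symmetric] v_def[symmetric]
    by (simp only: mult.assoc)
  also have "\<dots> = u ^ N * (u * v / ((1 - u) * (1 - v) * (u - v))) + v ^ N * (v * u / ((1 - v) * (1 - u) * (v - u)))"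
    using r u0 by (subst (1 2) coeff) auto
  also have "\<dots> = u * v * (u ^ N - v ^ N) / ((1 - u) * (1 - v) * (u - v))"
    using r by (simp add: divide_simps) (simp add: algebra_simps)
  also have "\<dots> = J3_cont N u v" using r by (simp add: J3_cont_eq)
  finally show ?thesis by (simp add: u_def v_def)
qed

text \<open>Where \<open>D\<close> accumulates at \<open>p\<close>, the continuous extension
  \<open>G\<close> provides the limit and uniqueness of limits identifies \<open>Lim\<close> with
  it; for a trivial filter \<open>Lim\<close> would be undetermined.\<close>

lemma fill_in_eq:
  assumes "\<And>q. q \<in> D \<Longrightarrow> F q = G q" and "continuous (at p within D) G" and "p \<notin> D \<Longrightarrow> at p within D \<noteq> bot"
  shows "fill_in D F p = G p"
proof (cases "p \<in> D")
  case False
  have "(G \<longlongrightarrow> G p) (at p within D)" using assms(2) by (simp add: continuous_within)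
  hence "(F \<longlongrightarrow> G p) (at p within D)"
    by (rule Lim_transform_eventually) (auto simp: eventually_at_filter assms(1))
  thus ?thesis using False assms(3) by (simp add: fill_in_def tendsto_Lim)
qed (simp add: fill_in_def assms(1))

lemma at_within_nontrivial:
  assumes "(f \<longlongrightarrow> p) (at_right (0::real))" "\<forall>\<^sub>F t in at_right 0. f t \<in> D" "p \<notin> D"
  shows "at p within D \<noteq> bot"
proof -
  have "filterlim f (at p within D) (at_right 0)"
    unfolding filterlim_at using assms by (auto elim: eventually_mono)
  thus ?thesis
    using filterlim_def[of f "at p within D" "at_right 0"] by (auto simp: bot_unique filtermap_bot_iff)
qed

text \<open>With positive real parts the only possible singularity is exp(\<alpha>1 - \<alpha>2) =
  1, and \<open>J3_cont\<close> is continuous across it.\<close>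

lemma J3_eq_J3_cont:
  assumes "Re \<alpha>1 > 0" "Re \<alpha>2 > 0" "Re \<beta> > 0"
  shows "J3 N \<alpha>1 \<alpha>2 \<beta> = J3_cont N (exp (- (\<alpha>1 + \<beta>))) (exp (- (\<alpha>2 + \<beta>)))"
proof -
  define G where "G = (\<lambda>(\<alpha>1, \<alpha>2, \<beta>). J3_cont N (exp (- (\<alpha>1 + \<beta>))) (exp (- (\<alpha>2 + \<beta>))))"
  have ne: "exp z \<noteq> 1" if "Re z \<noteq> 0" for z :: complex
  proof
    assume "exp z = 1"
    hence "exp (Re z) = norm (1 :: complex)" by (metis norm_exp_eq_Re)
    thus False using that by simp
  qed
  have "fill_in J3_regular (J3_formula N) (\<alpha>1, \<alpha>2, \<beta>) = G (\<alpha>1, \<alpha>2, \<beta>)"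
  proof (rule fill_in_eq)
    show "J3_formula N q = G q" if "q \<in> J3_regular" for q
      using that by (cases q) (simp add: G_def J3_formula_eq_J3_cont)
    show "continuous (at (\<alpha>1, \<alpha>2, \<beta>) within J3_regular) G"
      unfolding G_def J3_cont_def case_prod_unfold
      by (intro continuous_intros) (use assms in \<open>auto simp: ne\<close>)
    assume p: "(\<alpha>1, \<alpha>2, \<beta>) \<notin> J3_regular"
    \<comment> \<open>Moving \<alpha>1 in the real direction changes the modulus of exp(\<alpha>1 -
      \<alpha>2) and so leaves the singular set at once.\<close>
    show "at (\<alpha>1, \<alpha>2, \<beta>) within J3_regular \<noteq> bot"
    proof (rule at_within_nontrivial[where f = "\<lambda>t. (\<alpha>1 + of_real t, \<alpha>2, \<beta>)"])
      show "((\<lambda>t. (\<alpha>1 + complex_of_real t, \<alpha>2, \<beta>)) \<longlongrightarrow> (\<alpha>1, \<alpha>2, \<beta>)) (at_right 0)"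
        by (auto intro!: tendsto_eq_intros)
      have 1: "exp (\<alpha>1 - \<alpha>2) = 1"
        using p assms by (auto simp: J3_regular_def ne)
      have "exp (\<alpha>1 + of_real t - \<alpha>2) \<noteq> 1" if "t > 0" for t
      proof -
        have "exp (\<alpha>1 + of_real t - \<alpha>2) = exp (\<alpha>1 - \<alpha>2) * exp (of_real t)"
          by (simp flip: exp_add add: algebra_simps)
        thus ?thesis using that by (simp add: 1 ne)
      qed
      hence "(\<alpha>1 + of_real t, \<alpha>2, \<beta>) \<in> J3_regular" if "t > 0" for t
        using that assms by (auto simp: J3_regular_def ne)
      thus "\<forall>\<^sub>F t in at_right 0. (\<alpha>1 + of_real t, \<alpha>2, \<beta>) \<in> J3_regular"
        by (auto simp: eventually_at_filter)
    qed (rule p)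
  qed
  thus ?thesis by (simp add: J3_def G_def)
qed

text \<open>The bound is independent of the number of terms and provides the constant for dominated
  convergence.\<close>

lemma power_sum_partial_bound:
  fixes p :: "nat \<Rightarrow> complex"
  assumes s: "norm s < 1" and p: "\<And>k. norm (p k) \<le> C"
  shows "norm (\<Sum>k<m. s ^ Suc k * p k) \<le> C * (1 / (1 - norm s))"
proof -
  have C: "C \<ge> 0" using p[of 0] norm_ge_zero order_trans by blast
  have "norm (\<Sum>k<m. s ^ Suc k * p k) \<le> (\<Sum>k<m. norm s ^ k * C)"
  proof (rule order_trans[OF norm_sum], rule sum_mono)
    fix k
    have "norm s ^ Suc k \<le> norm s ^ k" using s by (simp add: mult_left_le_one_le)
    thus "norm (s ^ Suc k * p k) \<le> norm s ^ k * C"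
      unfolding norm_mult norm_power by (intro mult_mono p) auto
  qed
  also have "\<dots> = C * (\<Sum>k<m. norm s ^ k)" by (simp add: sum_distrib_left mult.commute)
  also have "(\<Sum>k<m. norm s ^ k) \<le> (\<Sum>k. norm s ^ k)"
    using s by (intro sum_le_suminf summable_geometric) auto
  hence "C * (\<Sum>k<m. norm s ^ k) \<le> C * (1 / (1 - norm s))"
    using s C by (intro mult_left_mono) (simp_all add: suminf_geometric)
  finally show ?thesis .
qed

lemma sum_product3:
  fixes f g h :: "_ \<Rightarrow> complex"
  shows "(\<Sum>j\<in>A. f j) * (\<Sum>k\<in>B. g k) * (\<Sum>l\<in>C. h l) = (\<Sum>j\<in>A. \<Sum>k\<in>B. \<Sum>l\<in>C. f j * (g k * h l))"
proof -
  have "(\<Sum>j\<in>A. f j) * (\<Sum>k\<in>B. g k) * (\<Sum>l\<in>C. h l) = (\<Sum>j\<in>A. f j * (\<Sum>k\<in>B. \<Sum>l\<in>C. g k * h l))"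
    by (simp only: mult.assoc sum_product[of g B h C]) (rule sum_distrib_right)
  thus ?thesis by (simp only: sum_distrib_left)
qed

section \<open>Termwise integration over the group\<close>

locale haar_eigenangles =
  fixes M :: "(complex^'n^'n) measure" and \<theta> :: "complex^'n^'n \<Rightarrow> 'n \<Rightarrow> real"
  assumes M: "haar_prob M" and eig: "\<And>X. X \<in> unitary_group \<Longrightarrow> eigenangles X (\<theta> X)"
begin

definition psum :: "int \<Rightarrow> complex^'n^'n \<Rightarrow> complex" where
  "psum k X = (\<Sum>n\<in>UNIV. cis (\<theta> X n) powi k)"

text \<open>On the group the sum agrees with a power trace, whatever choice of eigenangles
  \<open>\<theta>\<close> makes.\<close>

lemma psum_continuous: "continuous_on unitary_group (psum k)"
proof -
  have "continuous_on unitary_group (\<lambda>X :: complex^'n^'n. power_trace X k)" by (rule continuous_on_power_trace)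
  thus ?thesis by (rule continuous_on_cong[THEN iffD1, rotated -1]) (simp_all add: psum_def power_trace_eigenangles[OF eig])
qed

lemma psum_bound: "norm (psum k X) \<le> real CARD('n)"
  unfolding psum_def by (rule norm_power_sum_le)

lemma psum_integral: "(LINT X|M. prod_list (map (\<lambda>k. psum k X) ks)) = power_ops ks (alternant rho) (rho :: 'n \<Rightarrow> int)"
  unfolding psum_def by (rule haar_integral_power_sums[OF M eig])

lemma psum_integral2: "(LINT X|M. psum a X * psum b X) = power_ops [a, b] (alternant rho) (rho :: 'n \<Rightarrow> int)"
  using psum_integral[of "[a, b]"] by simp

lemma psum_integral3: "(LINT X|M. psum a X * psum b X * psum c X) = power_ops [a, b, c] (alternant rho) (rho :: 'n \<Rightarrow> int)"
  using psum_integral[of "[a, b, c]"] by (simp add: mult.assoc)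

text \<open>Truncated expansion of minus s times the logarithmic derivative of \<open>Lam X\<close>.
  The indices are negative because \<open>Lam\<close> is built from the adjoint of
  \<open>X\<close>.\<close>

definition lower_sum :: "nat \<Rightarrow> complex \<Rightarrow> complex^'n^'n \<Rightarrow> complex" where
  "lower_sum m s X = (\<Sum>k<m. s ^ Suc k * psum (- int (Suc k)) X)"

definition upper_sum :: "nat \<Rightarrow> complex \<Rightarrow> complex^'n^'n \<Rightarrow> complex" where
  "upper_sum m s X = (\<Sum>k<m. s ^ Suc k * psum (int (Suc k)) X)"

lemma lower_sum_limit:
  assumes "norm s < 1" "X \<in> unitary_group"
  shows "(\<lambda>m. lower_sum m s X) \<longlonglongrightarrow> - (s * Lam_logderiv X s)"
proof -
  have "(\<Sum>n\<in>UNIV. cis (- \<theta> X n) powi int (Suc k)) = psum (- int (Suc k)) X" for k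
    unfolding psum_def by (intro sum.cong refl) (simp only: power_int_minus cis_inverse[symmetric] power_int_inverse)
  moreover have "(\<lambda>k. s ^ Suc k * (\<Sum>n\<in>UNIV. cis (- \<theta> X n) powi int (Suc k))) sums (- (s * (deriv (Lam X) s / Lam X s)))"
    by (rule logderiv_product_sums[OF assms(1)]) (rule Lam_eigenangles[OF eig[OF assms(2)]])
  ultimately show ?thesis by (simp only: sums_def lower_sum_def Lam_logderiv_def)
qed

lemma upper_sum_limit:
  assumes "norm s < 1" "X \<in> unitary_group"
  shows "(\<lambda>m. upper_sum m s X) \<longlonglongrightarrow> - (s * Lam_logderiv (ctranspose X) s)"
proof -
  have "(\<lambda>k. s ^ Suc k * (\<Sum>n\<in>UNIV. cis (\<theta> X n) powi int (Suc k))) sums (- (s * (deriv (Lam (ctranspose X)) s / Lam (ctranspose X) s)))"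
    by (rule logderiv_product_sums[OF assms(1)]) (rule Lam_ctranspose_eigenangles[OF eig[OF assms(2)]])
  thus ?thesis by (simp only: sums_def upper_sum_def Lam_logderiv_def psum_def)
qed

lemma lower_sum_bound: "norm s < 1 \<Longrightarrow> norm (lower_sum m s X) \<le> real CARD('n) * (1 / (1 - norm s))"
  unfolding lower_sum_def by (erule power_sum_partial_bound) (rule psum_bound)

lemma upper_sum_bound: "norm s < 1 \<Longrightarrow> norm (upper_sum m s X) \<le> real CARD('n) * (1 / (1 - norm s))"
  unfolding upper_sum_def by (erule power_sum_partial_bound) (rule psum_bound)

lemma lower_sum_continuous: "continuous_on unitary_group (lower_sum m s)"
  unfolding lower_sum_def[abs_def] by (intro continuous_intros psum_continuous)

lemma upper_sum_continuous: "continuous_on unitary_group (upper_sum m s)"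
  unfolding upper_sum_def[abs_def] by (intro continuous_intros psum_continuous)

text \<open>The common bound \<open>B\<close> allows dominated convergence, and the measurability of
  the limit is inherited from the continuous functions \<open>F m\<close>.\<close>

lemma integral_limit:
  assumes "\<And>m. continuous_on unitary_group (F m)" "\<And>m X. norm (F m X) \<le> B"
    "\<And>X. X \<in> unitary_group \<Longrightarrow> (\<lambda>m. F m X) \<longlonglongrightarrow> G X"
  shows "(\<lambda>m. LINT X|M. F m X) \<longlonglongrightarrow> (LINT X|M. G X :: complex)"
proof -
  interpret prob_space M by (rule haar_prob_prob_space[OF M])
  have lim: "X \<in> space M \<Longrightarrow> (\<lambda>m. F m X) \<longlonglongrightarrow> G X" for X
    using assms(3) by (simp add: haar_prob_space[OF M])
  show ?thesis
  proof (rule integral_dominated_convergence[where w = "\<lambda>_. B"])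
    show "G \<in> borel_measurable M"
      by (rule borel_measurable_LIMSEQ_metric[OF haar_measurable[OF M assms(1)] lim])
  qed (use haar_measurable[OF M assms(1)] assms(2) lim in auto)
qed

text \<open>In the product of the truncated series the second moments leave only the diagonal, whose
  sum is a partial sum of the series of \<open>J2_cont\<close>.\<close>

lemma pair_integral:
  assumes s: "norm s < 1" and t: "norm t < 1"
  shows "s * t * (LINT X|M. Lam_logderiv X s * Lam_logderiv (ctranspose X) t) = J2_cont CARD('n) (s * t)"
proof -
  let ?N = "CARD('n)"
  let ?F = "\<lambda>m X. lower_sum m s X * upper_sum m t X"
  have "(\<lambda>m. LINT X|M. ?F m X) \<longlonglongrightarrow> (LINT X|M. (- (s * Lam_logderiv X s)) * (- (t * Lam_logderiv (ctranspose X) t)))"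
  proof (rule integral_limit)
    show "norm (?F m X) \<le> (real ?N * (1 / (1 - norm s))) * (real ?N * (1 / (1 - norm t)))" for m X
      unfolding norm_mult using lower_sum_bound[OF s] upper_sum_bound[OF t] s
      by (intro mult_mono) auto
  qed (intro continuous_intros lower_sum_continuous upper_sum_continuous tendsto_mult lower_sum_limit upper_sum_limit s t; assumption?)+
  also have "(LINT X|M. (- (s * Lam_logderiv X s)) * (- (t * Lam_logderiv (ctranspose X) t)))
     = s * t * (LINT X|M. Lam_logderiv X s * Lam_logderiv (ctranspose X) t)"
    by (simp flip: integral_mult_right_zero add: mult_ac)
  finally have lim1: "(\<lambda>m. LINT X|M. ?F m X) \<longlonglongrightarrow> s * t * (LINT X|M. Lam_logderiv X s * Lam_logderiv (ctranspose X) t)" .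
  have "(LINT X|M. ?F m X) = (\<Sum>j<m. (s * t) ^ Suc j * (of_nat ?N - of_nat (?N - Suc j)))" for m
  proof -
    have "?F m X = (\<Sum>j<m. \<Sum>l<m. s ^ Suc j * t ^ Suc l * (psum (- int (Suc j)) X * psum (int (Suc l)) X))" for X
      unfolding lower_sum_def upper_sum_def sum_product by (intro sum.cong refl) (simp only: mult_ac)
    hence "(LINT X|M. ?F m X) = (\<Sum>j<m. \<Sum>l<m. s ^ Suc j * t ^ Suc l * (LINT X|M. psum (- int (Suc j)) X * psum (int (Suc l)) X))"
      by (simp add: haar_integrable[OF M] psum_continuous continuous_intros del: power_Suc)
    also have "\<dots> = (\<Sum>j<m. \<Sum>l<m. if l = j then (s * t) ^ Suc j * (of_nat ?N - of_nat (?N - Suc j)) else 0)"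
      unfolding psum_integral2 power_ops_pair[OF zero_less_Suc zero_less_Suc]
      by (intro sum.cong refl) (auto simp: power_mult_distrib)
    also have "\<dots> = (\<Sum>j<m. (s * t) ^ Suc j * (of_nat ?N - of_nat (?N - Suc j)))"
      by (intro sum.cong refl) (simp del: power_Suc)
    finally show ?thesis .
  qed
  moreover have "norm (s * t) < 1"
    using s t mult_strict_mono[of "norm s" 1 "norm t" 1] by (simp add: norm_mult)
  ultimately have "(\<lambda>m. LINT X|M. ?F m X) \<longlonglongrightarrow> J2_cont ?N (s * t)"
    using J2_cont_sums[of "s * t" ?N] by (simp add: sums_def del: power_Suc)
  with lim1 show ?thesis by (rule LIMSEQ_unique)
qed

text \<open>The minus sign in front collects the signs of the three logarithmic expansions; the
  third moments restrict the product of series to a Cauchy product.\<close>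

lemma triple_integral:
  assumes s: "norm s < 1" and r: "norm r < 1" and t: "norm t < 1"
  shows "- (s * r * t) * (LINT X|M. Lam_logderiv X s * Lam_logderiv X r * Lam_logderiv (ctranspose X) t)
     = J3_cont CARD('n) (s * t) (r * t)"
proof -
  let ?N = "CARD('n)"
  \<comment> \<open>With \<open>Suc m\<close> terms in each series, the condition l = Suc (j + k)
    cuts out exactly the triangle j + k < m, so the integral is the m-th partial sum of the Cauchy
    product.\<close>
  let ?F = "\<lambda>m X. lower_sum (Suc m) s X * lower_sum (Suc m) r X * upper_sum (Suc m) t X"
  define c where "c j k = (of_nat ?N + of_nat (?N - (Suc j + Suc k)) - of_nat (?N - Suc j) - of_nat (?N - Suc k) :: complex)" for j k
  have "(\<lambda>m. LINT X|M. ?F m X) \<longlonglongrightarrow> (LINT X|M. (- (s * Lam_logderiv X s)) * (- (r * Lam_logderiv X r)) * (- (t * Lam_logderiv (ctranspose X) t)))"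
  proof (rule integral_limit)
    show "norm (?F m X) \<le> (real ?N * (1 / (1 - norm s))) * (real ?N * (1 / (1 - norm r))) * (real ?N * (1 / (1 - norm t)))" for m X
      unfolding norm_mult using lower_sum_bound[OF s] lower_sum_bound[OF r] upper_sum_bound[OF t] s r
      by (intro mult_mono) auto
  qed (intro continuous_intros lower_sum_continuous upper_sum_continuous tendsto_mult LIMSEQ_Suc[OF lower_sum_limit] LIMSEQ_Suc[OF upper_sum_limit] s r t; assumption?)+
  also have "(LINT X|M. (- (s * Lam_logderiv X s)) * (- (r * Lam_logderiv X r)) * (- (t * Lam_logderiv (ctranspose X) t)))
     = - (s * r * t) * (LINT X|M. Lam_logderiv X s * Lam_logderiv X r * Lam_logderiv (ctranspose X) t)"
    by (simp flip: integral_mult_right_zero add: mult_ac)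
  finally have lim1: "(\<lambda>m. LINT X|M. ?F m X) \<longlonglongrightarrow> - (s * r * t) * (LINT X|M. Lam_logderiv X s * Lam_logderiv X r * Lam_logderiv (ctranspose X) t)" .
  have "(LINT X|M. ?F m X) = (\<Sum>n<m. \<Sum>j\<le>n. (s * t) ^ Suc j * (r * t) ^ Suc (n - j) * c j (n - j))" for m
  proof -
    have "?F m X = (\<Sum>j<Suc m. \<Sum>k<Suc m. \<Sum>l<Suc m. s ^ Suc j * r ^ Suc k * t ^ Suc l
        * (psum (- int (Suc j)) X * psum (- int (Suc k)) X * psum (int (Suc l)) X))" for X
      unfolding lower_sum_def upper_sum_def sum_product3 by (intro sum.cong refl) (simp only: mult_ac)
    hence "(LINT X|M. ?F m X) = (\<Sum>j<Suc m. \<Sum>k<Suc m. \<Sum>l<Suc m. s ^ Suc j * r ^ Suc k * t ^ Suc l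
        * (LINT X|M. psum (- int (Suc j)) X * psum (- int (Suc k)) X * psum (int (Suc l)) X))"
      by (simp add: haar_integrable[OF M] psum_continuous continuous_intros del: power_Suc sum.lessThan_Suc)
    also have "\<dots> = (\<Sum>j<Suc m. \<Sum>k<Suc m. \<Sum>l<Suc m. if l = Suc (j + k) then (s * t) ^ Suc j * (r * t) ^ Suc k * c j k else 0)"
      unfolding psum_integral3 power_ops_triple[OF zero_less_Suc zero_less_Suc zero_less_Suc]
      by (intro sum.cong refl) (auto simp: power_mult_distrib c_def power_add)
    also have "\<dots> = (\<Sum>j<Suc m. \<Sum>k<Suc m. if j + k < m then (s * t) ^ Suc j * (r * t) ^ Suc k * c j k else 0)"
      by (intro sum.cong refl) (simp del: power_Suc sum.lessThan_Suc add: sum.delta)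
    also have "\<dots> = (\<Sum>(j, k)\<in>{(j, k). j + k < m}. (s * t) ^ Suc j * (r * t) ^ Suc k * c j k)"
      unfolding sum.cartesian_product
      by (rule sum.mono_neutral_cong_right) (auto simp del: power_Suc split: if_splits)
    also have "\<dots> = (\<Sum>n<m. \<Sum>j\<le>n. (s * t) ^ Suc j * (r * t) ^ Suc (n - j) * c j (n - j))"
      by (rule sum.triangle_reindex)
    finally show ?thesis .
  qed
  moreover have "norm (s * t) < 1" "norm (r * t) < 1"
    using s t r mult_strict_mono[of "norm s" 1 "norm t" 1] mult_strict_mono[of "norm r" 1 "norm t" 1]
    by (simp_all add: norm_mult)
  ultimately have "(\<lambda>m. LINT X|M. ?F m X) \<longlonglongrightarrow> J3_cont ?N (s * t) (r * t)"
    using J3_cont_sums[of "s * t" "r * t" ?N] by (simp add: sums_def c_def del: power_Suc)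
  with lim1 show ?thesis by (rule LIMSEQ_unique)
qed

lemma pair_formula:
  assumes "Re \<alpha> > 0" "Re \<beta> > 0"
  shows "exp (- \<alpha> - \<beta>) * (LINT X|M. Lam_logderiv X (exp (- \<alpha>)) * Lam_logderiv (ctranspose X) (exp (- \<beta>)))
     = J2 CARD('n) \<alpha> \<beta>"
proof -
  have "norm (exp (- (\<alpha> + \<beta>))) < 1" using assms by simp
  hence "exp (- (\<alpha> + \<beta>)) \<noteq> 1" by (metis norm_one less_irrefl)
  moreover have "exp (- (\<alpha> + \<beta>)) = exp (- \<alpha>) * exp (- \<beta>)" "exp (- \<alpha> - \<beta>) = exp (- \<alpha>) * exp (- \<beta>)"
    by (simp_all flip: exp_add)
  ultimately show ?thesis
    using pair_integral[of "exp (- \<alpha>)" "exp (- \<beta>)"] assms by (simp add: J2_eq_J2_cont)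
qed

lemma triple_formula:
  assumes "Re \<alpha>1 > 0" "Re \<alpha>2 > 0" "Re \<beta> > 0"
  shows "- exp (- \<alpha>1 - \<alpha>2 - \<beta>) * (LINT X|M. Lam_logderiv X (exp (- \<alpha>1)) * Lam_logderiv X (exp (- \<alpha>2))
            * Lam_logderiv (ctranspose X) (exp (- \<beta>)))
     = J3 CARD('n) \<alpha>1 \<alpha>2 \<beta>"
proof -
  have "exp (- (\<alpha>1 + \<beta>)) = exp (- \<alpha>1) * exp (- \<beta>)" "exp (- (\<alpha>2 + \<beta>)) = exp (- \<alpha>2) * exp (- \<beta>)"
    "exp (- \<alpha>1 - \<alpha>2 - \<beta>) = exp (- \<alpha>1) * exp (- \<alpha>2) * exp (- \<beta>)"
    by (simp_all flip: exp_add)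
  thus ?thesis
    using triple_integral[of "exp (- \<alpha>1)" "exp (- \<alpha>2)" "exp (- \<beta>)"] assms by (simp add: J3_eq_J3_cont)
qed

end

section \<open>Triple correlation\<close>

definition character3 :: "int \<Rightarrow> int \<Rightarrow> int \<Rightarrow> real \<times> real \<times> real \<Rightarrow> complex" where
  "character3 a b c = (\<lambda>(x, y, w). cis (of_int a * x + of_int b * y + of_int c * w))"

inductive trig_poly :: "(real \<times> real \<times> real \<Rightarrow> complex) \<Rightarrow> bool" where
  trig_poly_monom: "trig_poly (\<lambda>p. k * character3 a b c p)"
| trig_poly_add: "trig_poly g \<Longrightarrow> trig_poly h \<Longrightarrow> trig_poly (\<lambda>p. g p + h p)"

lemma character3_mult:
  "character3 a b c p * character3 a' b' c' p = character3 (a + a') (b + b') (c + c') p"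
  by (cases p) (simp add: character3_def cis_mult algebra_simps)

lemma trig_poly_monom_mult: "trig_poly g \<Longrightarrow> trig_poly (\<lambda>p. k * character3 a b c p * g p)"
proof (induction rule: trig_poly.induct)
  case (trig_poly_monom k' a' b' c')
  have "k * character3 a b c p * (k' * character3 a' b' c' p) = k * k' * character3 (a + a') (b + b') (c + c') p" for p
    by (simp flip: character3_mult)
  thus ?case by (simp only: trig_poly.trig_poly_monom)
next
  case (trig_poly_add g h)
  show ?case using trig_poly.trig_poly_add[OF trig_poly_add.IH] by (simp only: distrib_left)
qed

lemma trig_poly_mult: "trig_poly g \<Longrightarrow> trig_poly h \<Longrightarrow> trig_poly (\<lambda>p. g p * h p)"
proof (induction rule: trig_poly.induct)
  case (trig_poly_monom k a b c)
  thus ?case by (rule trig_poly_monom_mult)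
next
  case (trig_poly_add g h)
  thus ?case by (simp add: distrib_right trig_poly.trig_poly_add)
qed

lemma trig_poly_const: "trig_poly (\<lambda>p. k)"
proof -
  have "character3 0 0 0 p = 1" for p by (cases p) (simp add: character3_def)
  thus ?thesis using trig_poly_monom[of k 0 0 0] by simp
qed

text \<open>Real and imaginary parts of a character are combinations of it and its conjugate, which
  is again a character.\<close>

lemma trig_poly_coordinates:
  "trig_poly (\<lambda>(x, y, w). of_real (Re (cis x)))" "trig_poly (\<lambda>(x, y, w). of_real (Im (cis x)))"
  "trig_poly (\<lambda>(x, y, w). of_real (Re (cis y)))" "trig_poly (\<lambda>(x, y, w). of_real (Im (cis y)))"
  "trig_poly (\<lambda>(x, y, w). of_real (Re (cis w)))" "trig_poly (\<lambda>(x, y, w). of_real (Im (cis w)))"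
proof -
  have neg: "character3 (-a) (-b) (-c) p = cnj (character3 a b c p)" for a b c p
    by (cases p) (simp add: character3_def cis_cnj)
  have re: "trig_poly (\<lambda>(x, y, w). of_real (cos (of_int a * x + of_int b * y + of_int c * w)))" for a b c
  proof -
    have "trig_poly (\<lambda>p. 1/2 * character3 a b c p + 1/2 * character3 (-a) (-b) (-c) p)"
      by (intro trig_poly.intros)
    also have "(\<lambda>p. 1/2 * character3 a b c p + 1/2 * character3 (-a) (-b) (-c) p)
       = (\<lambda>(x, y, w). of_real (cos (of_int a * x + of_int b * y + of_int c * w)))"
      unfolding neg by (simp add: fun_eq_iff character3_def complex_eq_iff)
    finally show ?thesis .
  qed
  have im: "trig_poly (\<lambda>(x, y, w). of_real (sin (of_int a * x + of_int b * y + of_int c * w)))" for a b c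
  proof -
    have "trig_poly (\<lambda>p. (- \<i>/2) * character3 a b c p + \<i>/2 * character3 (-a) (-b) (-c) p)"
      by (intro trig_poly.intros)
    also have "(\<lambda>p. (- \<i>/2) * character3 a b c p + \<i>/2 * character3 (-a) (-b) (-c) p)
       = (\<lambda>(x, y, w). of_real (sin (of_int a * x + of_int b * y + of_int c * w)))"
      unfolding neg by (simp add: fun_eq_iff character3_def complex_eq_iff)
    finally show ?thesis .
  qed
  show "trig_poly (\<lambda>(x, y, w). of_real (Re (cis x)))" "trig_poly (\<lambda>(x, y, w). of_real (Im (cis x)))"
    "trig_poly (\<lambda>(x, y, w). of_real (Re (cis y)))" "trig_poly (\<lambda>(x, y, w). of_real (Im (cis y)))"
    "trig_poly (\<lambda>(x, y, w). of_real (Re (cis w)))" "trig_poly (\<lambda>(x, y, w). of_real (Im (cis w)))"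
    using re[of 1 0 0] im[of 1 0 0] re[of 0 1 0] im[of 0 1 0] re[of 0 0 1] im[of 0 0 1] by simp_all
qed

text \<open>Polynomials in the six real coordinates of the ambient space restrict to trigonometric
  polynomials on the torus. A real-linear functional is expanded in these coordinates; the other
  cases are closure properties.\<close>

lemma trig_poly_real_polynomial:
  assumes "real_polynomial_function (h :: complex \<times> complex \<times> complex \<Rightarrow> real)"
  shows "trig_poly (\<lambda>(x, y, w). of_real (h (cis x, cis y, cis w)))"
  using assms
proof (induction rule: real_polynomial_function.induct)
  case (linear h)
  then interpret bounded_linear h .
  have lin: "h (z1, z2, z3) = h (1, 0, 0) * Re z1 + h (\<i>, 0, 0) * Im z1 + (h (0, 1, 0) * Re z2 + h (0, \<i>, 0) * Im z2)
     + (h (0, 0, 1) * Re z3 + h (0, 0, \<i>) * Im z3)" for z1 z2 z3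
  proof -
    have "(z1, z2, z3) = Re z1 *\<^sub>R (1, 0, 0) + Im z1 *\<^sub>R (\<i>, 0, 0) + (Re z2 *\<^sub>R (0, 1, 0) + Im z2 *\<^sub>R (0, \<i>, 0))
       + (Re z3 *\<^sub>R (0, 0, 1) + Im z3 *\<^sub>R (0, 0, \<i>))"
      by (simp add: complex_eq_iff)
    hence "h (z1, z2, z3) = h (Re z1 *\<^sub>R (1, 0, 0) + Im z1 *\<^sub>R (\<i>, 0, 0) + (Re z2 *\<^sub>R (0, 1, 0) + Im z2 *\<^sub>R (0, \<i>, 0))
       + (Re z3 *\<^sub>R (0, 0, 1) + Im z3 *\<^sub>R (0, 0, \<i>)))" by (simp only:)
    thus ?thesis by (simp only: add scaleR) (simp add: mult.commute)
  qed
  have eq: "(\<lambda>(x, y, w). of_real (h (cis x, cis y, cis w))) = (\<lambda>p. of_real (h (1, 0, 0)) * (\<lambda>(x, y, w). of_real (Re (cis x))) p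
     + of_real (h (\<i>, 0, 0)) * (\<lambda>(x, y, w). of_real (Im (cis x))) p
     + (of_real (h (0, 1, 0)) * (\<lambda>(x, y, w). of_real (Re (cis y))) p
     + of_real (h (0, \<i>, 0)) * (\<lambda>(x, y, w). of_real (Im (cis y))) p)
     + (of_real (h (0, 0, 1)) * (\<lambda>(x, y, w). of_real (Re (cis w))) p
     + of_real (h (0, 0, \<i>)) * (\<lambda>(x, y, w). of_real (Im (cis w))) p :: complex))" (is "?L = ?R")
  proof (rule ext)
    fix p :: "real \<times> real \<times> real"
    obtain x y w where p: "p = (x, y, w)" by (cases p)
    show "?L p = ?R p" unfolding p using lin[of "cis x" "cis y" "cis w"] by simp
  qed
  show ?case unfolding eq
    by (intro trig_poly_add trig_poly_mult trig_poly_const trig_poly_coordinates)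
next
  case (const c)
  have "(\<lambda>(x, y, w). complex_of_real c) = (\<lambda>p :: real \<times> real \<times> real. of_real c)" by (simp add: fun_eq_iff)
  thus ?case by (simp only: trig_poly_const)
next
  case (add f g)
  have "(\<lambda>(x, y, w). complex_of_real (f (cis x, cis y, cis w) + g (cis x, cis y, cis w)))
     = (\<lambda>p. (\<lambda>(x, y, w). of_real (f (cis x, cis y, cis w))) p + (\<lambda>(x, y, w). of_real (g (cis x, cis y, cis w))) p)"
    by (simp add: fun_eq_iff)
  thus ?case using trig_poly_add[OF add.IH] by (simp only:)
next
  case (mult f g)
  have "(\<lambda>(x, y, w). complex_of_real (f (cis x, cis y, cis w) * g (cis x, cis y, cis w)))
     = (\<lambda>p. (\<lambda>(x, y, w). of_real (f (cis x, cis y, cis w))) p * (\<lambda>(x, y, w). of_real (g (cis x, cis y, cis w))) p)"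
    by (simp add: fun_eq_iff)
  thus ?case using trig_poly_mult[OF mult.IH] by (simp only:)
qed

lemma periodic3_shift:
  assumes "periodic3 f"
  shows "f (x + 2 * pi * of_int a, y + 2 * pi * of_int b, w + 2 * pi * of_int c) = f (x, y, w)"
proof -
  have shift: "h (x + 2 * pi * of_int n) = h x" if h: "\<And>x. h (x + 2 * pi) = h x" for h :: "real \<Rightarrow> complex" and n x
  proof -
    have nat: "h (x + 2 * pi * of_nat m) = h x" for m x
    proof (induction m)
      case (Suc m)
      have "x + 2 * pi * of_nat (Suc m) = (x + 2 * pi * of_nat m) + 2 * pi" by (simp add: algebra_simps)
      thus ?case by (simp only: h Suc.IH)
    qed simp
    show ?thesis
    proof (cases "n \<ge> 0")
      case True
      thus ?thesis using nat[of x "nat n"] by simp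
    next
      case False
      thus ?thesis using nat[of "x + 2 * pi * of_int n" "nat (- n)"] by simp
    qed
  qed
  have p: "f (x + 2 * pi, y, w) = f (x, y, w)" "f (x, y + 2 * pi, w) = f (x, y, w)" "f (x, y, w + 2 * pi) = f (x, y, w)" for x y w
    using assms by (auto simp: periodic3_def)
  have "f (x + 2 * pi * of_int a, y + 2 * pi * of_int b, w + 2 * pi * of_int c) = f (x, y + 2 * pi * of_int b, w + 2 * pi * of_int c)"
    by (rule shift[of "\<lambda>x. f (x, y + 2 * pi * of_int b, w + 2 * pi * of_int c)"]) (rule p)
  also have "\<dots> = f (x, y, w + 2 * pi * of_int c)"
    by (rule shift[of "\<lambda>y. f (x, y, w + 2 * pi * of_int c)"]) (rule p)
  also have "\<dots> = f (x, y, w)" by (rule shift[of "\<lambda>w. f (x, y, w)"]) (rule p)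
  finally show ?thesis .
qed

lemma Arg_cis_shift: "\<exists>n. x = Arg (cis x) + 2 * pi * of_int n"
proof -
  have "cis x = cis (Arg (cis x))" using cis_Arg[of "cis x"] by (simp add: sgn_div_norm)
  hence "exp (\<i> * of_real x) = exp (\<i> * of_real (Arg (cis x)))" by (simp only: cis_conv_exp)
  then obtain n where "\<i> * of_real x = \<i> * of_real (Arg (cis x)) + complex_of_real (of_int (2 * n) * pi) * \<i>"
    by (auto simp: exp_eq)
  hence "x = Arg (cis x) + 2 * pi * of_int n"
    by (simp add: complex_eq_iff algebra_simps)
  thus ?thesis by blast
qed

lemma periodic3_Arg:
  assumes "periodic3 f"
  shows "f (Arg (cis x), Arg (cis y), Arg (cis w)) = f (x, y, w)"
proof -
  obtain a b c where "x = Arg (cis x) + 2 * pi * of_int a" "y = Arg (cis y) + 2 * pi * of_int b" "w = Arg (cis w) + 2 * pi * of_int c"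
    using Arg_cis_shift by meson
  thus ?thesis using periodic3_shift[OF assms, of "Arg (cis x)" a "Arg (cis y)" b "Arg (cis w)" c] by simp
qed

text \<open>A continuous periodic function descends to the compact torus, where Stone-Weierstrass applies.\<close>

lemma trig_poly_approximation:
  assumes f: "continuous_on UNIV f" and per: "periodic3 f" and e: "e > 0"
  obtains g where "trig_poly g" "\<And>p. norm (f p - g p) < e"
proof -
  define q :: "real \<times> real \<times> real \<Rightarrow> complex \<times> complex \<times> complex" where "q = (\<lambda>(x, y, w). (cis x, cis y, cis w))"
  define T :: "(complex \<times> complex \<times> complex) set" where "T = sphere 0 1 \<times> sphere 0 1 \<times> sphere 0 1"
  define K :: "(real \<times> real \<times> real) set" where "K = {-pi..pi} \<times> {-pi..pi} \<times> {-pi..pi}"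
  define F where "F = (\<lambda>(z1, z2, z3). f (Arg z1, Arg z2, Arg z3))"
  have T: "compact T" unfolding T_def by (intro compact_Times compact_sphere)
  have K: "compact K" unfolding K_def by (intro compact_Times compact_Icc)
  have Fq: "F (q p) = f p" for p
    by (cases p) (simp add: F_def q_def periodic3_Arg[OF per])
  have cq: "continuous_on S q" for S
    unfolding q_def case_prod_unfold by (intro continuous_intros)
  have qT: "q p \<in> T" for p by (cases p) (simp add: q_def T_def)
  have onto: "\<exists>p\<in>K. z = q p" if "z \<in> T" for z
  proof -
    obtain z1 z2 z3 where z: "z = (z1, z2, z3)" by (cases z)
    have n: "norm z1 = 1" "norm z2 = 1" "norm z3 = 1" using that by (auto simp: T_def z)
    have c: "cis (Arg z) = z" if "norm z = 1" for z
      using that cis_Arg[of z] by (cases "z = 0") (simp_all add: sgn_div_norm)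
    have A: "Arg z \<in> {-pi..pi}" for z using Arg_bounded[of z] by auto
    show ?thesis
      using n A by (intro bexI[of _ "(Arg z1, Arg z2, Arg z3)"]) (simp_all add: z q_def c K_def)
  qed
  \<comment> \<open>\<open>Arg\<close> jumps on the negative axis, so continuity of \<open>F\<close>
    does not follow by composition. Instead, the preimage of a closed set is the image under
    \<open>q\<close> of a compact part of the cube \<open>K\<close>, hence closed.\<close>
  have "continuous_on T F"
    unfolding continuous_on_closed_vimage[OF compact_imp_closed[OF T]]
  proof (intro allI impI)
    fix B :: "complex set" assume B: "closed B"
    have "F -` B \<inter> T = q ` (K \<inter> f -` B)"
    proof (intro equalityI subsetI)
      fix z assume z: "z \<in> F -` B \<inter> T"
      then obtain p where p: "p \<in> K" "z = q p" using onto by blast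
      hence "f p \<in> B" using z Fq[of p] by simp
      thus "z \<in> q ` (K \<inter> f -` B)" using p by blast
    next
      fix z assume "z \<in> q ` (K \<inter> f -` B)"
      then obtain p where "z = q p" "f p \<in> B" by blast
      thus "z \<in> F -` B \<inter> T" using qT[of p] by (simp add: Fq)
    qed
    moreover have "closed (f -` B)" using f B by (simp add: continuous_on_closed_vimage)
    hence "compact (q ` (K \<inter> f -` B))"
      by (intro compact_continuous_image cq compact_Int_closed K)
    ultimately show "closed (F -` B \<inter> T)" by (simp add: compact_imp_closed)
  qed
  then obtain G where G: "polynomial_function G" "\<And>z. z \<in> T \<Longrightarrow> norm (F z - G z) < e"
    using Stone_Weierstrass_polynomial_function[OF T _ e] by metis
  define g where "g p = G (q p)" for p
  have "real_polynomial_function (Re \<circ> G)" "real_polynomial_function (Im \<circ> G)"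
    using G(1) bounded_linear_Re bounded_linear_Im unfolding polynomial_function_def by blast+
  hence "trig_poly (\<lambda>p. (\<lambda>(x, y, w). of_real ((Re \<circ> G) (cis x, cis y, cis w))) p
      + \<i> * (\<lambda>(x, y, w). of_real ((Im \<circ> G) (cis x, cis y, cis w))) p)"
    by (intro trig_poly_add trig_poly_mult trig_poly_const trig_poly_real_polynomial)
  moreover have "(\<lambda>p. (\<lambda>(x, y, w). of_real ((Re \<circ> G) (cis x, cis y, cis w))) p
      + \<i> * (\<lambda>(x, y, w). of_real ((Im \<circ> G) (cis x, cis y, cis w))) p) = g"
    by (auto simp: fun_eq_iff g_def q_def complex_eq_iff)
  ultimately have "trig_poly g" by simp
  moreover have "norm (f p - g p) < e" for p
    using G(2)[OF qT[of p]] by (simp add: Fq g_def)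
  ultimately show ?thesis using that by blast
qed

section \<open>Iterated integrals over the torus\<close>

definition circle_integral :: "(real \<Rightarrow> complex) \<Rightarrow> complex" where
  "circle_integral h = integral {-pi..pi} h"

definition torus_integral :: "(real \<times> real \<times> real \<Rightarrow> complex) \<Rightarrow> complex" where
  "torus_integral g = circle_integral (\<lambda>x. circle_integral (\<lambda>y. circle_integral (\<lambda>w. g (x, y, w))))"

lemma circle_integral_continuous:
  fixes g :: "'a::topological_space \<times> real \<Rightarrow> complex"
  assumes "continuous_on UNIV g"
  shows "continuous_on UNIV (\<lambda>x. circle_integral (\<lambda>y. g (x, y)))"
proof -
  have "continuous_on (UNIV \<times> cbox (-pi) pi) (\<lambda>(x, y). g (x, y))"
    using continuous_on_subset[OF assms] by (simp add: case_prod_unfold)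
  from integral_continuous_on_param[OF this] show ?thesis by (simp add: circle_integral_def)
qed

lemma circle_integrable: "continuous_on UNIV h \<Longrightarrow> h integrable_on {-pi..(pi::real)}"
  for h :: "real \<Rightarrow> complex"
  by (intro integrable_continuous_real) (rule continuous_on_subset, auto)

lemma circle_integral_add:
  "continuous_on UNIV g \<Longrightarrow> continuous_on UNIV h \<Longrightarrow> circle_integral (\<lambda>x. g x + h x) = circle_integral g + circle_integral h"
  unfolding circle_integral_def by (intro integral_add circle_integrable)

lemma circle_integral_cmult: "circle_integral (\<lambda>x. c * g x) = c * circle_integral g"
  by (simp add: circle_integral_def)

lemma circle_integral_cmult_right: "circle_integral (\<lambda>x. g x * c) = circle_integral g * c"
  by (simp add: circle_integral_def)

lemma circle_integral_bound:
  assumes "continuous_on UNIV h" "\<And>x. norm (h x) \<le> B"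
  shows "norm (circle_integral h) \<le> 2 * pi * B"
  using integral_bound[of "-pi" pi h B] assms unfolding circle_integral_def
  by (auto intro: continuous_on_subset simp: mult.commute)

lemma LBINT_circle:
  assumes "continuous_on UNIV h"
  shows "(LBINT x=-pi..pi. h x) = circle_integral h"
proof -
  have "set_integrable lborel {-pi..pi} h"
    using assms by (intro borel_integrable_atLeastAtMost') (rule continuous_on_subset, auto)
  thus ?thesis using interval_integral_eq_integral[of "-pi" pi h] by (simp add: circle_integral_def)
qed

lemma continuous_on_slice:
  fixes g :: "real \<times> real \<times> real \<Rightarrow> complex"
  assumes "continuous_on UNIV g"
  shows "continuous_on UNIV (\<lambda>w. g (x, y, w))" "continuous_on UNIV (\<lambda>(xy, w). g (fst xy, snd xy, w))"
  by (auto intro!: continuous_on_compose2[OF assms] continuous_intros simp: case_prod_unfold)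

lemma torus_integral_continuous:
  fixes g :: "real \<times> real \<times> real \<Rightarrow> complex"
  assumes "continuous_on UNIV g"
  shows "continuous_on UNIV (\<lambda>y. circle_integral (\<lambda>w. g (x, y, w)))"
    "continuous_on UNIV (\<lambda>x. circle_integral (\<lambda>y. circle_integral (\<lambda>w. g (x, y, w))))"
proof -
  have "continuous_on UNIV (\<lambda>xy :: real \<times> real. circle_integral (\<lambda>w. (\<lambda>(xy, w). g (fst xy, snd xy, w)) (xy, w)))"
    by (rule circle_integral_continuous[OF continuous_on_slice(2)[OF assms]])
  hence *: "continuous_on UNIV (\<lambda>xy :: real \<times> real. circle_integral (\<lambda>w. g (fst xy, snd xy, w)))" by simp
  show "continuous_on UNIV (\<lambda>y. circle_integral (\<lambda>w. g (x, y, w)))"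
  proof -
    have "continuous_on UNIV (\<lambda>y :: real. (x, y))" by (intro continuous_intros)
    from continuous_on_compose2[OF * this] show ?thesis by simp
  qed
  show "continuous_on UNIV (\<lambda>x. circle_integral (\<lambda>y. circle_integral (\<lambda>w. g (x, y, w))))"
    using circle_integral_continuous[OF *] by simp
qed

lemma LBINT_torus:
  assumes "continuous_on UNIV g"
  shows "(LBINT x=-pi..pi. (LBINT y=-pi..pi. (LBINT w=-pi..pi. g (x, y, w)))) = torus_integral g"
  by (simp add: torus_integral_def LBINT_circle continuous_on_slice torus_integral_continuous assms)

lemma torus_integral_add:
  assumes "continuous_on UNIV g" "continuous_on UNIV h"
  shows "torus_integral (\<lambda>p. g p + h p) = torus_integral g + torus_integral h"
  by (simp add: torus_integral_def circle_integral_add continuous_on_slice torus_integral_continuous assms)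

lemma torus_integral_cmult: "torus_integral (\<lambda>p. c * g p) = c * torus_integral g"
  by (simp add: torus_integral_def circle_integral_cmult)

lemma torus_integral_sum:
  assumes "\<And>i. i \<in> I \<Longrightarrow> continuous_on UNIV (g i)"
  shows "torus_integral (\<lambda>p. \<Sum>i\<in>I. g i p) = (\<Sum>i\<in>I. torus_integral (g i))"
  using assms
proof (induction I rule: infinite_finite_induct)
  case (insert i I)
  thus ?case by (simp add: torus_integral_add continuous_intros)
qed (simp_all add: torus_integral_def circle_integral_def)

lemma torus_integral_bound:
  assumes "continuous_on UNIV g" "\<And>p. norm (g p) \<le> B"
  shows "norm (torus_integral g) \<le> (2 * pi) ^ 3 * B"
proof -
  have "norm (torus_integral g) \<le> 2 * pi * (2 * pi * (2 * pi * B))"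
    unfolding torus_integral_def
    by (intro circle_integral_bound torus_integral_continuous continuous_on_slice assms)
  thus ?thesis by (simp add: power3_eq_cube mult.assoc)
qed

lemma circle_integral_cis: "circle_integral (\<lambda>x. cis (of_int k * x)) = (2 * of_real pi) * of_bool (k = 0)"
proof (cases "k = 0")
  case False
  have "((\<lambda>x. cis (of_int k * x)) has_integral
      (cis (of_int k * pi) / (\<i> * of_int k) - cis (of_int k * (- pi)) / (\<i> * of_int k))) {-pi..pi}"
  proof (rule fundamental_theorem_of_calculus)
    fix x assume "x \<in> {-pi..pi}"
    have "((\<lambda>x. cis (of_int k * x) / (\<i> * of_int k)) has_vector_derivative
        (of_int k * (\<i> * cis (of_int k * x))) / (\<i> * of_int k)) (at x within {-pi..pi})"
      unfolding cis_conv_exp by (auto intro!: derivative_eq_intros has_vector_derivative_real_field simp: field_simps)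
    thus "((\<lambda>x. cis (of_int k * x) / (\<i> * of_int k)) has_vector_derivative cis (of_int k * x)) (at x within {-pi..pi})"
      using False by simp
  qed simp
  moreover have "cis (of_int k * pi) = cis (of_int k * (- pi))"
  proof -
    have "cis (of_int k * pi) = cis (of_int k * (- pi)) * cis (2 * pi * of_int k)"
      by (simp add: cis_mult algebra_simps)
    thus ?thesis by (simp add: cis_multiple_2pi)
  qed
  ultimately show ?thesis using False by (simp add: circle_integral_def integral_unique)
qed (simp add: circle_integral_def scaleR_conv_of_real)

lemma torus_integral_character3:
  "torus_integral (character3 a b c) = (2 * of_real pi) ^ 3 * of_bool (a = 0 \<and> b = 0 \<and> c = 0)"
proof -
  have "character3 a b c (x, y, w) = cis (of_int a * x) * (cis (of_int b * y) * cis (of_int c * w))" for x y w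
    by (simp add: character3_def cis_mult add.assoc)
  hence "torus_integral (character3 a b c)
     = circle_integral (\<lambda>x. cis (of_int a * x)) * (circle_integral (\<lambda>y. cis (of_int b * y)) * circle_integral (\<lambda>w. cis (of_int c * w)))"
    by (simp only: torus_integral_def circle_integral_cmult circle_integral_cmult_right)
  thus ?thesis by (auto simp: circle_integral_cis power3_eq_cube)
qed

section \<open>The determinantal kernel\<close>

lemma character3_continuous: "continuous_on S (character3 a b c)"
  unfolding character3_def case_prod_unfold by (intro continuous_intros)

lemma trig_poly_continuous: "trig_poly g \<Longrightarrow> continuous_on UNIV g"
  by (induction rule: trig_poly.induct) (intro continuous_intros character3_continuous; assumption)+

text \<open>The one-sided Dirichlet kernel, whose frequencies are the values of \<open>rho\<close>.
  The phases distinguishing it from the centred kernel cancel in cyclic products.\<close>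

definition dirichlet :: "nat \<Rightarrow> real \<Rightarrow> complex" where
  "dirichlet N t = (\<Sum>i<N. cis (of_nat i * t))"

text \<open>The expanded 3 x 3 determinant whose entries are \<open>dirichlet N\<close> at the
  differences of the angles; the diagonal entries are N.\<close>

definition kernel3 :: "nat \<Rightarrow> real \<times> real \<times> real \<Rightarrow> complex" where
  "kernel3 N = (\<lambda>(x, y, w). of_nat N ^ 3
     - of_nat N * (dirichlet N (x - y) * dirichlet N (y - x) + dirichlet N (x - w) * dirichlet N (w - x)
         + dirichlet N (y - w) * dirichlet N (w - y))
     + dirichlet N (x - y) * dirichlet N (y - w) * dirichlet N (w - x)
     + dirichlet N (x - w) * dirichlet N (w - y) * dirichlet N (y - x))"

lemma kernel3_continuous: "continuous_on S (kernel3 N)"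
  unfolding kernel3_def dirichlet_def case_prod_unfold by (intro continuous_intros)

lemma dirichlet_rho: "dirichlet CARD('n::finite) t = (\<Sum>x\<in>(UNIV::'n set). cis (of_int (rho x) * t))"
proof -
  have "(\<Sum>x\<in>(UNIV::'n set). cis (of_int (rho x) * t)) = (\<Sum>i\<in>{0..<int CARD('n)}. cis (of_int i * t))"
    by (rule sum_rho)
  also have "\<dots> = (\<Sum>i<CARD('n). cis (of_nat i * t))"
    by (rule sum.reindex_bij_witness[of _ int nat]) auto
  finally show ?thesis by (simp add: dirichlet_def)
qed

lemma kernel3_expand:
  "kernel3 CARD('n::finite) p = (\<Sum>x\<in>(UNIV::'n set). \<Sum>y\<in>(UNIV::'n set). \<Sum>w\<in>(UNIV::'n set).
     character3 0 0 0 p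
     - character3 (rho x - rho y) (rho y - rho x) 0 p
     - character3 (rho x - rho w) 0 (rho w - rho x) p
     - character3 0 (rho y - rho w) (rho w - rho y) p
     + character3 (rho x - rho y) (rho y - rho w) (rho w - rho x) p
     + character3 (rho x - rho w) (rho y - rho x) (rho w - rho y) p)"
proof -
  obtain a b c where p: "p = (a, b, c)" by (cases p)
  define e where "e x t = cis (of_int (rho (x :: 'n)) * t)" for x t
  have ch: "character3 (rho x - rho y) (rho y - rho x) 0 p = e x (a - b) * e y (b - a)"
    "character3 (rho x - rho w) 0 (rho w - rho x) p = e x (a - c) * e w (c - a)"
    "character3 0 (rho y - rho w) (rho w - rho y) p = e y (b - c) * e w (c - b)"
    "character3 (rho x - rho y) (rho y - rho w) (rho w - rho x) p = e x (a - c) * (e y (b - a) * e w (c - b))"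
    "character3 (rho x - rho w) (rho y - rho x) (rho w - rho y) p = e x (a - b) * (e y (b - c) * e w (c - a))"
    "character3 0 0 0 p = 1" for x y w :: 'n
    by (simp_all add: p character3_def e_def cis_mult algebra_simps)
  have d: "dirichlet CARD('n) t = (\<Sum>x\<in>UNIV. e x t)" for t by (simp add: dirichlet_rho e_def)
  have s3: "(\<Sum>x\<in>UNIV. f x) * (\<Sum>y\<in>UNIV. g y) * (\<Sum>w\<in>UNIV. h w) = (\<Sum>x\<in>UNIV. \<Sum>y\<in>UNIV. \<Sum>w\<in>UNIV. f x * (g y * h w))"
    for f g h :: "'n \<Rightarrow> complex" by (rule sum_product3)
  have one: "of_nat CARD('n) = (\<Sum>x\<in>(UNIV::'n set). 1 :: complex)" by simp
  have n3: "of_nat CARD('n) ^ 3 = (\<Sum>x\<in>(UNIV::'n set). \<Sum>y\<in>(UNIV::'n set). \<Sum>w\<in>(UNIV::'n set). 1 :: complex)"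
    by (simp add: power3_eq_cube)
  have 1: "of_nat CARD('n) * (dirichlet CARD('n) (a - b) * dirichlet CARD('n) (b - a)) = (\<Sum>x\<in>(UNIV::'n set). \<Sum>y\<in>(UNIV::'n set). \<Sum>w\<in>(UNIV::'n set). e x (a - b) * e y (b - a))"
    using s3[of "\<lambda>x. e x (a - b)" "\<lambda>y. e y (b - a)" "\<lambda>_. 1"] unfolding d by (simp add: mult_ac)
  have 2: "of_nat CARD('n) * (dirichlet CARD('n) (a - c) * dirichlet CARD('n) (c - a)) = (\<Sum>x\<in>(UNIV::'n set). \<Sum>y\<in>(UNIV::'n set). \<Sum>w\<in>(UNIV::'n set). e x (a - c) * e w (c - a))"
    using s3[of "\<lambda>x. e x (a - c)" "\<lambda>_. 1" "\<lambda>w. e w (c - a)"] unfolding d by (simp add: mult_ac)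
  have 3: "of_nat CARD('n) * (dirichlet CARD('n) (b - c) * dirichlet CARD('n) (c - b)) = (\<Sum>x\<in>(UNIV::'n set). \<Sum>y\<in>(UNIV::'n set). \<Sum>w\<in>(UNIV::'n set). e y (b - c) * e w (c - b))"
    using s3[of "\<lambda>_. 1" "\<lambda>y. e y (b - c)" "\<lambda>w. e w (c - b)"] unfolding d by (simp add: mult_ac)
  have 4: "dirichlet CARD('n) (a - c) * dirichlet CARD('n) (c - b) * dirichlet CARD('n) (b - a) = (\<Sum>x\<in>(UNIV::'n set). \<Sum>y\<in>(UNIV::'n set). \<Sum>w\<in>(UNIV::'n set). e x (a - c) * (e y (b - a) * e w (c - b)))"
    using s3[of "\<lambda>x. e x (a - c)" "\<lambda>y. e y (b - a)" "\<lambda>w. e w (c - b)"] unfolding d by (simp only: mult_ac)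
  have 5: "dirichlet CARD('n) (a - b) * dirichlet CARD('n) (b - c) * dirichlet CARD('n) (c - a) = (\<Sum>x\<in>(UNIV::'n set). \<Sum>y\<in>(UNIV::'n set). \<Sum>w\<in>(UNIV::'n set). e x (a - b) * (e y (b - c) * e w (c - a)))"
    using s3[of "\<lambda>x. e x (a - b)" "\<lambda>y. e y (b - c)" "\<lambda>w. e w (c - a)"] unfolding d by (simp only: mult_ac)
  show ?thesis
    unfolding ch sum.distrib sum_subtractf 1[symmetric] 2[symmetric] 3[symmetric] 4[symmetric] 5[symmetric] n3[symmetric]
    by (simp add: kernel3_def p algebra_simps)
qed

text \<open>In each term of the expanded kernel, orthogonality of characters forces precisely the
  shifts that the corresponding product of \<open>hop\<close> records.\<close>

lemma kernel3_character3_integral: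
  "torus_integral (\<lambda>p. kernel3 CARD('n::finite) p * character3 a b c p) = (2 * of_real pi) ^ 3 * hop3 a b c TYPE('n)"
proof -
  let ?c = character3
  have lin: "P * t1 + - 1 * (P * t2) + - 1 * (P * t3) + - 1 * (P * t4) + P * t5 + P * t6
      = P * (t1 - t2 - t3 - t4 + t5 + t6)" for P t1 t2 t3 t4 t5 t6 :: complex
    by (simp add: algebra_simps)
  have "torus_integral (\<lambda>p. kernel3 CARD('n) p * ?c a b c p)
     = torus_integral (\<lambda>p. \<Sum>x\<in>(UNIV::'n set). \<Sum>y\<in>(UNIV::'n set). \<Sum>w\<in>(UNIV::'n set).
       ?c (0 + a) (0 + b) (0 + c) p
     + - 1 * ?c (rho x - rho y + a) (rho y - rho x + b) (0 + c) p
     + - 1 * ?c (rho x - rho w + a) (0 + b) (rho w - rho x + c) p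
     + - 1 * ?c (0 + a) (rho y - rho w + b) (rho w - rho y + c) p
     + ?c (rho x - rho y + a) (rho y - rho w + b) (rho w - rho x + c) p
     + ?c (rho x - rho w + a) (rho y - rho x + b) (rho w - rho y + c) p)"
    unfolding kernel3_expand sum_distrib_right
    by (simp only: distrib_right left_diff_distrib character3_mult[symmetric] mult_minus_left mult_1_left diff_conv_add_uminus)
  also have "\<dots> = (\<Sum>x\<in>(UNIV::'n set). \<Sum>y\<in>(UNIV::'n set). \<Sum>w\<in>(UNIV::'n set).
       torus_integral (?c (0 + a) (0 + b) (0 + c))
     + - 1 * torus_integral (?c (rho x - rho y + a) (rho y - rho x + b) (0 + c))
     + - 1 * torus_integral (?c (rho x - rho w + a) (0 + b) (rho w - rho x + c))
     + - 1 * torus_integral (?c (0 + a) (rho y - rho w + b) (rho w - rho y + c))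
     + torus_integral (?c (rho x - rho y + a) (rho y - rho w + b) (rho w - rho x + c))
     + torus_integral (?c (rho x - rho w + a) (rho y - rho x + b) (rho w - rho y + c)))"
    by (simp only: torus_integral_sum torus_integral_add torus_integral_cmult continuous_on_sum continuous_on_add
        continuous_on_mult continuous_on_const character3_continuous)
  also have "\<dots> = (\<Sum>x\<in>(UNIV::'n set). \<Sum>y\<in>(UNIV::'n set). \<Sum>w\<in>(UNIV::'n set). (2 * of_real pi) ^ 3 * (
     hop x a x * hop y b y * hop w c w - hop x a y * hop y b x * hop w c w
       - hop x a w * hop w c x * hop y b y - hop y b w * hop w c y * hop x a x
       + hop x a y * hop y b w * hop w c x + hop x a w * hop w c y * hop y b x))"
  proof (intro sum.cong refl)
    fix x y w :: 'n
    have h: "of_bool (0 + a = 0 \<and> 0 + b = 0 \<and> 0 + c = 0) = hop x a x * hop y b y * hop w c w"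
      "of_bool (rho x - rho y + a = 0 \<and> rho y - rho x + b = 0 \<and> 0 + c = 0) = hop x a y * hop y b x * hop w c w"
      "of_bool (rho x - rho w + a = 0 \<and> 0 + b = 0 \<and> rho w - rho x + c = 0) = hop x a w * hop w c x * hop y b y"
      "of_bool (0 + a = 0 \<and> rho y - rho w + b = 0 \<and> rho w - rho y + c = 0) = hop y b w * hop w c y * hop x a x"
      "of_bool (rho x - rho y + a = 0 \<and> rho y - rho w + b = 0 \<and> rho w - rho x + c = 0) = hop x a y * hop y b w * hop w c x"
      "of_bool (rho x - rho w + a = 0 \<and> rho y - rho x + b = 0 \<and> rho w - rho y + c = 0) = hop x a w * hop w c y * hop y b x"
      by (auto simp: hop_def of_bool_def)
    show "torus_integral (?c (0 + a) (0 + b) (0 + c))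
     + - 1 * torus_integral (?c (rho x - rho y + a) (rho y - rho x + b) (0 + c))
     + - 1 * torus_integral (?c (rho x - rho w + a) (0 + b) (rho w - rho x + c))
     + - 1 * torus_integral (?c (0 + a) (rho y - rho w + b) (rho w - rho y + c))
     + torus_integral (?c (rho x - rho y + a) (rho y - rho w + b) (rho w - rho x + c))
     + torus_integral (?c (rho x - rho w + a) (rho y - rho x + b) (rho w - rho y + c))
     = (2 * of_real pi) ^ 3 * (hop x a x * hop y b y * hop w c w - hop x a y * hop y b x * hop w c w
       - hop x a w * hop w c x * hop y b y - hop y b w * hop w c y * hop x a x
       + hop x a y * hop y b w * hop w c x + hop x a w * hop w c y * hop y b x)"
      unfolding torus_integral_character3 h by (rule lin)
  qed
  finally show ?thesis by (simp only: hop3_def sum_distrib_left)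
qed

lemma trig_poly_bounded: "trig_poly g \<Longrightarrow> \<exists>B. \<forall>p. norm (g p) \<le> B"
proof (induction rule: trig_poly.induct)
  case (trig_poly_monom k a b c)
  show ?case by (rule exI[of _ "norm k"]) (auto simp: norm_mult character3_def)
next
  case (trig_poly_add g h)
  then obtain B C where "\<And>p. norm (g p) \<le> B" "\<And>p. norm (h p) \<le> C" by blast
  thus ?case by (intro exI[of _ "B + C"] allI norm_triangle_mono)
qed

lemma kernel3_bounded: "\<exists>B. \<forall>p. norm (kernel3 N p) \<le> B"
proof -
  define n where "n = real N"
  have n: "n \<ge> 0" by (simp add: n_def)
  have d: "norm (dirichlet N t) \<le> n" for t
  proof -
    have "norm (dirichlet N t) \<le> (\<Sum>i<N. norm (cis (of_nat i * t)))" unfolding dirichlet_def by (rule norm_sum)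
    thus ?thesis by (simp add: n_def)
  qed
  have d2: "norm (dirichlet N s * dirichlet N t) \<le> n * n" for s t
    unfolding norm_mult by (intro mult_mono d n norm_ge_zero)
  have d3: "norm (dirichlet N s * dirichlet N t * dirichlet N r) \<le> n * n * n" for s t r
    unfolding norm_mult[of "_ * _"] by (intro mult_mono d d2 n norm_ge_zero mult_nonneg_nonneg)
  have "norm (kernel3 N (x, y, w)) \<le> n ^ 3 + n * (n * n + n * n + n * n) + n * n * n + n * n * n" for x y w
    unfolding kernel3_def prod.case
  proof (intro norm_triangle_mono norm_triangle_le_diff add_mono d3)
    show "norm (of_nat N ^ 3 :: complex) \<le> n ^ 3" by (simp add: norm_power n_def)
    show "norm (of_nat N * (dirichlet N (x - y) * dirichlet N (y - x) + dirichlet N (x - w) * dirichlet N (w - x)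
         + dirichlet N (y - w) * dirichlet N (w - y))) \<le> n * (n * n + n * n + n * n)"
      unfolding norm_mult[of "of_nat N"] n_def[symmetric] norm_of_nat
      by (intro mult_left_mono norm_triangle_mono d2 n)
  qed
  thus ?thesis by (metis prod_cases3)
qed

section \<open>Sums over distinct eigenvalues\<close>

context haar_eigenangles
begin

definition distinct_sum :: "(real \<times> real \<times> real \<Rightarrow> complex) \<Rightarrow> complex^'n^'n \<Rightarrow> complex" where
  "distinct_sum g X = (\<Sum>(j1, j2, j3) \<in> {(j1, j2, j3). j1 \<noteq> j2 \<and> j1 \<noteq> j3 \<and> j2 \<noteq> j3}. g (\<theta> X j1, \<theta> X j2, \<theta> X j3))"

text \<open>Inclusion-exclusion over coincidences of the three indices: each coinciding pair is
  subtracted, and the triple coincidence returns with coefficient 2.\<close>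

lemma distinct_sum_character3:
  "distinct_sum (character3 a b c) X = psum a X * psum b X * psum c X
     - psum (a + b) X * psum c X - psum (a + c) X * psum b X - psum (b + c) X * psum a X + 2 * psum (a + b + c) X"
proof -
  define e where "e k x = cis (of_int k * \<theta> X x)" for k x
  have p: "psum k X = (\<Sum>x\<in>UNIV. e k x)" for k by (simp add: psum_def e_def cis_power_int)
  have ee: "e k x * e l x = e (k + l) x" for k l x by (simp add: e_def cis_mult algebra_simps)
  have pair: "(\<Sum>x\<in>UNIV. \<Sum>w\<in>UNIV. if x \<noteq> w then e k x * e l w else 0) = psum k X * psum l X - psum (k + l) X" for k l
    using double_sum_split[of "\<lambda>x w. e k x * e l w"] unfolding p sum_product ee by (simp only: add_diff_cancel_right')
  define G where "G x y w = e a x * (e b y * e c w)" for x y w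
  have "distinct_sum (character3 a b c) X = (\<Sum>(x, y, w)\<in>UNIV. if x \<noteq> y \<and> x \<noteq> w \<and> y \<noteq> w then G x y w else 0)"
    unfolding distinct_sum_def
    by (rule sum.mono_neutral_cong_left) (auto simp: G_def e_def character3_def cis_mult add.assoc)
  also have "\<dots> = (\<Sum>x\<in>UNIV. \<Sum>y\<in>UNIV. \<Sum>w\<in>UNIV. if x \<noteq> y \<and> x \<noteq> w \<and> y \<noteq> w then G x y w else 0)"
    by (simp add: sum.cartesian_product case_prod_unfold flip: UNIV_Times_UNIV)
  also have "\<dots> = (\<Sum>x\<in>UNIV. \<Sum>y\<in>UNIV. \<Sum>w\<in>UNIV. G x y w)
      - (\<Sum>x\<in>UNIV. \<Sum>w\<in>UNIV. if x \<noteq> w then G x x w else 0)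
      - (\<Sum>x\<in>UNIV. \<Sum>y\<in>UNIV. if x \<noteq> y then G x y x else 0)
      - (\<Sum>x\<in>UNIV. \<Sum>y\<in>UNIV. if x \<noteq> y then G x y y else 0)
      - (\<Sum>x\<in>UNIV. G x x x)"
    by (subst triple_sum_split) simp
  also have "(\<Sum>x\<in>UNIV. \<Sum>y\<in>UNIV. \<Sum>w\<in>UNIV. G x y w) = psum a X * psum b X * psum c X"
    unfolding p G_def by (rule sum_product3[symmetric])
  also have "(\<Sum>x\<in>UNIV. \<Sum>w\<in>UNIV. if x \<noteq> w then G x x w else 0) = psum (a + b) X * psum c X - psum (a + b + c) X"
  proof -
    have "G x x w = e (a + b) x * e c w" for x w by (simp add: G_def ee mult.assoc[symmetric])
    thus ?thesis by (simp only: pair)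
  qed
  also have "(\<Sum>x\<in>UNIV. \<Sum>y\<in>UNIV. if x \<noteq> y then G x y x else 0) = psum (a + c) X * psum b X - psum (a + b + c) X"
  proof -
    have "G x y x = e a x * e c x * e b y" for x y by (simp add: G_def)
    hence "G x y x = e (a + c) x * e b y" for x y by (simp only: ee)
    thus ?thesis by (simp only: pair) (simp add: ac_simps)
  qed
  also have "(\<Sum>x\<in>UNIV. \<Sum>y\<in>UNIV. if x \<noteq> y then G x y y else 0) = psum (b + c) X * psum a X - psum (a + b + c) X"
  proof -
    have "G x y y = e a x * e (b + c) y" for x y by (simp only: G_def ee)
    thus ?thesis by (simp only: pair) (simp add: ac_simps)
  qed
  also have "(\<Sum>x\<in>UNIV. G x x x) = psum (a + b + c) X"
    unfolding p by (simp add: G_def ee add.assoc)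
  finally show ?thesis by simp
qed

lemma distinct_sum_character3_continuous: "continuous_on unitary_group (distinct_sum (character3 a b c))"
  unfolding distinct_sum_character3[abs_def] by (intro continuous_intros psum_continuous)

text \<open>The coincidence terms in \<open>power_ops3\<close> and \<open>power_ops2\<close> are
  exactly those removed by inclusion-exclusion, which leaves the determinantal part alone.\<close>

lemma integral_distinct_sum_character3:
  "(LINT X|M. distinct_sum (character3 a b c) X) = hop3 a b c TYPE('n)"
proof -
  interpret prob_space M by (rule haar_prob_prob_space[OF M])
  have int: "integrable M F" if "continuous_on unitary_group F" for F :: "complex^'n^'n \<Rightarrow> complex"
    by (rule haar_integrable[OF M that])
  have c: "continuous_on unitary_group (\<lambda>X. psum a X * psum b X * psum c X)"
    "continuous_on unitary_group (\<lambda>X. psum a X * psum b X)" for a b c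
    by (intro continuous_intros psum_continuous)+
  have one: "(LINT X|M. psum k X) = hop1 k TYPE('n)" for k
    using psum_integral[of "[k]"] power_ops1[of k, where 'n = 'n] by simp
  have "(LINT X|M. distinct_sum (character3 a b c) X)
     = (LINT X|M. psum a X * psum b X * psum c X) - (LINT X|M. psum (a + b) X * psum c X)
       - (LINT X|M. psum (a + c) X * psum b X) - (LINT X|M. psum (b + c) X * psum a X) + 2 * (LINT X|M. psum (a + b + c) X)"
    unfolding distinct_sum_character3 by (simp add: int c psum_continuous)
  thus ?thesis
    unfolding psum_integral3 psum_integral2 power_ops3 power_ops2 one by (simp add: algebra_simps)
qed

lemma distinct_sum_add: "distinct_sum (\<lambda>p. g p + h p) X = distinct_sum g X + distinct_sum h X"
  by (simp add: distinct_sum_def case_prod_unfold sum.distrib)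

lemma distinct_sum_cmult: "distinct_sum (\<lambda>p. k * g p) X = k * distinct_sum g X"
  by (simp add: distinct_sum_def case_prod_unfold sum_distrib_left)

lemma integral_distinct_sum_trig_poly:
  assumes "trig_poly g"
  shows "continuous_on unitary_group (distinct_sum g) \<and>
    (LINT X|M. distinct_sum g X) = 1 / (2 * of_real pi) ^ 3 * torus_integral (\<lambda>p. kernel3 CARD('n) p * g p)"
  using assms
proof (induction rule: trig_poly.induct)
  case (trig_poly_monom k a b c)
  have "torus_integral (\<lambda>p. kernel3 CARD('n) p * (k * character3 a b c p)) = k * ((2 * of_real pi) ^ 3 * hop3 a b c TYPE('n))"
    unfolding kernel3_character3_integral[symmetric] torus_integral_cmult[symmetric] by (simp only: mult.left_commute)
  thus ?case
    unfolding distinct_sum_cmult[abs_def]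
    by (auto simp: integral_distinct_sum_character3 intro!: continuous_intros distinct_sum_character3_continuous)
next
  case (trig_poly_add g h)
  have "torus_integral (\<lambda>p. kernel3 CARD('n) p * (g p + h p))
     = torus_integral (\<lambda>p. kernel3 CARD('n) p * g p) + torus_integral (\<lambda>p. kernel3 CARD('n) p * h p)"
    unfolding distrib_left
    by (intro torus_integral_add continuous_on_mult kernel3_continuous trig_poly_continuous trig_poly_add.hyps)
  thus ?case
    unfolding distinct_sum_add[abs_def] using trig_poly_add.IH
    by (simp add: haar_integrable[OF M] continuous_on_add distrib_left)
qed

lemma distinct_sum_bound:
  assumes "\<And>p. norm (g p) \<le> B"
  shows "norm (distinct_sum g X) \<le> real (card {(j1 :: 'n, j2 :: 'n, j3 :: 'n). j1 \<noteq> j2 \<and> j1 \<noteq> j3 \<and> j2 \<noteq> j3}) * B"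
  unfolding distinct_sum_def case_prod_unfold by (rule sum_norm_bound) (rule assms)

text \<open>Both sides are stable under uniform approximation: on the left there are finitely many
  index triples, on the right a bounded kernel on a domain of finite volume. Trigonometric
  polynomials within 1/(m+1) of \<open>f\<close> carry the identity over.\<close>

lemma integral_distinct_sum:
  assumes f: "continuous_on UNIV f" and per: "periodic3 f"
  shows "(LINT X|M. distinct_sum f X) = 1 / (2 * of_real pi) ^ 3 * torus_integral (\<lambda>p. kernel3 CARD('n) p * f p)"
proof -
  let ?K = "kernel3 CARD('n)"
  let ?C = "real (card {(j1 :: 'n, j2 :: 'n, j3 :: 'n). j1 \<noteq> j2 \<and> j1 \<noteq> j3 \<and> j2 \<noteq> j3})"
  interpret prob_space M by (rule haar_prob_prob_space[OF M])
  have "\<exists>g. trig_poly g \<and> (\<forall>p. norm (f p - g p) < 1 / real (Suc m))" for m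
  proof -
    have "1 / real (Suc m) > 0" by simp
    from trig_poly_approximation[OF f per this] show ?thesis by blast
  qed
  then obtain g where g: "\<And>m. trig_poly (g m)" "\<And>m p. norm (f p - g m p) < 1 / real (Suc m)"
    by metis
  obtain K where "\<forall>p. norm (?K p) \<le> K" using kernel3_bounded[of "CARD('n)"] by (rule exE)
  hence K: "norm (?K p) \<le> K" for p by (rule spec)
  have small: "(\<lambda>m. B * (1 / real (Suc m))) \<longlonglongrightarrow> 0" for B :: real
    using tendsto_mult[OF tendsto_const[of B] LIMSEQ_Suc[OF lim_1_over_n]] by simp
  have diff: "distinct_sum f X - distinct_sum (g m) X = distinct_sum (\<lambda>p. f p - g m p) X" for m X
    by (simp add: distinct_sum_def case_prod_unfold sum_subtractf)
  have near: "norm (distinct_sum f X - distinct_sum (g m) X) \<le> ?C * (1 / real (Suc m))" for m X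
    unfolding diff by (rule distinct_sum_bound) (rule less_imp_le[OF g(2)])
  have lim: "(\<lambda>m. distinct_sum (g m) X) \<longlonglongrightarrow> distinct_sum f X" for X
  proof (rule LIM_zero_cancel, rule Lim_null_comparison[OF _ small[of ?C]])
    show "\<forall>\<^sub>F m in sequentially. norm (distinct_sum (g m) X - distinct_sum f X) \<le> ?C * (1 / real (Suc m))"
      unfolding norm_minus_commute[of _ "distinct_sum f X"] by (intro always_eventually allI near)
  qed
  have "(\<lambda>m. LINT X|M. distinct_sum (g m) X) \<longlonglongrightarrow> (LINT X|M. distinct_sum f X)"
  proof -
    obtain B where B: "\<And>p. norm (g 0 p) \<le> B"
      using trig_poly_bounded[OF g(1)] by blast
    \<comment> \<open>A bound independent of \<open>m\<close>, obtained from \<open>g 0\<close>: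
      passing through \<open>f\<close> costs two approximation errors of at most 1 each.\<close>
    have "norm (g m p) \<le> B + 2" for m p
    proof -
      have "norm (g m p) \<le> norm (g 0 p + (f p - g 0 p)) + norm (f p - g m p)"
        using norm_triangle_ineq4[of "g 0 p + (f p - g 0 p)" "f p - g m p"] by simp
      also have "norm (g 0 p + (f p - g 0 p)) \<le> norm (g 0 p) + norm (f p - g 0 p)" by (rule norm_triangle_ineq)
      finally have "norm (g m p) \<le> norm (g 0 p) + norm (f p - g 0 p) + norm (f p - g m p)" by simp
      moreover have "1 / real (Suc m) \<le> 1" "1 / real (Suc 0) = 1" by simp_all
      ultimately show ?thesis using B[of p] g(2)[of p 0] g(2)[of p m] by linarith
    qed
    hence "norm (distinct_sum (g m) X) \<le> ?C * (B + 2)" for m X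
      by (rule distinct_sum_bound)
    thus ?thesis
      by (intro integral_limit[where B = "?C * (B + 2)"] lim conjunct1[OF integral_distinct_sum_trig_poly[OF g(1)]])
  qed
  moreover have "(\<lambda>m. 1 / (2 * of_real pi) ^ 3 * torus_integral (\<lambda>p. ?K p * g m p)) \<longlonglongrightarrow> 1 / (2 * of_real pi) ^ 3 * torus_integral (\<lambda>p. ?K p * f p)"
  proof (rule tendsto_mult[OF tendsto_const], rule LIM_zero_cancel, rule Lim_null_comparison[OF _ small[of "(2 * pi) ^ 3 * K"]])
    have "norm (torus_integral (\<lambda>p. ?K p * g m p) - torus_integral (\<lambda>p. ?K p * f p)) \<le> ((2 * pi) ^ 3 * K) * (1 / real (Suc m))" for m
    proof -
      have c: "continuous_on UNIV (\<lambda>p. ?K p * f p)" "continuous_on UNIV (\<lambda>p. ?K p * (g m p - f p))"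
        by (intro continuous_intros kernel3_continuous f trig_poly_continuous g)+
      have "torus_integral (\<lambda>p. ?K p * g m p) = torus_integral (\<lambda>p. ?K p * f p + ?K p * (g m p - f p))"
        by (simp add: algebra_simps)
      also have "\<dots> = torus_integral (\<lambda>p. ?K p * f p) + torus_integral (\<lambda>p. ?K p * (g m p - f p))"
        by (rule torus_integral_add[OF c])
      also have "norm (\<dots> - torus_integral (\<lambda>p. ?K p * f p)) \<le> (2 * pi) ^ 3 * (K * (1 / real (Suc m)))"
      proof -
        have "norm (?K p * (g m p - f p)) \<le> K * (1 / real (Suc m))" for p
          unfolding norm_mult using K[of p] less_imp_le[OF g(2)[of p m]] order_trans[OF norm_ge_zero K[of p]]
          by (intro mult_mono) (simp_all add: norm_minus_commute)
        from torus_integral_bound[OF c(2) this] show ?thesis by simp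
      qed
      finally show ?thesis by simp
    qed
    thus "\<forall>\<^sub>F m in sequentially. norm (torus_integral (\<lambda>p. ?K p * g m p) - torus_integral (\<lambda>p. ?K p * f p)) \<le> ((2 * pi) ^ 3 * K) * (1 / real (Suc m))"
      by simp
  qed
  ultimately show ?thesis
    using integral_distinct_sum_trig_poly[OF g(1)] by (auto intro: LIMSEQ_unique)
qed

end

section \<open>The bracket away from and at coincidences\<close>

lemma J3_rational:
  assumes e: "exp \<alpha>1 = a" "exp \<alpha>2 = b" "exp \<beta> = 1 / c" and ne: "a \<noteq> b" "a \<noteq> c" "b \<noteq> c"
  shows "J3 N \<alpha>1 \<alpha>2 \<beta> = a * b * c / ((a - c) * (b - c) * (b - a)) * (c ^ N / a ^ N - c ^ N / b ^ N)"
proof -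
  have z: "a \<noteq> 0" "b \<noteq> 0" using e by auto
  have "1 / c \<noteq> 0" unfolding e(3)[symmetric] by simp
  hence c: "c \<noteq> 0" by auto
  have "(\<alpha>1, \<alpha>2, \<beta>) \<in> J3_regular"
    using ne z c by (simp add: J3_regular_def exp_diff exp_add e)
  hence "J3 N \<alpha>1 \<alpha>2 \<beta> = J3_cont N (exp (- (\<alpha>1 + \<beta>))) (exp (- (\<alpha>2 + \<beta>)))"
    by (simp add: J3_def fill_in_def J3_formula_eq_J3_cont)
  also have "exp (- (\<alpha>1 + \<beta>)) = c / a" unfolding exp_minus exp_add e by (simp add: field_simps)
  also have "exp (- (\<alpha>2 + \<beta>)) = c / b" unfolding exp_minus exp_add e by (simp add: field_simps)
  also have "J3_cont N (c / a) (c / b) = (c / a) * (c / b) * (c ^ N / a ^ N - c ^ N / b ^ N) / ((1 - c / a) * (1 - c / b) * (c / a - c / b))"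
    using ne z c by (subst J3_cont_eq) (auto simp: power_divide field_simps)
  also have "(1 - c / a) * (1 - c / b) * (c / a - c / b) = (c / a) * (c / b) * ((a - c) * (b - c) * (b - a)) / (a * b * c)"
    using z c by (simp add: field_simps)
  finally show ?thesis using z c ne by (simp add: mult_ac)
qed

text \<open>The expression q/(1-q)^2 is invariant under inversion of q. With Q = q^N both sides
  equal q (2 - Q - 1/Q)/(1-q)^2, which on the unit circle is minus N times the Fejer kernel.\<close>

lemma J2_cont_reflection:
  assumes "q \<noteq> 0" "q \<noteq> 1"
  shows "J2_cont N q + J2_cont N (1 / q) = - ((\<Sum>i<N. q ^ i) * (\<Sum>i<N. (1 / q) ^ i))"
proof -
  define Q where "Q = q ^ N"
  have Q: "Q \<noteq> 0" using assms by (simp add: Q_def)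
  have s: "(\<Sum>i<N. q ^ i) = (Q - 1) / (q - 1)" using assms by (simp add: geometric_sum Q_def)
  have s': "(\<Sum>i<N. (1 / q) ^ i) = (1 / Q - 1) / (1 / q - 1)"
    using assms by (subst geometric_sum) (simp_all add: Q_def power_one_over)
  show ?thesis
    unfolding J2_cont_def s s' using assms Q by (simp add: divide_simps) (simp add: algebra_simps)
qed

lemma J2_pair:
  assumes e: "exp \<alpha> = a" "exp \<beta> = c" and ne: "a \<noteq> c"
  shows "J2 N (- \<alpha>) \<beta> + J2 N (- \<beta>) \<alpha> = - ((\<Sum>i<N. (a / c) ^ i) * (\<Sum>i<N. (c / a) ^ i))"
proof -
  have z: "a \<noteq> 0" "c \<noteq> 0" using e by auto
  have 1: "exp (- (- \<alpha> + \<beta>)) = a / c" "exp (- (- \<beta> + \<alpha>)) = c / a"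
    using e by (simp_all add: exp_diff)
  have ne1: "a / c \<noteq> 1" "c / a \<noteq> 1" using ne z by auto
  have "J2 N (- \<alpha>) \<beta> + J2 N (- \<beta>) \<alpha> = J2_cont N (a / c) + J2_cont N (1 / (a / c))"
    using J2_eq_J2_cont[of "- \<alpha>" \<beta> N, unfolded 1, OF ne1(1)] J2_eq_J2_cont[of "- \<beta>" \<alpha> N, unfolded 1, OF ne1(2)]
    by simp
  thus ?thesis using J2_cont_reflection[of "a / c" N] z ne1 by simp
qed

lemma dirichlet_diff: "dirichlet N (x - y) = (\<Sum>i<N. (cis x / cis y) ^ i)"
  unfolding dirichlet_def cis_divide by (intro sum.cong refl) (simp add: Complex.DeMoivre)

text \<open>Away from coincidences everything is rational in \<open>a\<close>, \<open>b\<close>,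
  \<open>c\<close> and their N-th powers. In the determinant, N^3 belongs to the identity
  permutation, the paired \<open>J2\<close> terms to the transpositions, and the six
  \<open>J3\<close> terms together to the two three-cycles.\<close>

lemma J_bracket_eq_kernel3:
  assumes "p \<in> noncoincident"
  shows "J_bracket N p = kernel3 N p"
proof -
  obtain x y w where p: "p = (x, y, w)" by (cases p)
  define a b c where "a = cis x" and "b = cis y" and "c = cis w"
  define A B C where "A = a ^ N" and "B = b ^ N" and "C = c ^ N"
  have ne: "a \<noteq> b" "a \<noteq> c" "b \<noteq> c" "b \<noteq> a" "c \<noteq> a" "c \<noteq> b"
    using assms by (auto simp: p noncoincident_def a_def b_def c_def)
  have z: "a \<noteq> 0" "b \<noteq> 0" "c \<noteq> 0" by (simp_all add: a_def b_def c_def)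
  have Z: "A \<noteq> 0" "B \<noteq> 0" "C \<noteq> 0" using z by (simp_all add: A_def B_def C_def)
  define t1 t2 t3 where "t1 = \<i> * complex_of_real x" and "t2 = \<i> * complex_of_real y" and "t3 = \<i> * complex_of_real w"
  have e: "exp t1 = a" "exp t2 = b" "exp t3 = c"
    by (simp_all add: t1_def t2_def t3_def a_def b_def c_def cis_conv_exp)
  have e': "exp (- t1) = 1 / a" "exp (- t2) = 1 / b" "exp (- t3) = 1 / c"
    by (simp_all add: exp_minus e inverse_eq_divide)
  \<comment> \<open>Permuting or inverting \<open>a\<close>, \<open>b\<close>, \<open>c\<close>
    changes this by at most a sign, which makes it the common factor of all six \<open>J3\<close>
    terms and of both cyclic products.\<close>
  define \<kappa> where "\<kappa> = a * b * c / ((a - b) * (b - c) * (c - a))"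
  have up: "J3 N t1 t2 (- t3) = \<kappa> * (C / A - C / B)" "J3 N t1 t3 (- t2) = \<kappa> * (B / C - B / A)" "J3 N t2 t3 (- t1) = \<kappa> * (A / B - A / C)"
  proof -
    have "J3 N t1 t2 (- t3) = a * b * c / ((a - c) * (b - c) * (b - a)) * (C / A - C / B)"
      unfolding A_def B_def C_def by (rule J3_rational) (simp_all add: e e' ne)
    also have "a * b * c / ((a - c) * (b - c) * (b - a)) = \<kappa>"
      unfolding \<kappa>_def by (rule arg_cong2[of _ _ _ _ "(/)"]) (simp_all add: algebra_simps)
    finally show "J3 N t1 t2 (- t3) = \<kappa> * (C / A - C / B)" .
    have "J3 N t1 t3 (- t2) = a * c * b / ((a - b) * (c - b) * (c - a)) * (B / A - B / C)"
      unfolding A_def B_def C_def by (rule J3_rational) (simp_all add: e e' ne)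
    also have "a * c * b / ((a - b) * (c - b) * (c - a)) = - \<kappa>"
      unfolding \<kappa>_def minus_divide_right by (rule arg_cong2[of _ _ _ _ "(/)"]) (simp_all add: algebra_simps)
    finally show "J3 N t1 t3 (- t2) = \<kappa> * (B / C - B / A)" by (simp add: algebra_simps)
    have "J3 N t2 t3 (- t1) = b * c * a / ((b - a) * (c - a) * (c - b)) * (A / B - A / C)"
      unfolding A_def B_def C_def by (rule J3_rational) (simp_all add: e e' ne)
    also have "b * c * a / ((b - a) * (c - a) * (c - b)) = \<kappa>"
      unfolding \<kappa>_def by (rule arg_cong2[of _ _ _ _ "(/)"]) (simp_all add: algebra_simps)
    finally show "J3 N t2 t3 (- t1) = \<kappa> * (A / B - A / C)" .
  qed
  \<comment> \<open>The \<open>J3\<close> terms with reversed signs are the previous ones at the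
    reciprocals of \<open>a\<close>, \<open>b\<close>, \<open>c\<close>.\<close>
  have inv: "1 / u * (1 / v) * (1 / r) / ((1 / u - 1 / r) * (1 / v - 1 / r) * (1 / v - 1 / u)) = u * v * r / ((r - u) * (r - v) * (u - v))"
    if "u \<noteq> 0" "v \<noteq> 0" "r \<noteq> 0" for u v r :: complex
  proof -
    have "(1 / u - 1 / r) * (1 / v - 1 / r) * (1 / v - 1 / u) = ((r - u) * (r - v) * (u - v)) / ((u * v * r) * (u * v * r))"
      using that by (simp add: divide_simps)
    thus ?thesis using that by (simp add: divide_simps)
  qed
  have low: "J3 N (- t1) (- t2) t3 = \<kappa> * (B / C - A / C)" "J3 N (- t1) (- t3) t2 = \<kappa> * (A / B - C / B)" "J3 N (- t2) (- t3) t1 = \<kappa> * (C / A - B / A)"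
  proof -
    have "J3 N (- t1) (- t2) t3 = 1 / a * (1 / b) * (1 / c) / ((1 / a - 1 / c) * (1 / b - 1 / c) * (1 / b - 1 / a)) * ((1 / c) ^ N / (1 / a) ^ N - (1 / c) ^ N / (1 / b) ^ N)"
      by (rule J3_rational) (use ne z in \<open>auto simp: e e'\<close>)
    also have "\<dots> = a * b * c / ((c - a) * (c - b) * (a - b)) * (A / C - B / C)"
      unfolding inv[OF z] by (simp add: A_def B_def C_def power_one_over)
    also have "a * b * c / ((c - a) * (c - b) * (a - b)) = - \<kappa>"
      unfolding \<kappa>_def minus_divide_right by (rule arg_cong2[of _ _ _ _ "(/)"]) (simp_all add: algebra_simps)
    finally show "J3 N (- t1) (- t2) t3 = \<kappa> * (B / C - A / C)" by (simp add: algebra_simps)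
    have "J3 N (- t1) (- t3) t2 = 1 / a * (1 / c) * (1 / b) / ((1 / a - 1 / b) * (1 / c - 1 / b) * (1 / c - 1 / a)) * ((1 / b) ^ N / (1 / a) ^ N - (1 / b) ^ N / (1 / c) ^ N)"
      by (rule J3_rational) (use ne z in \<open>auto simp: e e'\<close>)
    also have "\<dots> = a * c * b / ((b - a) * (b - c) * (a - c)) * (A / B - C / B)"
      unfolding inv[OF z(1) z(3) z(2)] by (simp add: A_def B_def C_def power_one_over)
    also have "a * c * b / ((b - a) * (b - c) * (a - c)) = \<kappa>"
      unfolding \<kappa>_def by (rule arg_cong2[of _ _ _ _ "(/)"]) (simp_all add: algebra_simps)
    finally show "J3 N (- t1) (- t3) t2 = \<kappa> * (A / B - C / B)" .
    have "J3 N (- t2) (- t3) t1 = 1 / b * (1 / c) * (1 / a) / ((1 / b - 1 / a) * (1 / c - 1 / a) * (1 / c - 1 / b)) * ((1 / a) ^ N / (1 / b) ^ N - (1 / a) ^ N / (1 / c) ^ N)"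
      by (rule J3_rational) (use ne z in \<open>auto simp: e e'\<close>)
    also have "\<dots> = b * c * a / ((a - b) * (a - c) * (b - c)) * (B / A - C / A)"
      unfolding inv[OF z(2) z(3) z(1)] by (simp add: A_def B_def C_def power_one_over)
    also have "b * c * a / ((a - b) * (a - c) * (b - c)) = - \<kappa>"
      unfolding \<kappa>_def minus_divide_right by (rule arg_cong2[of _ _ _ _ "(/)"]) (simp_all add: algebra_simps)
    finally show "J3 N (- t2) (- t3) t1 = \<kappa> * (C / A - B / A)" by (simp add: algebra_simps)
  qed
  have J2s: "J2 N (- t1) t3 + J2 N (- t2) t3 + J2 N (- t1) t2 + J2 N (- t3) t2 + J2 N (- t2) t1 + J2 N (- t3) t1
     = - (dirichlet N (x - y) * dirichlet N (y - x) + dirichlet N (x - w) * dirichlet N (w - x) + dirichlet N (y - w) * dirichlet N (w - y))"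
  proof -
    have "J2 N (- t1) t3 + J2 N (- t2) t3 + J2 N (- t1) t2 + J2 N (- t3) t2 + J2 N (- t2) t1 + J2 N (- t3) t1
      = (J2 N (- t1) t2 + J2 N (- t2) t1) + (J2 N (- t1) t3 + J2 N (- t3) t1) + (J2 N (- t2) t3 + J2 N (- t3) t2)"
      by (simp only: ac_simps)
    thus ?thesis
      unfolding J2_pair[OF e(1) e(2) ne(1)] J2_pair[OF e(1) e(3) ne(2)] J2_pair[OF e(2) e(3) ne(3)]
        dirichlet_diff a_def[symmetric] b_def[symmetric] c_def[symmetric]
      by (simp only: minus_add_distrib)
  qed
  have S: "(\<Sum>i<N. (u / v) ^ i) = (u ^ N - v ^ N) * v / (v ^ N * (u - v))" if "u \<noteq> v" "v \<noteq> 0" for u v :: complex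
  proof -
    have "(\<Sum>i<N. (u / v) ^ i) = ((u / v) ^ N - 1) / (u / v - 1)" using that by (simp add: geometric_sum)
    also have "\<dots> = (u ^ N - v ^ N) * v / (v ^ N * (u - v))"
      using that by (simp add: power_divide divide_simps)
    finally show ?thesis .
  qed
  have cyc: "dirichlet N (x - y) * dirichlet N (y - w) * dirichlet N (w - x) = \<kappa> * ((A - B) * (B - C) * (C - A) / (A * B * C))"
    "dirichlet N (x - w) * dirichlet N (w - y) * dirichlet N (y - x) = \<kappa> * ((A - B) * (B - C) * (C - A) / (A * B * C))"
  proof -
    show "dirichlet N (x - y) * dirichlet N (y - w) * dirichlet N (w - x) = \<kappa> * ((A - B) * (B - C) * (C - A) / (A * B * C))"
      unfolding dirichlet_diff a_def[symmetric] b_def[symmetric] c_def[symmetric] S[OF ne(1) z(2)] S[OF ne(3) z(3)] S[OF ne(5) z(1)]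
        A_def[symmetric] B_def[symmetric] C_def[symmetric] \<kappa>_def
      by (simp add: mult_ac)
    have "dirichlet N (x - w) * dirichlet N (w - y) * dirichlet N (y - x)
       = ((A - C) * (C - B) * (B - A)) * (a * b * c) / ((A * B * C) * ((a - c) * (c - b) * (b - a)))"
      unfolding dirichlet_diff a_def[symmetric] b_def[symmetric] c_def[symmetric] S[OF ne(2) z(3)] S[OF ne(6) z(2)] S[OF ne(4) z(1)]
        A_def[symmetric] B_def[symmetric] C_def[symmetric]
      by (simp add: mult_ac)
    also have "(A - C) * (C - B) * (B - A) = - ((A - B) * (B - C) * (C - A))" by (simp add: algebra_simps)
    also have "(a - c) * (c - b) * (b - a) = - ((a - b) * (b - c) * (c - a))" by (simp add: algebra_simps)
    finally show "dirichlet N (x - w) * dirichlet N (w - y) * dirichlet N (y - x) = \<kappa> * ((A - B) * (B - C) * (C - A) / (A * B * C))"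
      unfolding \<kappa>_def by (simp add: mult_ac)
  qed
  \<comment> \<open>The six \<open>J3\<close> terms add up to \<open>\<kappa>\<close> times twice
    this sum of quotients, one copy for each three-cycle.\<close>
  have six: "(A - B) * (B - C) * (C - A) / (A * B * C) = A / B + B / C + C / A - A / C - C / B - B / A"
    using Z by (simp add: divide_simps) (simp add: algebra_simps)
  have "J_bracket N p = \<kappa> * (C / A - C / B) + \<kappa> * (B / C - B / A) + \<kappa> * (A / B - A / C)
     + \<kappa> * (B / C - A / C) + \<kappa> * (A / B - C / B) + \<kappa> * (C / A - B / A)
     + of_nat N * (- (dirichlet N (x - y) * dirichlet N (y - x) + dirichlet N (x - w) * dirichlet N (w - x) + dirichlet N (y - w) * dirichlet N (w - y)))
     + of_nat N ^ 3"
    unfolding J_bracket_def p prod.case Let_def t1_def[symmetric] t2_def[symmetric] t3_def[symmetric] up low J2s ..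
  also have "\<dots> = kernel3 N p"
    unfolding kernel3_def p prod.case cyc six by (simp add: algebra_simps)
  finally show ?thesis .
qed

text \<open>Points moving on the circle at different speeds separate at once, even from a common
  start: for 0 < t < pi/|r-s| the angle between them lies strictly between 0 and pi.\<close>

lemma eventually_cis_ne:
  assumes "r \<noteq> s"
  shows "\<forall>\<^sub>F t in at_right 0. cis (x + r * t) \<noteq> cis (y + s * t)"
proof (cases "cis x = cis y")
  case False
  have "((\<lambda>t. cis (x + r * t) - cis (y + s * t)) \<longlongrightarrow> cis (x + r * 0) - cis (y + s * 0)) (at_right 0)"
    by (intro tendsto_intros)
  hence "\<forall>\<^sub>F t in at_right 0. cis (x + r * t) - cis (y + s * t) \<noteq> 0"
    by (rule tendsto_imp_eventually_ne) (use False in simp)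
  thus ?thesis by eventually_elim simp
next
  case True
  define d where "d = r - s"
  have "cis (x + r * t) \<noteq> cis (y + s * t)" if t: "0 < t" "t < pi / \<bar>d\<bar>" for t
  proof
    assume "cis (x + r * t) = cis (y + s * t)"
    hence "cis x * cis (r * t) = cis y * cis (s * t)" by (simp add: cis_mult)
    hence "cis (r * t) = cis (s * t)" using True by simp
    hence "cis (r * t) / cis (s * t) = 1" by simp
    hence "cis (d * t) = 1" by (simp add: cis_divide d_def left_diff_distrib)
    hence c1: "cos \<bar>d * t\<bar> = cos 0" by (simp add: complex_eq_iff abs_if)
    have c2: "\<bar>d * t\<bar> \<le> pi"
    proof -
      have "\<bar>d\<bar> > 0" using assms by (simp add: d_def)
      hence "t * \<bar>d\<bar> < pi" using t(2) by (simp add: pos_less_divide_eq)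
      thus ?thesis using t(1) by (simp add: abs_mult mult.commute)
    qed
    have "\<bar>d * t\<bar> = 0"
      by (rule cos_inj_pi[OF abs_ge_zero c2 order_refl pi_ge_zero c1])
    thus False using t(1) assms by (simp add: d_def)
  qed
  moreover have "pi / \<bar>d\<bar> > 0" using assms by (simp add: d_def)
  ultimately show ?thesis unfolding eventually_at_right_field by blast
qed

lemma fill_in_J_bracket: "fill_in noncoincident (J_bracket N) p = kernel3 N p"
proof (rule fill_in_eq)
  show "continuous (at p within noncoincident) (kernel3 N)"
  proof (rule continuous_within_subset)
    show "continuous (at p within UNIV) (kernel3 N)"
      using kernel3_continuous[of UNIV N] unfolding continuous_on_eq_continuous_within by (rule bspec) simp
  qed simp
  assume p: "p \<notin> noncoincident"
  obtain x y w where xyw: "p = (x, y, w)" by (cases p)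
  \<comment> \<open>The three angles move with the pairwise distinct speeds 0, 1, 2, so all
    coincidences dissolve simultaneously.\<close>
  show "at p within noncoincident \<noteq> bot"
  proof (rule at_within_nontrivial[where f = "\<lambda>t. (x + 0 * t, y + 1 * t, w + 2 * t)"])
    show "((\<lambda>t. (x + 0 * t, y + 1 * t, w + 2 * t)) \<longlongrightarrow> p) (at_right 0)"
      unfolding xyw by (auto intro!: tendsto_eq_intros)
    have "\<forall>\<^sub>F t in at_right 0. cis (x + 0 * t) \<noteq> cis (y + 1 * t)" "\<forall>\<^sub>F t in at_right 0. cis (x + 0 * t) \<noteq> cis (w + 2 * t)"
      "\<forall>\<^sub>F t in at_right 0. cis (y + 1 * t) \<noteq> cis (w + 2 * t)"
      by (rule eventually_cis_ne; simp)+
    thus "\<forall>\<^sub>F t in at_right 0. (x + 0 * t, y + 1 * t, w + 2 * t) \<in> noncoincident"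
      by eventually_elim (simp add: noncoincident_def)
  qed (rule p)
qed (rule J_bracket_eq_kernel3)

theorem theorem2p2:
  fixes M :: "(complex^'n^'n) measure"
    and N :: nat
    and f :: "real \<times> real \<times> real \<Rightarrow> complex"
    and \<theta> :: "complex^'n^'n \<Rightarrow> 'n \<Rightarrow> real"
  assumes N: "N = CARD('n)"
    and haar: "haar_prob M"
    and smooth: "smooth f"
    and periodic: "periodic3 f"
    and eigenangles: "\<And>X. X \<in> unitary_group \<Longrightarrow> eigenangles X (\<theta> X)"
  shows
    "(\<forall>\<alpha>1 \<alpha>2 \<beta> :: complex. Re \<alpha>1 > 0 \<and> Re \<alpha>2 > 0 \<and> Re \<beta> > 0 \<longrightarrow>
        - exp (- \<alpha>1 - \<alpha>2 - \<beta>)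
          * (LINT X|M. Lam_logderiv X (exp (- \<alpha>1)) * Lam_logderiv X (exp (- \<alpha>2))
                       * Lam_logderiv (ctranspose X) (exp (- \<beta>)))
        = J3 N \<alpha>1 \<alpha>2 \<beta>)
   \<and> (\<forall>\<alpha> \<beta> :: complex. Re \<alpha> > 0 \<and> Re \<beta> > 0 \<longrightarrow>
        exp (- \<alpha> - \<beta>)
          * (LINT X|M. Lam_logderiv X (exp (- \<alpha>)) * Lam_logderiv (ctranspose X) (exp (- \<beta>)))
        = J2 N \<alpha> \<beta>)
   \<and> (LINT X|M. (\<Sum>(j1, j2, j3) \<in> {(j1, j2, j3). j1 \<noteq> j2 \<and> j1 \<noteq> j3 \<and> j2 \<noteq> j3}.
                    f (\<theta> X j1, \<theta> X j2, \<theta> X j3)))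
      = 1 / (2 * of_real pi) ^ 3
        * (LBINT \<theta>1=-pi..pi. (LBINT \<theta>2=-pi..pi. (LBINT \<theta>3=-pi..pi.
             fill_in noncoincident (J_bracket N) (\<theta>1, \<theta>2, \<theta>3) * f (\<theta>1, \<theta>2, \<theta>3))))"
proof -
  interpret haar_eigenangles M \<theta> by unfold_locales (fact haar, fact eigenangles)
  have "times_differentiable 0 f" using smooth unfolding smooth_def ..
  hence f: "continuous_on UNIV f" by simp
  have c: "continuous_on UNIV (\<lambda>p. kernel3 CARD('n) p * f p)"
    by (intro continuous_on_mult kernel3_continuous f)
  have "(LINT X|M. (\<Sum>(j1, j2, j3) \<in> {(j1, j2, j3). j1 \<noteq> j2 \<and> j1 \<noteq> j3 \<and> j2 \<noteq> j3}. f (\<theta> X j1, \<theta> X j2, \<theta> X j3)))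
      = 1 / (2 * of_real pi) ^ 3
        * (LBINT \<theta>1=-pi..pi. (LBINT \<theta>2=-pi..pi. (LBINT \<theta>3=-pi..pi.
             fill_in noncoincident (J_bracket N) (\<theta>1, \<theta>2, \<theta>3) * f (\<theta>1, \<theta>2, \<theta>3))))"
    using integral_distinct_sum[OF f periodic]
    by (simp add: distinct_sum_def fill_in_J_bracket N LBINT_torus[OF c])
  thus ?thesis using triple_formula pair_formula N by simp
qed

end
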